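(* Let $k$ be an algebraically closed field of characteristic zero, let $v,w\in\mathcal S_n$, and suppose that $X_v$ is an irreducible component of the singular locus $\mathrm{Sing}(X_w)$ of the Schubert variety $X_w$ in the variety $\mathbb F_n$ of complete flags of $k^n$, such that $v$ is obtained from $w$ through a minimal configuration of one of the types $4231$ (with parameters $l,m>0$), $34{*}12$ (with parameter $l\ge 0$) or $34\emptyset12$ (with parameters $l,m\ge 0$) defined in the context. Then each point of the Schubert cell $\Omega_v$ has an affine (Zariski open) neighbourhood in $\mathbb F_n$ whose intersection with $X_w$ is isomorphic to the product of the affine cell $\Omega_v$, of dimension $\ell(v)$, with, respectively: (1) for type $4231$: the cone of matrices of size $(l+1)\times(m+1)$ and rank at most one; (2) for type $34{*}12$: a quadratic cone of dimension $2l+3$; (3) for type $34\emptyset 12$: the cone of matrices of size $2\times(l+m+2)$ and rank at most one.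
   Context: Fix a complete reference flag $V_\bullet$ of $k^n$. For $w\in\mathcal S_n$ put $r_w(p,q)=\#\{i\le p,\ w(i)\le q\}$. The Schubert variety is $X_w=\{W_\bullet\in\mathbb F_n:\ \dim(W_p\cap V_q)\ge r_w(p,q),\ 1\le p,q\le n\}$ (a reduced irreducible closed subvariety); it is the Zariski closure of the affine cell $\Omega_w=\{W_\bullet:\ \dim(W_p\cap V_q)=r_w(p,q)\ \forall p,q\}$, which has dimension $\ell(w)$, the number of inversions of $w$. The diagram of $w$ is the set of points $(i,w(i))$, $1\le i\le n$. Configurations. A configuration consists of $N$ points of the diagram of $w$, with rows $x_1<\dots<x_N$ and columns $y_1<\dots<y_N$, such that $w(x_a)=y_{\omega(a)}$ for $1\le a\le N$, where $\omega\in\mathcal S_N$ is a prescribed permutation. The associated permutation $v\in\mathcal S_n$ is defined by $v(x_a)=y_{\nu(a)}$ for $1\le a\le N$, with $\nu\in\mathcal S_N$ prescribed, and $v(i)=w(i)$ for $i\notin\{x_1,\dots,x_N\}$. The three types are, in one-line notation (each "$\dots$" between two listed values denotes a decreasing run of consecutive integers, empty if the number of terms is zero): Type $4231$ ($l>0$, $m>0$, $N=l+m+2$): $\omega=(N,\ l+1,l,\dots,2,\ N-1,N-2,\dots,l+2,\ 1)$ (the middle blocks have $l$ and $m$ entries), $\nu=(l+1,l,\dots,1,\ N,N-1,\dots,l+2)$. Here $\ell(w)-\ell(v)=l+m+1$. Type $34{*}12$ ($l\ge0$, $N=l+4$): $\omega=(N-1,\ N,\ N-2,N-3,\dots,3,\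 1,\ 2)$ (the middle block has $l$ entries), $\nu=(1,\ N-1,N-2,\dots,2,\ N)$. Here $\ell(w)-\ell(v)=2l+3$. Type $34\emptyset12$ ($l\ge0$, $m\ge0$, $N=l+m+4$): $\omega=(l+3,\ l+1,l,\dots,2,\ N,\ 1,\ N-1,N-2,\dots,l+4,\ l+2)$ (the block $l+1,\dots,2$ has $l$ entries and the block $N-1,\dots,l+4$ has $m$ entries), $\nu=(l+1,l,\dots,1,\ l+3,\ l+2,\ N,N-1,\dots,l+4)$. Here $\ell(w)-\ell(v)=l+m+3$. The configuration is minimal if no point of the diagram of $w$ other than the $N$ points of the configuration lies in the region $D=\{(p,q):\ r_v(p,q)>r_w(p,q)\}$. It is known that the irreducible components of $\mathrm{Sing}(X_w)$ are exactly the $X_v$ arising from minimal configurations of these three types. A quadratic cone of dimension $d$ is the zero locus in affine space $\mathbb A^{d+1}$ of a nondegenerate quadratic form. *)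

theory Defs
  imports "HOL-Analysis.Analysis" "Jordan_Normal_Form.DL_Rank"
begin

section \<open>Varieties as spaces with functions\<close>

text \<open>
  Varieties are treated in the classical (reduced) language: a topological space together with,
  for every open set U, the set of functions that are regular on U.  Functions are total in HOL;
  whether a function belongs to \<open>reg X U\<close> depends only on its values on U, and
  \<open>reg X U\<close> is used only for open U.
\<close>

record ('p, 'k) space_with_functions =
  top_of :: "'p topology"
  reg :: "'p set \<Rightarrow> ('p \<Rightarrow> 'k) set"

inductive_set polynomial_functions :: "('p \<Rightarrow> 'k::comm_ring_1) set \<Rightarrow> ('p \<Rightarrow> 'k) set"
  for C :: "('p \<Rightarrow> 'k) set" where
  const: "(\<lambda>_. c) \<in> polynomial_functions C"
| coord: "f \<in> C \<Longrightarrow> f \<in> polynomial_functions C"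
| add: "f \<in> polynomial_functions C \<Longrightarrow> g \<in> polynomial_functions C
    \<Longrightarrow> (\<lambda>x. f x + g x) \<in> polynomial_functions C"
| mult: "f \<in> polynomial_functions C \<Longrightarrow> g \<in> polynomial_functions C
    \<Longrightarrow> (\<lambda>x. f x * g x) \<in> polynomial_functions C"

text \<open>
  The Zariski topology on a set P of points with coordinate functions C: the closed sets are the
  zero loci of sets of polynomials in the coordinates.
\<close>

definition zariski_open :: "'p set \<Rightarrow> ('p \<Rightarrow> 'k::idom) set \<Rightarrow> 'p set \<Rightarrow> bool" where
  "zariski_open P C U \<longleftrightarrow>
     (\<exists>S \<subseteq> polynomial_functions C. U = P - {x \<in> P. \<forall>f\<in>S. f x = 0})"

lemma zariski_open_iff:
  "zariski_open P C U \<longleftrightarrow> (\<exists>S \<subseteq> polynomial_functions C. U = {x \<in> P. \<exists>f\<in>S. f x \<noteq> 0})"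
proof -
  have "P - {x \<in> P. \<forall>f\<in>S. f x = 0} = {x \<in> P. \<exists>f\<in>S. f x \<noteq> 0}" for S :: "('a \<Rightarrow> 'b) set"
    by blast
  then show ?thesis unfolding zariski_open_def by simp
qed

lemma istopology_zariski: "istopology (zariski_open P C)"
  unfolding istopology_def
proof (intro conjI allI impI)
  fix U V assume "zariski_open P C U" "zariski_open P C V"
  then obtain S T where S: "S \<subseteq> polynomial_functions C" "U = {x \<in> P. \<exists>f\<in>S. f x \<noteq> 0}"
    and T: "T \<subseteq> polynomial_functions C" "V = {x \<in> P. \<exists>f\<in>T. f x \<noteq> 0}"
    unfolding zariski_open_iff by blast
  define R where "R = (\<lambda>(f, g) x. f x * g x) ` (S \<times> T)"
  have "R \<subseteq> polynomial_functions C"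
    unfolding R_def using S(1) T(1) by (auto intro: polynomial_functions.mult)
  moreover have "U \<inter> V = {x \<in> P. \<exists>f\<in>R. f x \<noteq> 0}"
    unfolding S(2) T(2) R_def by auto
  ultimately show "zariski_open P C (U \<inter> V)" unfolding zariski_open_iff by blast
next
  fix K assume "\<forall>U\<in>K. zariski_open P C U"
  then have "\<forall>U\<in>K. \<exists>S. S \<subseteq> polynomial_functions C \<and> U = {x \<in> P. \<exists>f\<in>S. f x \<noteq> 0}"
    unfolding zariski_open_iff by blast
  then obtain S where S: "\<forall>U\<in>K. S U \<subseteq> polynomial_functions C \<and> U = {x \<in> P. \<exists>f\<in>S U. f x \<noteq> 0}"
    by (rule bchoice[THEN exE])
  have "\<Union>K = (\<Union>U\<in>K. {x \<in> P. \<exists>f\<in>S U. f x \<noteq> 0})"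
    using S by (metis (no_types, lifting) SUP_cong image_ident)
  also have "\<dots> = {x \<in> P. \<exists>f\<in>(\<Union>U\<in>K. S U). f x \<noteq> 0}"
    by blast
  finally have "\<Union>K = {x \<in> P. \<exists>f\<in>(\<Union>U\<in>K. S U). f x \<noteq> 0}" .
  moreover have "(\<Union>U\<in>K. S U) \<subseteq> polynomial_functions C" using S by blast
  ultimately show "zariski_open P C (\<Union>K)" unfolding zariski_open_iff by blast
qed

definition coordinate_space ::
  "'p set \<Rightarrow> ('p \<Rightarrow> 'k::field) set \<Rightarrow> ('p, 'k) space_with_functions" where
  "coordinate_space P C =
    \<lparr> top_of = topology (zariski_open P C),
      reg = (\<lambda>U. {f. \<forall>x\<in>U. \<exists>V. zariski_open P C V \<and> x \<in> V \<and> V \<subseteq> U \<and>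
               (\<exists>a\<in>polynomial_functions C. \<exists>b\<in>polynomial_functions C.
                  \<forall>y\<in>V. b y \<noteq> 0 \<and> f y = a y / b y)}) \<rparr>"

definition affine_space :: "nat \<Rightarrow> (nat \<Rightarrow> 'k::field, 'k) space_with_functions" where
  "affine_space d = coordinate_space {x. \<forall>i\<ge>d. x i = 0} {(\<lambda>x. x i) | i. i < d}"

text \<open>
  The induced reduced structure on a locally closed subset: regular functions are locally
  restrictions of regular functions on open subsets of the ambient space.
\<close>

definition subspace_of ::
  "('p, 'k) space_with_functions \<Rightarrow> 'p set \<Rightarrow> ('p, 'k) space_with_functions" where
  "subspace_of X Y =
    \<lparr> top_of = subtopology (top_of X) Y,
      reg = (\<lambda>U. {f. \<forall>x\<in>U. \<exists>V g. openin (top_of X) V \<and> x \<in> V \<and> g \<in> reg X V \<and>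
               (\<forall>y \<in> V \<inter> U. f y = g y)}) \<rparr>"

definition is_morphism ::
  "('p, 'k) space_with_functions \<Rightarrow> ('q, 'k) space_with_functions \<Rightarrow> ('p \<Rightarrow> 'q) \<Rightarrow> bool" where
  "is_morphism X Y \<phi> \<longleftrightarrow> continuous_map (top_of X) (top_of Y) \<phi> \<and>
     (\<forall>V f. openin (top_of Y) V \<and> f \<in> reg Y V \<longrightarrow>
        f \<circ> \<phi> \<in> reg X {x \<in> topspace (top_of X). \<phi> x \<in> V})"

definition isomorphic_spaces ::
  "('p, 'k) space_with_functions \<Rightarrow> ('q, 'k) space_with_functions \<Rightarrow> bool" where
  "isomorphic_spaces X Y \<longleftrightarrow> (\<exists>\<phi> \<psi>. is_morphism X Y \<phi> \<and> is_morphism Y X \<psi> \<and>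
     (\<forall>x\<in>topspace (top_of X). \<psi> (\<phi> x) = x) \<and> (\<forall>y\<in>topspace (top_of Y). \<phi> (\<psi> y) = y))"

definition is_affine_variety :: "('p, 'k::field) space_with_functions \<Rightarrow> bool" where
  "is_affine_variety X \<longleftrightarrow> (\<exists>d Z. closedin (top_of (affine_space d :: (nat \<Rightarrow> 'k, 'k) space_with_functions)) Z \<and>
     isomorphic_spaces X (subspace_of (affine_space d) Z))"

text \<open>
  Products in the category of varieties.  The topology is not the product topology: a base is
  given by the loci in U \<open>\<times>\<close> V where a sum of products of regular functions on U and on V
  does not vanish; regular functions are locally quotients of such sums.
\<close>

definition tensor_functions ::
  "('p, 'k::field) space_with_functions \<Rightarrow> ('q, 'k) space_with_functions \<Rightarrow>
   'p set \<Rightarrow> 'q set \<Rightarrow> ('p \<times> 'q \<Rightarrow> 'k) set" where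
  "tensor_functions X Y U V =
     {(\<lambda>(x, y). \<Sum>i<r. f i x * g i y) | (r::nat) f g. \<forall>i<r. f i \<in> reg X U \<and> g i \<in> reg Y V}"

definition product_basic_open ::
  "('p, 'k::field) space_with_functions \<Rightarrow> ('q, 'k) space_with_functions \<Rightarrow>
   'p set \<Rightarrow> 'q set \<Rightarrow> ('p \<times> 'q \<Rightarrow> 'k) \<Rightarrow> ('p \<times> 'q) set \<Rightarrow> bool" where
  "product_basic_open X Y U V h W \<longleftrightarrow> openin (top_of X) U \<and> openin (top_of Y) V \<and>
     h \<in> tensor_functions X Y U V \<and> W = {z \<in> U \<times> V. h z \<noteq> 0}"

definition product_space ::
  "('p, 'k::field) space_with_functions \<Rightarrow> ('q, 'k) space_with_functions \<Rightarrow>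
   ('p \<times> 'q, 'k) space_with_functions" where
  "product_space X Y =
    \<lparr> top_of = topology_generated_by {W. \<exists>U V h. product_basic_open X Y U V h W},
      reg = (\<lambda>W. {f. \<forall>z\<in>W. \<exists>U V a b D. product_basic_open X Y U V b D \<and> z \<in> D \<and> D \<subseteq> W \<and>
               a \<in> tensor_functions X Y U V \<and> (\<forall>y\<in>D. f y = a y / b y)}) \<rparr>"


section \<open>Irreducible components and the singular locus\<close>

definition irreducible_subset :: "'p topology \<Rightarrow> 'p set \<Rightarrow> bool" where
  "irreducible_subset T Z \<longleftrightarrow> Z \<noteq> {} \<and> Z \<subseteq> topspace T \<and>
     (\<forall>A B. closedin T A \<and> closedin T B \<and> Z \<subseteq> A \<union> B \<longrightarrow> Z \<subseteq> A \<or> Z \<subseteq> B)"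

definition irreducible_component_of :: "'p topology \<Rightarrow> 'p set \<Rightarrow> bool" where
  "irreducible_component_of T Z \<longleftrightarrow> irreducible_subset T Z \<and>
     (\<forall>Z'. irreducible_subset T Z' \<and> Z \<subseteq> Z' \<longrightarrow> Z' = Z)"

text \<open>
  The Krull dimension of the local ring at x: prime ideals of the local ring correspond to the
  irreducible closed subsets containing x.
\<close>

definition local_dimension :: "('p, 'k) space_with_functions \<Rightarrow> 'p \<Rightarrow> enat" where
  "local_dimension X x = Sup {enat d | d. \<exists>Z :: nat \<Rightarrow> 'p set.
     (\<forall>i\<le>d. closedin (top_of X) (Z i) \<and> irreducible_subset (top_of X) (Z i) \<and> x \<in> Z i) \<and>
     (\<forall>i<d. Z i \<subset> Z (Suc i))}"

text \<open>
  The local ring at x is regular: its maximal ideal is generated by as many germs (represented by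
  \<open>g 0, \<dots>, g (d - 1)\<close> on U) as its Krull dimension d.
\<close>

definition regular_point :: "('p, 'k::field) space_with_functions \<Rightarrow> 'p \<Rightarrow> bool" where
  "regular_point X x \<longleftrightarrow> (\<exists>d::nat. local_dimension X x = enat d \<and>
     (\<exists>U g. openin (top_of X) U \<and> x \<in> U \<and> (\<forall>i<d. g i \<in> reg X U \<and> g i x = 0) \<and>
       (\<forall>V f. openin (top_of X) V \<and> x \<in> V \<and> f \<in> reg X V \<and> f x = 0 \<longrightarrow>
         (\<exists>W h. openin (top_of X) W \<and> x \<in> W \<and> W \<subseteq> U \<inter> V \<and> (\<forall>i<d. h i \<in> reg X W) \<and>
            (\<forall>y\<in>W. f y = (\<Sum>i<d. h i y * g i y))))))"

definition singular_locus :: "('p, 'k::field) space_with_functions \<Rightarrow> 'p set" where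
  "singular_locus X = {x \<in> topspace (top_of X). \<not> regular_point X x}"


section \<open>The variety of complete flags\<close>

text \<open>
  Rows, columns and members of a flag are indexed by a finite linearly ordered type with n
  elements instead of 1, ..., n; so \<open>card {..p}\<close> is the rank of p in this order.
\<close>

type_synonym ('k, 'n) flag = "'n \<Rightarrow> ('k ^ 'n) set"
type_synonym ('k, 'n) square_matrix = "'k ^ 'n ^ 'n"

definition complete_flags :: "('k::field, 'n::{finite,linorder}) flag set" where
  "complete_flags = {W. (\<forall>p. vec.subspace (W p) \<and> vec.dim (W p) = card {..p}) \<and>
                        (\<forall>p q. p \<le> q \<longrightarrow> W p \<subseteq> W q)}"

definition general_linear_group :: "(('k::field, 'n::finite) square_matrix, 'k) space_with_functions" where
  "general_linear_group =
     subspace_of (coordinate_space UNIV {(\<lambda>g. vec_nth (vec_nth g i) j) | i j. True}) {g. invertible g}"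

definition column_flag :: "('k::field, 'n::{finite,linorder}) square_matrix \<Rightarrow> ('k, 'n) flag" where
  "column_flag g = (\<lambda>p. vec.span {column j g | j. j \<le> p})"

text \<open>
  The structure of a variety on the set of complete flags is that of the homogeneous space GL/B
  (B the upper triangular matrices): the quotient structure for the surjection
  \<open>column_flag\<close> from GL.
\<close>

definition flag_preimage :: "('k::field, 'n::{finite,linorder}) flag set \<Rightarrow> ('k, 'n) square_matrix set" where
  "flag_preimage U = {g. invertible g \<and> column_flag g \<in> U}"

definition flag_open :: "('k::field, 'n::{finite,linorder}) flag set \<Rightarrow> bool" where
  "flag_open U \<longleftrightarrow> U \<subseteq> complete_flags \<and> openin (top_of general_linear_group) (flag_preimage U)"

lemma istopology_flag_open:
  "istopology (flag_open :: ('k::field, 'n::{finite,linorder}) flag set \<Rightarrow> bool)"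
  unfolding istopology_def
proof (intro conjI allI impI)
  fix U V :: "('k, 'n) flag set"
  assume UV: "flag_open U" "flag_open V"
  have "flag_preimage (U \<inter> V) = flag_preimage U \<inter> flag_preimage V"
    unfolding flag_preimage_def by blast
  then show "flag_open (U \<inter> V)"
    using UV unfolding flag_open_def by (metis le_infI1 openin_Int)
next
  fix K :: "('k, 'n) flag set set"
  assume K: "\<forall>U\<in>K. flag_open U"
  have eq: "flag_preimage (\<Union>K) = (\<Union>U\<in>K. flag_preimage U)"
    unfolding flag_preimage_def by blast
  have "openin (top_of general_linear_group) (\<Union>U\<in>K. flag_preimage U)"
    by (rule openin_Union) (use K in \<open>unfold flag_open_def, blast\<close>)
  moreover have "\<Union>K \<subseteq> complete_flags" using K unfolding flag_open_def by blast
  ultimately show "flag_open (\<Union>K)" unfolding flag_open_def eq by blast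
qed

definition flag_variety ::
  "(('k::field, 'n::{finite,linorder}) flag, 'k) space_with_functions" where
  "flag_variety =
    \<lparr> top_of = topology flag_open,
      reg = (\<lambda>U. {f. f \<circ> column_flag \<in> reg general_linear_group (flag_preimage U)}) \<rparr>"


section \<open>Schubert cells and Schubert varieties\<close>

definition rank_function :: "('n::{finite,linorder} \<Rightarrow> 'n) \<Rightarrow> 'n \<Rightarrow> 'n \<Rightarrow> nat" where
  "rank_function w p q = card {i. i \<le> p \<and> w i \<le> q}"

definition inversions :: "('n::{finite,linorder} \<Rightarrow> 'n) \<Rightarrow> nat" where
  "inversions w = card {(i, j). i < j \<and> w j < w i}"

definition schubert_variety ::
  "('k::field, 'n::{finite,linorder}) flag \<Rightarrow> ('n \<Rightarrow> 'n) \<Rightarrow> ('k, 'n) flag set" where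
  "schubert_variety V w =
     {W \<in> complete_flags. \<forall>p q. vec.dim (W p \<inter> V q) \<ge> rank_function w p q}"

definition schubert_cell ::
  "('k::field, 'n::{finite,linorder}) flag \<Rightarrow> ('n \<Rightarrow> 'n) \<Rightarrow> ('k, 'n) flag set" where
  "schubert_cell V w =
     {W \<in> complete_flags. \<forall>p q. vec.dim (W p \<inter> V q) = rank_function w p q}"

definition component_of_singular_locus ::
  "('k::field, 'n::{finite,linorder}) flag \<Rightarrow> ('n \<Rightarrow> 'n) \<Rightarrow> ('n \<Rightarrow> 'n) \<Rightarrow> bool" where
  "component_of_singular_locus V w v \<longleftrightarrow>
     irreducible_component_of
       (subtopology (top_of flag_variety)
          (singular_locus (subspace_of flag_variety (schubert_variety V w))))
       (schubert_variety V v)"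


section \<open>Configurations\<close>

text \<open>
  The one-line notations \<open>om\<close> and \<open>nu\<close> are lists with values 1, ..., N, while the lists of rows
  \<open>xs\<close> and of columns \<open>ys\<close> are accessed from position 0; hence the shifts by 1.
\<close>

definition minimal_configuration ::
  "nat list \<Rightarrow> nat list \<Rightarrow> ('n::{finite,linorder} \<Rightarrow> 'n) \<Rightarrow> ('n \<Rightarrow> 'n) \<Rightarrow> bool" where
  "minimal_configuration om nu w v \<longleftrightarrow> (\<exists>xs ys.
     sorted_wrt (<) xs \<and> sorted_wrt (<) ys \<and> length xs = length om \<and> length ys = length om \<and>
     (\<forall>a<length om. w (xs ! a) = ys ! (om ! a - 1) \<and> v (xs ! a) = ys ! (nu ! a - 1)) \<and>
     (\<forall>i. i \<notin> set xs \<longrightarrow> v i = w i) \<and>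
     (\<forall>i. i \<notin> set xs \<longrightarrow> \<not> rank_function v i (w i) > rank_function w i (w i)))"

definition decreasing_run :: "nat \<Rightarrow> nat \<Rightarrow> nat list" where
  "decreasing_run a b = rev [b..<Suc a]"

definition omega_4231 :: "nat \<Rightarrow> nat \<Rightarrow> nat list" where
  "omega_4231 l m = (let N = l + m + 2 in
     [N] @ decreasing_run (l + 1) 2 @ decreasing_run (N - 1) (l + 2) @ [1])"

definition nu_4231 :: "nat \<Rightarrow> nat \<Rightarrow> nat list" where
  "nu_4231 l m = (let N = l + m + 2 in decreasing_run (l + 1) 1 @ decreasing_run N (l + 2))"

definition omega_34_star_12 :: "nat \<Rightarrow> nat list" where
  "omega_34_star_12 l = (let N = l + 4 in [N - 1, N] @ decreasing_run (N - 2) 3 @ [1, 2])"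

definition nu_34_star_12 :: "nat \<Rightarrow> nat list" where
  "nu_34_star_12 l = (let N = l + 4 in [1] @ decreasing_run (N - 1) 2 @ [N])"

definition omega_34_empty_12 :: "nat \<Rightarrow> nat \<Rightarrow> nat list" where
  "omega_34_empty_12 l m = (let N = l + m + 4 in
     [l + 3] @ decreasing_run (l + 1) 2 @ [N, 1] @ decreasing_run (N - 1) (l + 4) @ [l + 2])"

definition nu_34_empty_12 :: "nat \<Rightarrow> nat \<Rightarrow> nat list" where
  "nu_34_empty_12 l m = (let N = l + m + 4 in
     decreasing_run (l + 1) 1 @ [l + 3, l + 2] @ decreasing_run N (l + 4))"


section \<open>The local models\<close>

definition rank_at_most_one_cone :: "nat \<Rightarrow> nat \<Rightarrow> ('k::field mat, 'k) space_with_functions" where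
  "rank_at_most_one_cone r c =
     subspace_of
       (coordinate_space (carrier_mat r c) {(\<lambda>A. A $$ (i, j)) | i j. i < r \<and> j < c})
       {A \<in> carrier_mat r c. vec_space.rank r A \<le> 1}"

text \<open>
  A quadratic form in N variables is given by its symmetric Gram matrix \<open>a\<close>; no form is lost,
  as the characteristic is not 2.  Nondegenerate means that the associated bilinear form has
  trivial radical.
\<close>

definition nondegenerate_form :: "nat \<Rightarrow> (nat \<Rightarrow> nat \<Rightarrow> 'k::field_char_0) \<Rightarrow> bool" where
  "nondegenerate_form N a \<longleftrightarrow> (\<forall>i<N. \<forall>j<N. a i j = a j i) \<and>
     (\<forall>x. (\<forall>y. (\<Sum>i<N. \<Sum>j<N. a i j * x i * y j) = 0) \<longrightarrow> (\<forall>i<N. x i = 0))"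

definition quadratic_cone ::
  "nat \<Rightarrow> (nat \<Rightarrow> 'k::field_char_0, 'k) space_with_functions \<Rightarrow> bool" where
  "quadratic_cone d Q \<longleftrightarrow> (\<exists>a. nondegenerate_form (d + 1) a \<and>
     Q = subspace_of (affine_space (d + 1))
       {x. (\<forall>i\<ge>d + 1. x i = 0) \<and> (\<Sum>i<d + 1. \<Sum>j<d + 1. a i j * x i * x j) = 0})"

definition locally_cell_times ::
  "('k::field, 'n::{finite,linorder}) flag \<Rightarrow> ('n \<Rightarrow> 'n) \<Rightarrow> ('n \<Rightarrow> 'n) \<Rightarrow>
   ('p, 'k) space_with_functions \<Rightarrow> bool" where
  "locally_cell_times V w v C \<longleftrightarrow> (\<forall>P \<in> schubert_cell V v. \<exists>U.
     openin (top_of flag_variety) U \<and> P \<in> U \<and>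
     is_affine_variety (subspace_of flag_variety U) \<and>
     isomorphic_spaces
       (subspace_of flag_variety (U \<inter> schubert_variety V w))
       (product_space (subspace_of flag_variety (schubert_cell V v)) C))"

end

theory Submission
  imports Defs "Jordan_Normal_Form.DL_Rank_Submatrix"
begin

text \<open>
  Write \<open>V_q = g1 E_q\<close>, where \<open>E_q\<close> is spanned by the basis vectors \<open>e_j\<close> with \<open>v j \<le> q\<close>.  The flags of
  the matrices \<open>g1 u\<close> with \<open>u\<close> lower unitriangular form an affine open set containing the cell of \<open>v\<close>,
  and \<open>u\<close> is determined by the flag through Cramer's rule.  Every such \<open>u\<close> factors uniquely and
  polynomially as \<open>u = b c\<close>, where the entries of \<open>b\<close> off the diagonal lie at the inversions of \<open>v\<close> and
  those of \<open>c\<close> at the noninversions.  As \<open>b\<close> preserves all \<open>E_q\<close>, the rank conditions defining the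
  Schubert variety of \<open>w\<close> concern \<open>c\<close> only; this gives the product structure, the cell of \<open>v\<close> being
  \<open>c = 1\<close>.  Minimality makes all entries of \<open>c\<close> outside the rows and columns of the configuration vanish,
  and on the remaining entries the rank conditions say that certain Schur complements vanish or
  have rank at most one, which are the equations of the three cones.
\<close>

section \<open>Polynomial maps and coordinate spaces\<close>

text \<open>Few boxes \<open>(P, Q)\<close> carry all the equations. Off-diagonal entries of
  \<open>c\<close> sit at increasing pairs of \<open>nu\<close>. In type 4231 these fill one block
  with no pivot between its rows and columns, and the box \<open>(l + 1, l + 1)\<close>, where the
  ranks of \<open>v\<close> and \<open>w\<close> differ by one, gives all minors. In type 34*12 they
  form a column and a row of length \<open>l + 2\<close> and a corner; two boxes without rank
  difference kill the corner and the pairing of row and column, which is a split quadric in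
  \<open>2 * l + 4\<close> variables. In type 34empty12 they form a block with two rows, a block
  with two columns and a far block; the far block vanishes, the other two have rank at most one and
  their product is zero. The rotation of (s, t) to (t, -s) turns vanishing pairings into vanishing
  minors, so both blocks join to one matrix with two rows. The obstacle is the converse, that all
  other boxes impose nothing new: there each residual is shown to be a product of a function of the
  row and one of the column, and to vanish wherever the ranks do not differ. No increasing chain of
  four occurs in \<open>nu\<close>, so Schur complements stop at degree two.\<close>

lemma polynomial_functions_sum:
  "(\<And>i. i \<in> I \<Longrightarrow> f i \<in> polynomial_functions C) \<Longrightarrow> (\<lambda>x. \<Sum>i\<in>I. f i x) \<in> polynomial_functions C"
  by (induction I rule: infinite_finite_induct)
     (auto intro: polynomial_functions.intros)

lemma polynomial_functions_prod:
  "(\<And>i. i \<in> I \<Longrightarrow> f i \<in> polynomial_functions C) \<Longrightarrow> (\<lambda>x. \<Prod>i\<in>I. f i x) \<in> polynomial_functions C"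
  by (induction I rule: infinite_finite_induct)
     (auto intro: polynomial_functions.intros)

lemma polynomial_functions_uminus:
  assumes "f \<in> polynomial_functions C" shows "(\<lambda>x. - f x) \<in> polynomial_functions C"
proof -
  have "(\<lambda>x. (- 1) * f x) \<in> polynomial_functions C"
    by (rule polynomial_functions.mult[OF polynomial_functions.const assms])
  then show ?thesis by simp
qed

lemma polynomial_functions_diff:
  assumes "f \<in> polynomial_functions C" "g \<in> polynomial_functions C"
  shows "(\<lambda>x. f x - g x) \<in> polynomial_functions C"
  using polynomial_functions.add[OF assms(1) polynomial_functions_uminus[OF assms(2)]] by simp

text \<open>Agreement is asked on \<open>P\<close> only, because the maps between point sets obey
  their polynomial formulas only there.\<close>

lemma polynomial_functions_compose:
  assumes "p \<in> polynomial_functions E"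
    and "\<And>e. e \<in> E \<Longrightarrow> \<exists>g\<in>polynomial_functions C. \<forall>x\<in>P. e (\<phi> x) = g x"
  shows "\<exists>g\<in>polynomial_functions C. \<forall>x\<in>P. p (\<phi> x) = g x"
  using assms(1)
proof induction
  case (const c)
  show ?case by (intro bexI[of _ "\<lambda>_. c"]) (auto intro: polynomial_functions.const)
next
  case (coord f)
  then show ?case using assms(2) by blast
next
  case (add f g)
  then obtain a b where "a \<in> polynomial_functions C" "b \<in> polynomial_functions C"
    "\<forall>x\<in>P. f (\<phi> x) = a x" "\<forall>x\<in>P. g (\<phi> x) = b x" by blast
  then show ?case by (intro bexI[of _ "\<lambda>x. a x + b x"]) (auto intro: polynomial_functions.add)
next
  case (mult f g)
  then obtain a b where "a \<in> polynomial_functions C" "b \<in> polynomial_functions C"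
    "\<forall>x\<in>P. f (\<phi> x) = a x" "\<forall>x\<in>P. g (\<phi> x) = b x" by blast
  then show ?case by (intro bexI[of _ "\<lambda>x. a x * b x"]) (auto intro: polynomial_functions.mult)
qed

text \<open>Principal open sets form a base. In one direction a single member of the defining set
  suffices at each point; in the other the defining set consists of all polynomials whose
  nonvanishing locus in \<open>P\<close> stays inside \<open>U\<close>.\<close>

lemma zariski_open_principal:
  "zariski_open P C U \<longleftrightarrow>
    U \<subseteq> P \<and> (\<forall>x\<in>U. \<exists>s\<in>polynomial_functions C. s x \<noteq> 0 \<and> (\<forall>y\<in>P. s y \<noteq> 0 \<longrightarrow> y \<in> U))"
  (is "?L \<longleftrightarrow> ?R")
proof
  assume ?L
  then obtain S where S: "S \<subseteq> polynomial_functions C" "U = {x \<in> P. \<exists>f\<in>S. f x \<noteq> 0}"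
    unfolding zariski_open_iff by blast
  show ?R
  proof (intro conjI ballI)
    show "U \<subseteq> P" using S(2) by blast
    fix x assume "x \<in> U"
    then obtain s where "s \<in> S" "s x \<noteq> 0" using S(2) by blast
    then show "\<exists>s\<in>polynomial_functions C. s x \<noteq> 0 \<and> (\<forall>y\<in>P. s y \<noteq> 0 \<longrightarrow> y \<in> U)"
      using S by (intro bexI[of _ s]) auto
  qed
next
  assume R: ?R
  define S where "S = {s \<in> polynomial_functions C. \<forall>y\<in>P. s y \<noteq> 0 \<longrightarrow> y \<in> U}"
  have "U = {x \<in> P. \<exists>f\<in>S. f x \<noteq> 0}"
  proof (intro equalityI subsetI)
    fix x assume "x \<in> U"
    moreover from this obtain s where "s \<in> polynomial_functions C" "s x \<noteq> 0" "\<forall>y\<in>P. s y \<noteq> 0 \<longrightarrow> y \<in> U"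
      using R by blast
    ultimately show "x \<in> {x \<in> P. \<exists>f\<in>S. f x \<noteq> 0}" using R unfolding S_def by auto
  qed (auto simp: S_def)
  moreover have "S \<subseteq> polynomial_functions C" by (auto simp: S_def)
  ultimately show ?L unfolding zariski_open_iff by (intro exI[of _ S]) simp
qed

lemma zariski_open_nonzero:
  "s \<in> polynomial_functions C \<Longrightarrow> zariski_open P C {y \<in> P. s y \<noteq> 0}"
  unfolding zariski_open_principal by blast

lemma zariski_open_whole: "zariski_open P C P"
  unfolding zariski_open_principal
  by (auto intro!: bexI[of _ "\<lambda>_. 1"] polynomial_functions.const)

lemma openin_coordinate_space [simp]:
  "openin (top_of (coordinate_space P C)) U \<longleftrightarrow> zariski_open P C U"
  by (simp add: coordinate_space_def istopology_zariski)

lemma topspace_coordinate_space [simp]: "topspace (top_of (coordinate_space P C)) = P"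
proof -
  let ?T = "top_of (coordinate_space P C)"
  have "zariski_open P C (topspace ?T)" using openin_topspace[of ?T] unfolding openin_coordinate_space .
  moreover have "P \<subseteq> topspace ?T" by (rule openin_subset) (simp add: zariski_open_whole)
  ultimately show ?thesis by (auto simp: zariski_open_principal)
qed

text \<open>The neighbourhood \<open>V\<close> is absorbed into the fraction: numerator and
  denominator are multiplied by a polynomial \<open>s\<close> that does not vanish at
  \<open>x\<close> but vanishes outside \<open>V\<close>. Nonvanishing of the denominator then
  certifies everything.\<close>

lemma reg_coordinate_space:
  assumes "U \<subseteq> P"
  shows "f \<in> reg (coordinate_space P C) U \<longleftrightarrow>
    (\<forall>x\<in>U. \<exists>a\<in>polynomial_functions C. \<exists>b\<in>polynomial_functions C.
       b x \<noteq> 0 \<and> (\<forall>y\<in>P. b y \<noteq> 0 \<longrightarrow> y \<in> U \<and> f y = a y / b y))" (is "?L \<longleftrightarrow> ?R")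
proof
  assume L: ?L
  show ?R
  proof
    fix x assume "x \<in> U"
    with L obtain V a b where V: "zariski_open P C V" "x \<in> V" "V \<subseteq> U"
      and ab: "a \<in> polynomial_functions C" "b \<in> polynomial_functions C"
      "\<forall>y\<in>V. b y \<noteq> 0 \<and> f y = a y / b y"
      unfolding coordinate_space_def by simp blast
    from V obtain s where s: "s \<in> polynomial_functions C" "s x \<noteq> 0" "\<forall>y\<in>P. s y \<noteq> 0 \<longrightarrow> y \<in> V"
      unfolding zariski_open_principal by blast
    have "(\<lambda>y. a y * s y) \<in> polynomial_functions C" "(\<lambda>y. b y * s y) \<in> polynomial_functions C"
      using ab s by (auto intro: polynomial_functions.mult)
    moreover have "b x * s x \<noteq> 0 \<and> (\<forall>y\<in>P. b y * s y \<noteq> 0 \<longrightarrow> y \<in> U \<and> f y = (a y * s y) / (b y * s y))"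
      using ab s V by auto
    ultimately show "\<exists>a\<in>polynomial_functions C. \<exists>b\<in>polynomial_functions C.
       b x \<noteq> 0 \<and> (\<forall>y\<in>P. b y \<noteq> 0 \<longrightarrow> y \<in> U \<and> f y = a y / b y)" by (intro bexI)
  qed
next
  assume R: ?R
  show ?L unfolding coordinate_space_def
  proof (simp, intro ballI)
    fix x assume x: "x \<in> U"
    with R obtain a b where ab: "a \<in> polynomial_functions C" "b \<in> polynomial_functions C" "b x \<noteq> 0"
      "\<forall>y\<in>P. b y \<noteq> 0 \<longrightarrow> y \<in> U \<and> f y = a y / b y" by blast
    show "\<exists>V. zariski_open P C V \<and> x \<in> V \<and> V \<subseteq> U \<and>
      (\<exists>a\<in>polynomial_functions C. \<exists>b\<in>polynomial_functions C. \<forall>y\<in>V. b y \<noteq> 0 \<and> f y = a y / b y)"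
      using ab x assms zariski_open_nonzero[OF ab(2), of P]
      by (intro exI[of _ "{y \<in> P. b y \<noteq> 0}"]) auto
  qed
qed

lemma reg_coordinate_space_polynomial:
  "a \<in> polynomial_functions C \<Longrightarrow> zariski_open P C U \<Longrightarrow> a \<in> reg (coordinate_space P C) U"
  unfolding coordinate_space_def
  by (simp, intro ballI exI[of _ U] conjI bexI[of _ a] bexI[of _ "\<lambda>_. 1"])
     (auto intro: polynomial_functions.const)

text \<open>Both functions are first brought to a common denominator near each point.\<close>

lemma reg_coordinate_space_add_mult:
  assumes "U \<subseteq> P" "f \<in> reg (coordinate_space P C) U" "g \<in> reg (coordinate_space P C) U"
  shows "(\<lambda>x. f x + g x) \<in> reg (coordinate_space P C) U"
    and "(\<lambda>x. f x * g x) \<in> reg (coordinate_space P C) U"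
proof -
  have *: "\<exists>a\<in>polynomial_functions C. \<exists>b\<in>polynomial_functions C. \<exists>c\<in>polynomial_functions C.
     b x \<noteq> 0 \<and> (\<forall>y\<in>P. b y \<noteq> 0 \<longrightarrow> y \<in> U \<and> f y = a y / b y \<and> g y = c y / b y)" if x: "x \<in> U" for x
  proof -
    obtain a b where ab: "a \<in> polynomial_functions C" "b \<in> polynomial_functions C" "b x \<noteq> 0"
        "\<forall>y\<in>P. b y \<noteq> 0 \<longrightarrow> y \<in> U \<and> f y = a y / b y"
      using bspec[OF assms(2)[unfolded reg_coordinate_space[OF assms(1)]] x] by blast
    obtain c d where cd: "c \<in> polynomial_functions C" "d \<in> polynomial_functions C" "d x \<noteq> 0"
        "\<forall>y\<in>P. d y \<noteq> 0 \<longrightarrow> y \<in> U \<and> g y = c y / d y"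
      using bspec[OF assms(3)[unfolded reg_coordinate_space[OF assms(1)]] x] by blast
    have "(\<lambda>y. a y * d y) \<in> polynomial_functions C" "(\<lambda>y. b y * d y) \<in> polynomial_functions C"
      "(\<lambda>y. c y * b y) \<in> polynomial_functions C"
      using ab cd by (blast intro: polynomial_functions.mult)+
    moreover have "b x * d x \<noteq> 0 \<and> (\<forall>y\<in>P. b y * d y \<noteq> 0 \<longrightarrow>
       y \<in> U \<and> f y = a y * d y / (b y * d y) \<and> g y = c y * b y / (b y * d y))"
      using ab(3,4) cd(3,4) by auto
    ultimately show ?thesis by (intro bexI)
  qed
  show "(\<lambda>x. f x + g x) \<in> reg (coordinate_space P C) U"
    unfolding reg_coordinate_space[OF assms(1)]
  proof
    fix x assume "x \<in> U"
    from *[OF this] obtain a b c where "a \<in> polynomial_functions C" "b \<in> polynomial_functions C"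
      "c \<in> polynomial_functions C" "b x \<noteq> 0"
      "\<forall>y\<in>P. b y \<noteq> 0 \<longrightarrow> y \<in> U \<and> f y = a y / b y \<and> g y = c y / b y" by blast
    then show "\<exists>a\<in>polynomial_functions C. \<exists>b\<in>polynomial_functions C.
       b x \<noteq> 0 \<and> (\<forall>y\<in>P. b y \<noteq> 0 \<longrightarrow> y \<in> U \<and> f y + g y = a y / b y)"
      by (intro bexI[of _ "\<lambda>y. a y + c y"] bexI[of _ b])
         (auto intro: polynomial_functions.add simp: add_divide_distrib)
  qed
  show "(\<lambda>x. f x * g x) \<in> reg (coordinate_space P C) U"
    unfolding reg_coordinate_space[OF assms(1)]
  proof
    fix x assume "x \<in> U"
    from *[OF this] obtain a b c where "a \<in> polynomial_functions C" "b \<in> polynomial_functions C"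
      "c \<in> polynomial_functions C" "b x \<noteq> 0"
      "\<forall>y\<in>P. b y \<noteq> 0 \<longrightarrow> y \<in> U \<and> f y = a y / b y \<and> g y = c y / b y" by blast
    then show "\<exists>a\<in>polynomial_functions C. \<exists>b\<in>polynomial_functions C.
       b x \<noteq> 0 \<and> (\<forall>y\<in>P. b y \<noteq> 0 \<longrightarrow> y \<in> U \<and> f y * g y = a y / b y)"
      by (intro bexI[of _ "\<lambda>y. a y * c y"] bexI[of _ "\<lambda>y. b y * b y"])
         (auto intro: polynomial_functions.mult)
  qed
qed

lemma polynomial_map_is_morphism:
  assumes "\<And>x. x \<in> P \<Longrightarrow> \<phi> x \<in> Q"
    and "\<And>e. e \<in> E \<Longrightarrow> \<exists>g\<in>polynomial_functions C. \<forall>x\<in>P. e (\<phi> x) = g x"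
  shows "is_morphism (coordinate_space P C) (coordinate_space Q E) \<phi>"
proof -
  have pull: "\<exists>g\<in>polynomial_functions C. \<forall>x\<in>P. p (\<phi> x) = g x" if "p \<in> polynomial_functions E" for p
    by (rule polynomial_functions_compose[where \<phi> = \<phi>, OF that assms(2)])
  have op: "zariski_open P C {x \<in> P. \<phi> x \<in> U}" if U: "zariski_open Q E U" for U
    unfolding zariski_open_principal
  proof (intro conjI ballI)
    fix x assume x: "x \<in> {x \<in> P. \<phi> x \<in> U}"
    then obtain s where s: "s \<in> polynomial_functions E" "s (\<phi> x) \<noteq> 0" "\<forall>y\<in>Q. s y \<noteq> 0 \<longrightarrow> y \<in> U"
      using U[unfolded zariski_open_principal] by blast
    obtain g where "g \<in> polynomial_functions C" "\<forall>x\<in>P. s (\<phi> x) = g x" using pull[OF s(1)] by blast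
    then show "\<exists>s\<in>polynomial_functions C. s x \<noteq> 0 \<and> (\<forall>y\<in>P. s y \<noteq> 0 \<longrightarrow> y \<in> {x \<in> P. \<phi> x \<in> U})"
      using s x assms(1) by (intro bexI[of _ g]) auto
  qed auto
  have rg: "f \<circ> \<phi> \<in> reg (coordinate_space P C) {x \<in> P. \<phi> x \<in> U}"
    if U: "zariski_open Q E U" and f: "f \<in> reg (coordinate_space Q E) U" for U f
  proof -
    have sub: "{x \<in> P. \<phi> x \<in> U} \<subseteq> P" "U \<subseteq> Q" using U by (auto simp: zariski_open_principal)
    show ?thesis unfolding reg_coordinate_space[OF sub(1)]
    proof
      fix x assume x: "x \<in> {x \<in> P. \<phi> x \<in> U}"
      obtain a b where ab: "a \<in> polynomial_functions E" "b \<in> polynomial_functions E" "b (\<phi> x) \<noteq> 0"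
        "\<forall>y\<in>Q. b y \<noteq> 0 \<longrightarrow> y \<in> U \<and> f y = a y / b y"
        using bspec[OF f[unfolded reg_coordinate_space[OF sub(2)]], of "\<phi> x"] x by blast
      obtain a' b' where "a' \<in> polynomial_functions C" "\<forall>x\<in>P. a (\<phi> x) = a' x"
        "b' \<in> polynomial_functions C" "\<forall>x\<in>P. b (\<phi> x) = b' x" using pull[OF ab(1)] pull[OF ab(2)] by blast
      then show "\<exists>a\<in>polynomial_functions C. \<exists>b\<in>polynomial_functions C. b x \<noteq> 0 \<and>
        (\<forall>y\<in>P. b y \<noteq> 0 \<longrightarrow> y \<in> {x \<in> P. \<phi> x \<in> U} \<and> (f \<circ> \<phi>) y = a y / b y)"
        using ab x assms(1) by (intro bexI[of _ a'] bexI[of _ b']) auto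
    qed
  qed
  show ?thesis unfolding is_morphism_def continuous_map_def
    using assms(1) op rg by auto
qed

lemma isomorphic_coordinate_spaces:
  assumes "\<And>x. x \<in> P \<Longrightarrow> \<phi> x \<in> Q" "\<And>y. y \<in> Q \<Longrightarrow> \<psi> y \<in> P"
    and "\<And>x. x \<in> P \<Longrightarrow> \<psi> (\<phi> x) = x" "\<And>y. y \<in> Q \<Longrightarrow> \<phi> (\<psi> y) = y"
    and "\<And>e. e \<in> E \<Longrightarrow> \<exists>g\<in>polynomial_functions C. \<forall>x\<in>P. e (\<phi> x) = g x"
    and "\<And>c. c \<in> C \<Longrightarrow> \<exists>g\<in>polynomial_functions E. \<forall>y\<in>Q. c (\<psi> y) = g y"
  shows "isomorphic_spaces (coordinate_space P C) (coordinate_space Q E)"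
  unfolding isomorphic_spaces_def
  using polynomial_map_is_morphism[of P \<phi> Q E C] polynomial_map_is_morphism[of Q \<psi> P C E] assms
  by (intro exI[of _ \<phi>] exI[of _ \<psi>]) simp

section \<open>Isomorphisms, subspaces and products\<close>

lemma is_morphism_compose:
  assumes "is_morphism X Y \<phi>" "is_morphism Y Z \<psi>"
  shows "is_morphism X Z (\<psi> \<circ> \<phi>)"
  unfolding is_morphism_def
proof (intro conjI allI impI)
  show "continuous_map (top_of X) (top_of Z) (\<psi> \<circ> \<phi>)"
    using assms unfolding is_morphism_def by (blast intro: continuous_map_compose)
  fix V f assume V: "openin (top_of Z) V \<and> f \<in> reg Z V"
  let ?V = "{y \<in> topspace (top_of Y). \<psi> y \<in> V}"
  have "openin (top_of Y) ?V" "f \<circ> \<psi> \<in> reg Y ?V"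
    using V assms(2) unfolding is_morphism_def continuous_map_def by auto
  then have "(f \<circ> \<psi>) \<circ> \<phi> \<in> reg X {x \<in> topspace (top_of X). \<phi> x \<in> ?V}"
    using assms(1) unfolding is_morphism_def by blast
  moreover have "{x \<in> topspace (top_of X). \<phi> x \<in> ?V} = {x \<in> topspace (top_of X). (\<psi> \<circ> \<phi>) x \<in> V}"
    using assms(1) unfolding is_morphism_def continuous_map_def by auto
  ultimately show "f \<circ> (\<psi> \<circ> \<phi>) \<in> reg X {x \<in> topspace (top_of X). (\<psi> \<circ> \<phi>) x \<in> V}"
    by (simp add: comp_assoc)
qed

lemma isomorphic_spaces_trans [trans]:
  assumes "isomorphic_spaces X Y" "isomorphic_spaces Y Z"
  shows "isomorphic_spaces X Z"
proof -
  obtain \<phi> \<psi> where 1: "is_morphism X Y \<phi>" "is_morphism Y X \<psi>"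
     "\<forall>x\<in>topspace (top_of X). \<psi> (\<phi> x) = x" "\<forall>y\<in>topspace (top_of Y). \<phi> (\<psi> y) = y"
    using assms(1) unfolding isomorphic_spaces_def by blast
  obtain \<phi>' \<psi>' where 2: "is_morphism Y Z \<phi>'" "is_morphism Z Y \<psi>'"
     "\<forall>x\<in>topspace (top_of Y). \<psi>' (\<phi>' x) = x" "\<forall>y\<in>topspace (top_of Z). \<phi>' (\<psi>' y) = y"
    using assms(2) unfolding isomorphic_spaces_def by blast
  have "\<forall>x\<in>topspace (top_of X). \<phi> x \<in> topspace (top_of Y)"
    "\<forall>x\<in>topspace (top_of Z). \<psi>' x \<in> topspace (top_of Y)"
    using 1 2 unfolding is_morphism_def continuous_map_def by auto
  then show ?thesis unfolding isomorphic_spaces_def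
    using 1 2 is_morphism_compose[OF 1(1) 2(1)] is_morphism_compose[OF 2(2) 1(2)]
    by (intro exI[of _ "\<phi>' \<circ> \<phi>"] exI[of _ "\<psi> \<circ> \<psi>'"]) auto
qed

lemma isomorphic_spaces_sym: "isomorphic_spaces X Y \<Longrightarrow> isomorphic_spaces Y X"
  unfolding isomorphic_spaces_def by blast

text \<open>The identity is the isomorphism. Regular functions are compared on open sets only, since
  on other sets the two \<open>reg\<close> fields may differ.\<close>

lemma isomorphic_spaces_same:
  assumes "\<And>U. openin (top_of X) U \<longleftrightarrow> openin (top_of Y) U"
    and "\<And>U f. openin (top_of X) U \<Longrightarrow> f \<in> reg X U \<longleftrightarrow> f \<in> reg Y U"
  shows "isomorphic_spaces X Y"
proof -
  have top: "top_of X = top_of Y" using assms(1) by (simp add: topology_eq)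
  have "is_morphism X Y id" "is_morphism Y X id"
    using assms(2) openin_subset[of "top_of Y"]
    by (auto simp: is_morphism_def top Collect_conj_eq inf.absorb2 inf.absorb1 Int_def[symmetric])
  then show ?thesis unfolding isomorphic_spaces_def by (intro exI[of _ id]) simp
qed

section \<open>Induced structures on subsets of coordinate spaces\<close>

lemma top_of_subspace_of [simp]: "top_of (subspace_of X Y) = subtopology (top_of X) Y"
  by (simp add: subspace_of_def)

lemma openin_subspace_coordinate_space:
  assumes "Y \<subseteq> P"
  shows "openin (subtopology (top_of (coordinate_space P C)) Y) U \<longleftrightarrow> zariski_open Y C U"
proof -
  have "{x \<in> P. \<exists>f\<in>S. f x \<noteq> 0} \<inter> Y = {x \<in> Y. \<exists>f\<in>S. f x \<noteq> 0}" for S :: "('a \<Rightarrow> 'b) set"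
    using assms by blast
  then have "(\<exists>T. (\<exists>S\<subseteq>polynomial_functions C. T = {x \<in> P. \<exists>f\<in>S. f x \<noteq> 0}) \<and> U = T \<inter> Y) \<longleftrightarrow>
      (\<exists>S\<subseteq>polynomial_functions C. U = {x \<in> Y. \<exists>f\<in>S. f x \<noteq> 0})" by auto
  then show ?thesis unfolding openin_subtopology openin_coordinate_space zariski_open_iff .
qed

text \<open>A fraction of polynomials extends from \<open>Y\<close> to the open set of
  \<open>P\<close> where its denominator does not vanish. Conversely an ambient fraction is cut down
  to \<open>U\<close> by a factor \<open>s\<close> as in
  \<open>reg_coordinate_space\<close>.\<close>

lemma reg_subspace_coordinate_space:
  assumes "Y \<subseteq> P" and U: "zariski_open Y C U"
  shows "f \<in> reg (subspace_of (coordinate_space P C) Y) U \<longleftrightarrow> f \<in> reg (coordinate_space Y C) U"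
proof -
  have UY: "U \<subseteq> Y" using U by (simp add: zariski_open_principal)
  show ?thesis
  proof
    assume L: "f \<in> reg (subspace_of (coordinate_space P C) Y) U"
    show "f \<in> reg (coordinate_space Y C) U" unfolding reg_coordinate_space[OF UY]
    proof
      fix x assume x: "x \<in> U"
      then obtain V g where V: "zariski_open P C V" "x \<in> V" "g \<in> reg (coordinate_space P C) V"
         "\<forall>y \<in> V \<inter> U. f y = g y"
        using L unfolding subspace_of_def by auto
      have VP: "V \<subseteq> P" using V by (simp add: zariski_open_principal)
      obtain a b where ab: "a \<in> polynomial_functions C" "b \<in> polynomial_functions C" "b x \<noteq> 0"
        "\<forall>y\<in>P. b y \<noteq> 0 \<longrightarrow> y \<in> V \<and> g y = a y / b y"
        using bspec[OF V(3)[unfolded reg_coordinate_space[OF VP]] V(2)] by blast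
      obtain s where s: "s \<in> polynomial_functions C" "s x \<noteq> 0" "\<forall>y\<in>Y. s y \<noteq> 0 \<longrightarrow> y \<in> U"
        using U x unfolding zariski_open_principal by blast
      show "\<exists>a\<in>polynomial_functions C. \<exists>b\<in>polynomial_functions C.
         b x \<noteq> 0 \<and> (\<forall>y\<in>Y. b y \<noteq> 0 \<longrightarrow> y \<in> U \<and> f y = a y / b y)"
        using ab s V(4) assms(1)
        by (intro bexI[of _ "\<lambda>y. a y * s y"] bexI[of _ "\<lambda>y. b y * s y"])
           (auto intro: polynomial_functions.mult)
    qed
  next
    assume R: "f \<in> reg (coordinate_space Y C) U"
    have "\<exists>V g. zariski_open P C V \<and> x \<in> V \<and> g \<in> reg (coordinate_space P C) V \<and> (\<forall>y \<in> V \<inter> U. f y = g y)"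
      if x: "x \<in> U" for x
    proof -
      obtain a b where ab: "a \<in> polynomial_functions C" "b \<in> polynomial_functions C" "b x \<noteq> 0"
        "\<forall>y\<in>Y. b y \<noteq> 0 \<longrightarrow> y \<in> U \<and> f y = a y / b y"
        using bspec[OF R[unfolded reg_coordinate_space[OF UY]] x] by blast
      let ?V = "{y \<in> P. b y \<noteq> 0}"
      have "(\<lambda>y. a y / b y) \<in> reg (coordinate_space P C) ?V"
        using ab by (subst reg_coordinate_space) auto
      then show ?thesis
        using ab x UY assms(1) zariski_open_nonzero[OF ab(2), of P]
        by (intro exI[of _ ?V] exI[of _ "\<lambda>y. a y / b y"]) auto
    qed
    then show "f \<in> reg (subspace_of (coordinate_space P C) Y) U"
      unfolding subspace_of_def by auto
  qed
qed

text \<open>From here on a subset is treated as a coordinate space in its own right, with the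
  coordinates of the ambient space.\<close>

lemma subspace_of_coordinate_space:
  assumes "Y \<subseteq> P"
  shows "isomorphic_spaces (subspace_of (coordinate_space P C) Y) (coordinate_space Y C)"
  by (rule isomorphic_spaces_same)
     (simp_all add: reg_subspace_coordinate_space[OF assms] openin_subspace_coordinate_space[OF assms])

section \<open>Products of spaces with functions\<close>

lemma product_basic_openI:
  "openin (top_of X) U \<Longrightarrow> openin (top_of Y) V \<Longrightarrow> h \<in> tensor_functions X Y U V \<Longrightarrow>
    product_basic_open X Y U V h {z \<in> U \<times> V. h z \<noteq> 0}"
  unfolding product_basic_open_def by simp

lemma openin_product_basic:
  "product_basic_open X Y U V h W \<Longrightarrow> openin (top_of (product_space X Y)) W"
  unfolding product_space_def by (simp add: openin_topology_generated_by_iff) (blast intro: generate_topology_on.Basis)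

lemma topspace_product_subset:
  "topspace (top_of (product_space X Y)) \<subseteq> topspace (top_of X) \<times> topspace (top_of Y)"
proof
  fix z assume "z \<in> topspace (top_of (product_space X Y))"
  then obtain U V h W where "product_basic_open X Y U V h W" "z \<in> W"
    unfolding product_space_def by auto
  then show "z \<in> topspace (top_of X) \<times> topspace (top_of Y)"
    unfolding product_basic_open_def by (auto dest: openin_subset)
qed

text \<open>The whole product is the nonvanishing locus of the tensor 1, which is available as soon
  as 1 is regular on both factors; an arbitrary space with functions does not guarantee
  this.\<close>

lemma topspace_product_space:
  assumes "(\<lambda>_. 1) \<in> reg X (topspace (top_of X))" "(\<lambda>_. 1) \<in> reg Y (topspace (top_of Y))"
  shows "topspace (top_of (product_space X Y)) = topspace (top_of X) \<times> topspace (top_of Y)"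
proof -
  let ?U = "topspace (top_of X)" and ?V = "topspace (top_of Y)"
  have "(\<lambda>(x, y). \<Sum>i<(1::nat). 1 * 1) \<in> tensor_functions X Y ?U ?V"
    unfolding tensor_functions_def using assms
    by (auto intro!: exI[of _ 1] exI[of _ "\<lambda>_ _. 1"])
  from openin_product_basic[OF product_basic_openI[OF openin_topspace openin_topspace this]]
  have "openin (top_of (product_space X Y)) (?U \<times> ?V)" by (simp add: case_prod_beta)
  then show ?thesis using topspace_product_subset[of X Y] openin_subset by blast
qed

lemma tensor_functions_pullback:
  assumes "is_morphism X X' \<phi>" "is_morphism Y Y' \<psi>"
    and "openin (top_of X') U" "openin (top_of Y') V" "h \<in> tensor_functions X' Y' U V"
  shows "h \<circ> map_prod \<phi> \<psi> \<in> tensor_functions X Y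
     {x \<in> topspace (top_of X). \<phi> x \<in> U} {y \<in> topspace (top_of Y). \<psi> y \<in> V}"
proof -
  obtain r f g where h: "h = (\<lambda>(x, y). \<Sum>i<(r::nat). f i x * g i y)"
    "\<forall>i<r. f i \<in> reg X' U \<and> g i \<in> reg Y' V"
    using assms(5) unfolding tensor_functions_def by blast
  have "h \<circ> map_prod \<phi> \<psi> = (\<lambda>(x, y). \<Sum>i<r. (f i \<circ> \<phi>) x * (g i \<circ> \<psi>) y)"
    unfolding h by auto
  moreover have "\<forall>i<r. f i \<circ> \<phi> \<in> reg X {x \<in> topspace (top_of X). \<phi> x \<in> U} \<and>
     g i \<circ> \<psi> \<in> reg Y {y \<in> topspace (top_of Y). \<psi> y \<in> V}"
    using h assms unfolding is_morphism_def by blast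
  ultimately show ?thesis unfolding tensor_functions_def
    by (intro CollectI exI[of _ r] exI[of _ "\<lambda>i. f i \<circ> \<phi>"] exI[of _ "\<lambda>i. g i \<circ> \<psi>"]) simp
qed

text \<open>Basic open sets and quotients of tensor functions pull back to the same kind of object.
  Regularity of 1 is pulled back as well, which identifies the point sets of both products.\<close>

lemma is_morphism_map_prod:
  assumes "is_morphism X X' \<phi>" "is_morphism Y Y' \<psi>"
    and "(\<lambda>_. 1) \<in> reg X' (topspace (top_of X'))" "(\<lambda>_. 1) \<in> reg Y' (topspace (top_of Y'))"
  shows "is_morphism (product_space X Y) (product_space X' Y') (map_prod \<phi> \<psi>)"
proof -
  have op1: "openin (top_of X) {x \<in> topspace (top_of X). \<phi> x \<in> U}" if "openin (top_of X') U" for U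
    using assms(1) that unfolding is_morphism_def continuous_map_def by blast
  have op2: "openin (top_of Y) {x \<in> topspace (top_of Y). \<psi> x \<in> U}" if "openin (top_of Y') U" for U
    using assms(2) that unfolding is_morphism_def continuous_map_def by blast
  have 1: "(\<lambda>_. 1) \<in> reg X (topspace (top_of X))"
  proof -
    have "(\<lambda>_. 1) \<circ> \<phi> \<in> reg X {x \<in> topspace (top_of X). \<phi> x \<in> topspace (top_of X')}"
      using assms(1,3) openin_topspace unfolding is_morphism_def by blast
    moreover have "{x \<in> topspace (top_of X). \<phi> x \<in> topspace (top_of X')} = topspace (top_of X)"
      using assms(1) unfolding is_morphism_def continuous_map_def by auto
    ultimately show ?thesis by (simp add: comp_def)
  qed
  have 2: "(\<lambda>_. 1) \<in> reg Y (topspace (top_of Y))"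
  proof -
    have "(\<lambda>_. 1) \<circ> \<psi> \<in> reg Y {x \<in> topspace (top_of Y). \<psi> x \<in> topspace (top_of Y')}"
      using assms(2,4) openin_topspace unfolding is_morphism_def by blast
    moreover have "{x \<in> topspace (top_of Y). \<psi> x \<in> topspace (top_of Y')} = topspace (top_of Y)"
      using assms(2) unfolding is_morphism_def continuous_map_def by auto
    ultimately show ?thesis by (simp add: comp_def)
  qed
  note ts = topspace_product_space[OF 1 2] topspace_product_space[OF assms(3,4)]
  have maps: "\<phi> x \<in> topspace (top_of X')" "\<psi> y \<in> topspace (top_of Y')"
    if "x \<in> topspace (top_of X)" "y \<in> topspace (top_of Y)" for x y
    using assms that unfolding is_morphism_def continuous_map_def by auto
  let ?pre = "\<lambda>W. {z \<in> topspace (top_of X) \<times> topspace (top_of Y). map_prod \<phi> \<psi> z \<in> W}"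
  have basic: "product_basic_open X Y {x \<in> topspace (top_of X). \<phi> x \<in> U}
       {y \<in> topspace (top_of Y). \<psi> y \<in> V} (h \<circ> map_prod \<phi> \<psi>) (?pre W)"
    if "product_basic_open X' Y' U V h W" for U V h W
  proof -
    have U: "openin (top_of X') U" "openin (top_of Y') V" "h \<in> tensor_functions X' Y' U V"
       and W: "W = {z \<in> U \<times> V. h z \<noteq> 0}"
      using that unfolding product_basic_open_def by auto
    have "?pre W = {z \<in> {x \<in> topspace (top_of X). \<phi> x \<in> U} \<times>
       {y \<in> topspace (top_of Y). \<psi> y \<in> V}. (h \<circ> map_prod \<phi> \<psi>) z \<noteq> 0}"
      unfolding W by auto
    then show ?thesis unfolding product_basic_open_def
      using tensor_functions_pullback[OF assms(1,2) U] op1 op2 U by blast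
  qed
  have cont: "continuous_map (top_of (product_space X Y)) (top_of (product_space X' Y')) (map_prod \<phi> \<psi>)"
  proof -
    have top': "top_of (product_space X' Y') =
        topology_generated_by {W. \<exists>U V h. product_basic_open X' Y' U V h W}"
      by (simp add: product_space_def)
    show ?thesis unfolding top'
    proof (rule continuous_on_generated_topo)
      fix W assume "W \<in> {W. \<exists>U V h. product_basic_open X' Y' U V h W}"
      then obtain U V h where "product_basic_open X' Y' U V h W" by blast
      from openin_product_basic[OF basic[OF this]]
      show "openin (top_of (product_space X Y))
          (map_prod \<phi> \<psi> -` W \<inter> topspace (top_of (product_space X Y)))"
        unfolding ts by (simp add: vimage_def Int_def conj_commute)
    next
      have "\<Union> {W. \<exists>U V h. product_basic_open X' Y' U V h W} = topspace (top_of (product_space X' Y'))"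
        by (simp add: product_space_def)
      then show "map_prod \<phi> \<psi> ` topspace (top_of (product_space X Y))
          \<subseteq> \<Union> {W. \<exists>U V h. product_basic_open X' Y' U V h W}"
        unfolding ts using maps by auto
    qed
  qed
  have "f \<circ> map_prod \<phi> \<psi> \<in> reg (product_space X Y) (?pre W)"
    if W: "openin (top_of (product_space X' Y')) W" and f: "f \<in> reg (product_space X' Y') W" for W f
  proof -
    have "\<exists>U V a b D. product_basic_open X Y U V b D \<and> z \<in> D \<and> D \<subseteq> ?pre W \<and>
               a \<in> tensor_functions X Y U V \<and> (\<forall>y\<in>D. (f \<circ> map_prod \<phi> \<psi>) y = a y / b y)"
      if z: "z \<in> ?pre W" for z
    proof -
      obtain U V a b D where D: "product_basic_open X' Y' U V b D" "map_prod \<phi> \<psi> z \<in> D" "D \<subseteq> W"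
         "a \<in> tensor_functions X' Y' U V" "\<forall>y\<in>D. f y = a y / b y"
        using f z unfolding product_space_def by auto
      have UV: "openin (top_of X') U" "openin (top_of Y') V" using D unfolding product_basic_open_def by auto
      have "product_basic_open X Y {x \<in> topspace (top_of X). \<phi> x \<in> U}
          {y \<in> topspace (top_of Y). \<psi> y \<in> V} (b \<circ> map_prod \<phi> \<psi>) (?pre D) \<and> z \<in> ?pre D \<and> ?pre D \<subseteq> ?pre W \<and>
         a \<circ> map_prod \<phi> \<psi> \<in> tensor_functions X Y {x \<in> topspace (top_of X). \<phi> x \<in> U}
          {y \<in> topspace (top_of Y). \<psi> y \<in> V} \<and>
         (\<forall>y\<in>?pre D. (f \<circ> map_prod \<phi> \<psi>) y = (a \<circ> map_prod \<phi> \<psi>) y / (b \<circ> map_prod \<phi> \<psi>) y)"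
        using basic[OF D(1)] D z tensor_functions_pullback[OF assms(1,2) UV D(4)] by auto
      then show ?thesis by blast
    qed
    then show ?thesis unfolding product_space_def by auto
  qed
  then show ?thesis unfolding is_morphism_def using cont ts by simp
qed

lemma reg_one_coordinate_space:
  "(\<lambda>_. 1) \<in> reg (coordinate_space P C) (topspace (top_of (coordinate_space P C)))"
  by (simp add: reg_coordinate_space_polynomial polynomial_functions.const zariski_open_whole)

lemma isomorphic_reg_one:
  assumes "isomorphic_spaces X Y" "(\<lambda>_. 1) \<in> reg Y (topspace (top_of Y))"
  shows "(\<lambda>_. 1) \<in> reg X (topspace (top_of X))"
proof -
  obtain \<phi> where \<phi>: "is_morphism X Y \<phi>" using assms(1) unfolding isomorphic_spaces_def by blast
  have "(\<lambda>_. 1) \<circ> \<phi> \<in> reg X {x \<in> topspace (top_of X). \<phi> x \<in> topspace (top_of Y)}"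
    using \<phi> assms(2) openin_topspace unfolding is_morphism_def by blast
  moreover have "{x \<in> topspace (top_of X). \<phi> x \<in> topspace (top_of Y)} = topspace (top_of X)"
    using \<phi> unfolding is_morphism_def continuous_map_def by auto
  ultimately show ?thesis by (simp add: comp_def)
qed

lemma isomorphic_product_spaces:
  assumes "isomorphic_spaces X X'" "isomorphic_spaces Y Y'"
    and one: "(\<lambda>_. 1) \<in> reg X' (topspace (top_of X'))" "(\<lambda>_. 1) \<in> reg Y' (topspace (top_of Y'))"
  shows "isomorphic_spaces (product_space X Y) (product_space X' Y')"
proof -
  note one' = isomorphic_reg_one[OF assms(1) one(1)] isomorphic_reg_one[OF assms(2) one(2)]
  obtain \<phi> \<phi>' where 1: "is_morphism X X' \<phi>" "is_morphism X' X \<phi>'"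
     "\<forall>x\<in>topspace (top_of X). \<phi>' (\<phi> x) = x" "\<forall>y\<in>topspace (top_of X'). \<phi> (\<phi>' y) = y"
    using assms(1) unfolding isomorphic_spaces_def by blast
  obtain \<psi> \<psi>' where 2: "is_morphism Y Y' \<psi>" "is_morphism Y' Y \<psi>'"
     "\<forall>x\<in>topspace (top_of Y). \<psi>' (\<psi> x) = x" "\<forall>y\<in>topspace (top_of Y'). \<psi> (\<psi>' y) = y"
    using assms(2) unfolding isomorphic_spaces_def by blast
  show ?thesis unfolding isomorphic_spaces_def
    topspace_product_space[OF one] topspace_product_space[OF one']
    using is_morphism_map_prod[OF 1(1) 2(1) one] is_morphism_map_prod[OF 1(2) 2(2) one'] 1 2
    by (intro exI[of _ "map_prod \<phi> \<psi>"] exI[of _ "map_prod \<phi>' \<psi>'"]) auto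
qed

section \<open>Products of coordinate spaces\<close>

definition product_coordinates ::
  "('p \<Rightarrow> 'k) set \<Rightarrow> ('q \<Rightarrow> 'k) set \<Rightarrow> ('p \<times> 'q \<Rightarrow> 'k) set" where
  "product_coordinates C E = (\<lambda>f. f \<circ> fst) ` C \<union> (\<lambda>f. f \<circ> snd) ` E"

text \<open>Polynomials in two groups of variables form the tensor product of the two polynomial
  rings. The summation runs over an arbitrary finite set of naturals, which makes sums and products
  of such expressions easy to reindex.\<close>

lemma polynomial_tensor:
  assumes "p \<in> polynomial_functions (product_coordinates C E)"
  shows "\<exists>(I::nat set) f g. finite I \<and> (\<forall>i\<in>I. f i \<in> polynomial_functions C \<and> g i \<in> polynomial_functions E) \<and>
     p = (\<lambda>(x, y). \<Sum>i\<in>I. f i x * g i y)"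
  using assms
proof induction
  case (const c)
  show ?case
    by (rule exI[of _ "{0}"], rule exI[of _ "\<lambda>_ _. c"], rule exI[of _ "\<lambda>_ _. 1"])
       (auto intro: polynomial_functions.const)
next
  case (coord p)
  then consider f where "f \<in> C" "p = f \<circ> fst" | f where "f \<in> E" "p = f \<circ> snd"
    unfolding product_coordinates_def by blast
  then show ?case
  proof cases
    case 1
    then show ?thesis
      by (intro exI[of _ "{0}"] exI[of _ "\<lambda>_. f"] exI[of _ "\<lambda>_ _. 1"])
         (auto intro: polynomial_functions.const polynomial_functions.coord)
  next
    case 2
    then show ?thesis
      by (intro exI[of _ "{0}"] exI[of _ "\<lambda>_. f"] exI[of _ "\<lambda>_ _. 1"])
         (auto intro!: exI[of _ "{0}"] exI[of _ "\<lambda>_ _. 1"] exI[of _ "\<lambda>_. f"] polynomial_functions.const polynomial_functions.coord)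
  qed
next
  case (add p q)
  then obtain I f g J f' g' where p: "finite (I::nat set)"
     "\<forall>i\<in>I. f i \<in> polynomial_functions C \<and> g i \<in> polynomial_functions E"
     "p = (\<lambda>(x, y). \<Sum>i\<in>I. f i x * g i y)"
    and q: "finite (J::nat set)"
     "\<forall>i\<in>J. f' i \<in> polynomial_functions C \<and> g' i \<in> polynomial_functions E"
     "q = (\<lambda>(x, y). \<Sum>i\<in>J. f' i x * g' i y)" by blast
  \<comment> \<open>The two index sets are made disjoint by moving \<open>I\<close> to even and
    \<open>J\<close> to odd numbers.\<close>
  have inj: "inj_on (\<lambda>i. 2 * i) I" "inj_on (\<lambda>i. Suc (2 * i)) J" by (auto simp: inj_on_def)
  have disj: "(\<lambda>i. 2 * i) ` I \<inter> (\<lambda>i. Suc (2 * i)) ` J = {}" by (auto, presburger)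
  have eq: "(\<Sum>i\<in>(\<lambda>i. 2 * i) ` I \<union> (\<lambda>i. Suc (2 * i)) ` J. (if even i then f (i div 2) else f' (i div 2)) x *
          (if even i then g (i div 2) else g' (i div 2)) y) =
      (\<Sum>i\<in>I. f i x * g i y) + (\<Sum>i\<in>J. f' i x * g' i y)" for x y
    using p(1) q(1)
    by (subst sum.union_disjoint) (simp_all add: disj sum.reindex inj)
  show ?case
    using p q
    by (intro exI[of _ "(\<lambda>i. 2 * i) ` I \<union> (\<lambda>i. Suc (2 * i)) ` J"]
       exI[of _ "\<lambda>i. if even i then f (i div 2) else f' (i div 2)"]
       exI[of _ "\<lambda>i. if even i then g (i div 2) else g' (i div 2)"] conjI)
       (auto simp: eq)
next
  case (mult p q)
  then obtain I f g J f' g' where p: "finite (I::nat set)"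
     "\<forall>i\<in>I. f i \<in> polynomial_functions C \<and> g i \<in> polynomial_functions E"
     "p = (\<lambda>(x, y). \<Sum>i\<in>I. f i x * g i y)"
    and q: "finite (J::nat set)"
     "\<forall>i\<in>J. f' i \<in> polynomial_functions C \<and> g' i \<in> polynomial_functions E"
     "q = (\<lambda>(x, y). \<Sum>i\<in>J. f' i x * g' i y)" by blast
  \<comment> \<open>Pairs of indices are encoded as naturals, so that the expanded product is again
    a sum over a set of naturals.\<close>
  obtain e :: "nat \<times> nat \<Rightarrow> nat" where e: "inj e" using ex_inj by blast
  have eq: "(\<Sum>k\<in>e ` (I \<times> J). (f (fst (inv_into UNIV e k)) x * f' (snd (inv_into UNIV e k)) x) *
         (g (fst (inv_into UNIV e k)) y * g' (snd (inv_into UNIV e k)) y)) =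
       (\<Sum>i\<in>I. f i x * g i y) * (\<Sum>i\<in>J. f' i x * g' i y)" for x y
  proof -
    have "(\<Sum>i\<in>I. f i x * g i y) * (\<Sum>i\<in>J. f' i x * g' i y) =
        (\<Sum>z\<in>I \<times> J. (f (fst z) x * g (fst z) y) * (f' (snd z) x * g' (snd z) y))"
      by (simp only: sum_product sum.cartesian_product split_def)
    then show ?thesis
      by (subst sum.reindex[OF inj_on_subset[OF e subset_UNIV]]) (simp add: inv_f_f[OF e] mult_ac)
  qed
  show ?case
    using p q
    by (intro exI[of _ "e ` (I \<times> J)"] exI[of _ "\<lambda>k x. f (fst (inv_into UNIV e k)) x * f' (snd (inv_into UNIV e k)) x"]
       exI[of _ "\<lambda>k y. g (fst (inv_into UNIV e k)) y * g' (snd (inv_into UNIV e k)) y"] conjI)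
       (auto simp: eq inv_f_f[OF e] intro: polynomial_functions.mult)
qed

lemma polynomial_tensor_functions:
  assumes "p \<in> polynomial_functions (product_coordinates C E)" "zariski_open P C U" "zariski_open Q E V"
  shows "p \<in> tensor_functions (coordinate_space P C) (coordinate_space Q E) U V"
proof -
  obtain I f g where p: "finite (I::nat set)"
     "\<forall>i\<in>I. f i \<in> polynomial_functions C \<and> g i \<in> polynomial_functions E"
     "p = (\<lambda>(x, y). \<Sum>i\<in>I. f i x * g i y)" using polynomial_tensor[OF assms(1)] by blast
  obtain e where e: "bij_betw e {..<card I} I" using p(1) ex_bij_betw_nat_finite[of I] by (auto simp: atLeast0LessThan)
  have "p = (\<lambda>(x, y). \<Sum>i<card I. f (e i) x * g (e i) y)"
    unfolding p(3) by (intro ext) (auto simp: sum.reindex_bij_betw[OF e, of "\<lambda>i. f i _ * g i _"])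
  moreover have "\<forall>i<card I. f (e i) \<in> reg (coordinate_space P C) U \<and> g (e i) \<in> reg (coordinate_space Q E) V"
    using p(2) e assms(2,3) by (auto simp: bij_betw_def intro!: reg_coordinate_space_polynomial)
  ultimately show ?thesis unfolding tensor_functions_def
    by (intro CollectI exI[of _ "card I"] exI[of _ "\<lambda>i. f (e i)"] exI[of _ "\<lambda>i. g (e i)"]) simp
qed

text \<open>Functions of one factor are regular on the preimage of \<open>U\<close> or
  \<open>V\<close> under a projection; \<open>restr\<close> shrinks their domain to
  \<open>U \<times> V\<close>, where sums and products can be formed.\<close>

lemma tensor_functions_reg:
  assumes U: "zariski_open P C U" and V: "zariski_open Q E V"
    and h: "h \<in> tensor_functions (coordinate_space P C) (coordinate_space Q E) U V"
  shows "h \<in> reg (coordinate_space (P \<times> Q) (product_coordinates C E)) (U \<times> V)"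
proof -
  let ?X = "coordinate_space (P \<times> Q) (product_coordinates C E)"
  have UV: "U \<subseteq> P" "V \<subseteq> Q" using U V by (auto simp: zariski_open_principal)
  then have sub: "U \<times> V \<subseteq> P \<times> Q" by auto
  have fst: "is_morphism ?X (coordinate_space P C) fst"
    by (rule polynomial_map_is_morphism)
       (auto simp: product_coordinates_def intro!: bexI[of _ "_ \<circ> fst"] polynomial_functions.coord)
  have snd: "is_morphism ?X (coordinate_space Q E) snd"
    by (rule polynomial_map_is_morphism)
       (auto simp: product_coordinates_def intro!: bexI[of _ "_ \<circ> snd"] polynomial_functions.coord)
  have opU: "zariski_open (P \<times> Q) (product_coordinates C E) {z \<in> P \<times> Q. fst z \<in> U}"
    using fst U unfolding is_morphism_def continuous_map_def by simp
  have opV: "zariski_open (P \<times> Q) (product_coordinates C E) {z \<in> P \<times> Q. snd z \<in> V}"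
    using snd V unfolding is_morphism_def continuous_map_def by simp
  have "openin (top_of ?X) ({z \<in> P \<times> Q. fst z \<in> U} \<inter> {z \<in> P \<times> Q. snd z \<in> V})"
    using opU opV by (intro openin_Int) auto
  moreover have "{z \<in> P \<times> Q. fst z \<in> U} \<inter> {z \<in> P \<times> Q. snd z \<in> V} = U \<times> V" using UV by auto
  ultimately have opUV: "zariski_open (P \<times> Q) (product_coordinates C E) (U \<times> V)" by simp
  have restr: "f \<in> reg ?X (U \<times> V)" if f: "f \<in> reg ?X W" and W: "W \<subseteq> P \<times> Q" "U \<times> V \<subseteq> W" for f W
    unfolding reg_coordinate_space[OF sub]
  proof
    fix z assume z: "z \<in> U \<times> V"
    obtain a b where ab: "a \<in> polynomial_functions (product_coordinates C E)"
       "b \<in> polynomial_functions (product_coordinates C E)" "b z \<noteq> 0"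
       "\<forall>y\<in>P \<times> Q. b y \<noteq> 0 \<longrightarrow> y \<in> W \<and> f y = a y / b y"
      using bspec[OF f[unfolded reg_coordinate_space[OF W(1)]], of z] z W(2) by blast
    obtain s where s: "s \<in> polynomial_functions (product_coordinates C E)" "s z \<noteq> 0"
       "\<forall>y\<in>P \<times> Q. s y \<noteq> 0 \<longrightarrow> y \<in> U \<times> V"
      using opUV[unfolded zariski_open_principal] z by blast
    have "(\<lambda>y. a y * s y) \<in> polynomial_functions (product_coordinates C E)"
      "(\<lambda>y. b y * s y) \<in> polynomial_functions (product_coordinates C E)"
      using ab s by (blast intro: polynomial_functions.mult)+
    moreover have "b z * s z \<noteq> 0 \<and> (\<forall>y\<in>P \<times> Q. b y * s y \<noteq> 0 \<longrightarrow>
        y \<in> U \<times> V \<and> f y = a y * s y / (b y * s y))"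
      using ab(3,4) s(2,3) by simp
    ultimately show "\<exists>a\<in>polynomial_functions (product_coordinates C E).
       \<exists>b\<in>polynomial_functions (product_coordinates C E).
         b z \<noteq> 0 \<and> (\<forall>y\<in>P \<times> Q. b y \<noteq> 0 \<longrightarrow> y \<in> U \<times> V \<and> f y = a y / b y)"
      by (intro bexI)
  qed
  obtain r f g where r: "h = (\<lambda>(x, y). \<Sum>i<(r::nat). f i x * g i y)"
    "\<forall>i<r. f i \<in> reg (coordinate_space P C) U \<and> g i \<in> reg (coordinate_space Q E) V"
    using h unfolding tensor_functions_def by blast
  have fi: "f i \<circ> fst \<in> reg ?X (U \<times> V)" if "i < r" for i
  proof (rule restr)
    show "f i \<circ> fst \<in> reg ?X {z \<in> P \<times> Q. fst z \<in> U}"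
      using fst U r(2) that unfolding is_morphism_def by simp
  qed (use UV in auto)
  have gi: "g i \<circ> snd \<in> reg ?X (U \<times> V)" if "i < r" for i
  proof (rule restr)
    show "g i \<circ> snd \<in> reg ?X {z \<in> P \<times> Q. snd z \<in> V}"
      using snd V r(2) that unfolding is_morphism_def by simp
  qed (use UV in auto)
  have "(\<lambda>z. \<Sum>i<m. (f i \<circ> fst) z * (g i \<circ> snd) z) \<in> reg ?X (U \<times> V)" if "m \<le> r" for m
    using that
  proof (induction m)
    case 0
    show ?case using reg_coordinate_space_polynomial[OF polynomial_functions.const opUV, of 0] by simp
  next
    case (Suc m)
    then show ?case
      using reg_coordinate_space_add_mult(1)[OF sub Suc.IH reg_coordinate_space_add_mult(2)[OF sub fi gi]]
      by simp
  qed
  from this[of r] show ?thesis unfolding r by (simp add: split_def)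
qed

text \<open>Locally a tensor function is a fraction, so basic open sets are Zariski open. Conversely
  a principal open set is basic with the full factors \<open>P\<close> and \<open>Q\<close>, because
  every polynomial on the product is a tensor function.\<close>

lemma product_of_coordinate_spaces:
  "isomorphic_spaces (product_space (coordinate_space P C) (coordinate_space Q E))
     (coordinate_space (P \<times> Q) (product_coordinates C E))"
proof -
  let ?X = "coordinate_space P C" and ?Y = "coordinate_space Q E"
  let ?Z = "coordinate_space (P \<times> Q) (product_coordinates C E)"
  let ?pf = "polynomial_functions (product_coordinates C E)"
  have basic_open: "zariski_open (P \<times> Q) (product_coordinates C E) W"
    if W: "product_basic_open ?X ?Y U V h W" for U V h W
    unfolding zariski_open_principal
  proof (intro conjI ballI)
    have U: "zariski_open P C U" and V: "zariski_open Q E V"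
      and h: "h \<in> tensor_functions ?X ?Y U V" and Weq: "W = {z \<in> U \<times> V. h z \<noteq> 0}"
      using W unfolding product_basic_open_def by auto
    have sub: "U \<times> V \<subseteq> P \<times> Q" using U V by (auto simp: zariski_open_principal)
    then show "W \<subseteq> P \<times> Q" using Weq by blast
    fix z assume z: "z \<in> W"
    obtain a b where ab: "a \<in> ?pf" "b \<in> ?pf" "b z \<noteq> 0"
        "\<forall>y\<in>P \<times> Q. b y \<noteq> 0 \<longrightarrow> y \<in> U \<times> V \<and> h y = a y / b y"
      using bspec[OF tensor_functions_reg[OF U V h, unfolded reg_coordinate_space[OF sub]], of z] z Weq by blast
    have "h z \<noteq> 0" "z \<in> P \<times> Q" using z Weq sub by auto
    then have "a z \<noteq> 0" using ab by auto
    \<comment> \<open>Nonvanishing of \<open>b\<close> puts a point into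
      \<open>U \<times> V\<close>; nonvanishing of \<open>a\<close> then gives
      \<open>h y \<noteq> 0\<close>.\<close>
    have "(\<lambda>y. a y * b y) \<in> ?pf" using ab by (blast intro: polynomial_functions.mult)
    moreover have "a z * b z \<noteq> 0 \<and> (\<forall>y\<in>P \<times> Q. a y * b y \<noteq> 0 \<longrightarrow> y \<in> W)"
      using ab \<open>a z \<noteq> 0\<close> unfolding Weq by auto
    ultimately show "\<exists>s\<in>?pf. s z \<noteq> 0 \<and> (\<forall>y\<in>P \<times> Q. s y \<noteq> 0 \<longrightarrow> y \<in> W)" by (intro bexI)
  qed
  have principal_basic: "product_basic_open ?X ?Y P Q s {z \<in> P \<times> Q. s z \<noteq> 0}" if "s \<in> ?pf" for s
    using polynomial_tensor_functions[OF that zariski_open_whole zariski_open_whole]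
    by (intro product_basic_openI) (auto simp: zariski_open_whole)
  have top_prod: "top_of (product_space ?X ?Y) =
        topology_generated_by {W. \<exists>U V h. product_basic_open ?X ?Y U V h W}"
    by (simp add: product_space_def)
  show ?thesis
  proof (rule isomorphic_spaces_same)
    fix W
    show op: "openin (top_of (product_space ?X ?Y)) W \<longleftrightarrow> openin (top_of ?Z) W"
    proof
      assume "openin (top_of (product_space ?X ?Y)) W"
      then have "generate_topology_on {W. \<exists>U V h. product_basic_open ?X ?Y U V h W} W"
        unfolding top_prod by (simp add: openin_topology_generated_by_iff)
      then show "openin (top_of ?Z) W"
      proof induction
        case (Int a b)
        then show ?case by (blast intro: openin_Int)
      next
        case (UN K)
        then show ?case by (blast intro: openin_Union)
      next
        case (Basis s)
        then show ?case using basic_open by auto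
      qed (rule openin_empty)
    next
      assume W: "openin (top_of ?Z) W"
      show "openin (top_of (product_space ?X ?Y)) W"
      proof (subst openin_subopen, intro ballI)
        fix z assume z: "z \<in> W"
        then obtain s where s: "s \<in> ?pf" "s z \<noteq> 0" "\<forall>y\<in>P \<times> Q. s y \<noteq> 0 \<longrightarrow> y \<in> W"
          using W by (auto simp: zariski_open_principal)
        have "z \<in> P \<times> Q" using z W by (auto simp: zariski_open_principal)
        then show "\<exists>T. openin (top_of (product_space ?X ?Y)) T \<and> z \<in> T \<and> T \<subseteq> W"
          using openin_product_basic[OF principal_basic[OF s(1)]] s
          by (intro exI[of _ "{z \<in> P \<times> Q. s z \<noteq> 0}"]) auto
      qed
    qed
    fix f assume "openin (top_of (product_space ?X ?Y)) W"
    with op have "zariski_open (P \<times> Q) (product_coordinates C E) W" by simp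
    then have WPQ: "W \<subseteq> P \<times> Q" by (simp add: zariski_open_principal)
    show "f \<in> reg (product_space ?X ?Y) W \<longleftrightarrow> f \<in> reg ?Z W"
    proof
      assume f: "f \<in> reg (product_space ?X ?Y) W"
      show "f \<in> reg ?Z W" unfolding reg_coordinate_space[OF WPQ]
      proof
        fix z assume "z \<in> W"
        then obtain U V a b D where D: "product_basic_open ?X ?Y U V b D" "z \<in> D" "D \<subseteq> W"
           "a \<in> tensor_functions ?X ?Y U V" "\<forall>y\<in>D. f y = a y / b y"
          using f unfolding product_space_def by auto
        have U: "zariski_open P C U" and V: "zariski_open Q E V"
          and b: "b \<in> tensor_functions ?X ?Y U V" and Deq: "D = {z \<in> U \<times> V. b z \<noteq> 0}"
          using D unfolding product_basic_open_def by auto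
        have sub: "U \<times> V \<subseteq> P \<times> Q" using U V by (auto simp: zariski_open_principal)
        obtain a1 a2 where a: "a1 \<in> ?pf" "a2 \<in> ?pf" "a2 z \<noteq> 0"
          "\<forall>y\<in>P \<times> Q. a2 y \<noteq> 0 \<longrightarrow> y \<in> U \<times> V \<and> a y = a1 y / a2 y"
          using bspec[OF tensor_functions_reg[OF U V D(4), unfolded reg_coordinate_space[OF sub]], of z] D(2) Deq by blast
        obtain b1 b2 where b: "b1 \<in> ?pf" "b2 \<in> ?pf" "b2 z \<noteq> 0"
          "\<forall>y\<in>P \<times> Q. b2 y \<noteq> 0 \<longrightarrow> y \<in> U \<times> V \<and> b y = b1 y / b2 y"
          using bspec[OF tensor_functions_reg[OF U V b, unfolded reg_coordinate_space[OF sub]], of z] D(2) Deq by blast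
        have "b z \<noteq> 0" "z \<in> P \<times> Q" using D Deq sub by auto
        then have b1z: "b1 z \<noteq> 0" using b by auto
        \<comment> \<open>The second factor \<open>b2\<close> makes nonvanishing of the denominator
          imply \<open>b2 y \<noteq> 0\<close>, so that the fraction for \<open>b\<close> is valid
          at \<open>y\<close>.\<close>
        have *: "y \<in> W \<and> f y = ((a1 y * b2 y) * b2 y) / ((a2 y * b1 y) * b2 y)"
          if y: "y \<in> P \<times> Q" "(a2 y * b1 y) * b2 y \<noteq> 0" for y
        proof -
          have "y \<in> U \<times> V" "a y = a1 y / a2 y" "b y = b1 y / b2 y" using y a b by auto
          moreover have "b y \<noteq> 0" using calculation y by auto
          moreover from calculation have "y \<in> D" unfolding Deq by blast
          ultimately have "y \<in> W" "f y = (a1 y / a2 y) / (b1 y / b2 y)" using D(3,5) by auto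
          then show ?thesis using y(2) by simp
        qed
        note polynomial_functions.mult[OF polynomial_functions.mult[OF a(1) b(2)] b(2)]
          polynomial_functions.mult[OF polynomial_functions.mult[OF a(2) b(1)] b(2)]
        moreover have "(a2 z * b1 z) * b2 z \<noteq> 0 \<and> (\<forall>y\<in>P \<times> Q. (a2 y * b1 y) * b2 y \<noteq> 0 \<longrightarrow>
            y \<in> W \<and> f y = ((a1 y * b2 y) * b2 y) / ((a2 y * b1 y) * b2 y))"
          using a b b1z * by simp
        ultimately show "\<exists>a\<in>?pf. \<exists>b\<in>?pf.
            b z \<noteq> 0 \<and> (\<forall>y\<in>P \<times> Q. b y \<noteq> 0 \<longrightarrow> y \<in> W \<and> f y = a y / b y)" by (intro bexI)
      qed
    next
      assume f: "f \<in> reg ?Z W"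
      have "\<exists>U V a b D. product_basic_open ?X ?Y U V b D \<and> z \<in> D \<and> D \<subseteq> W \<and>
               a \<in> tensor_functions ?X ?Y U V \<and> (\<forall>y\<in>D. f y = a y / b y)" if z: "z \<in> W" for z
      proof -
        obtain a b where ab: "a \<in> ?pf" "b \<in> ?pf" "b z \<noteq> 0"
          "\<forall>y\<in>P \<times> Q. b y \<noteq> 0 \<longrightarrow> y \<in> W \<and> f y = a y / b y"
          using bspec[OF f[unfolded reg_coordinate_space[OF WPQ]] z] by blast
        show ?thesis
          using principal_basic[OF ab(2)] polynomial_tensor_functions[OF ab(1) zariski_open_whole zariski_open_whole, of P Q]
             ab z WPQ
          by (intro exI[of _ P] exI[of _ Q] exI[of _ a] exI[of _ b] exI[of _ "{z \<in> P \<times> Q. b z \<noteq> 0}"]) auto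
      qed
      then show "f \<in> reg (product_space ?X ?Y) W" unfolding product_space_def by auto
    qed
  qed
qed

section \<open>Flags of invertible matrices\<close>

no_notation vec_index (infixl \<open>$\<close> 100)

lemmas cart_eq_iff = Finite_Cartesian_Product.vec_eq_iff

definition coord_subspace :: "'n set \<Rightarrow> ('k::field ^ 'n) set" where
  "coord_subspace d = {x. \<forall>i. i \<notin> d \<longrightarrow> x $ i = 0}"

lemma subspace_coord_subspace: "vec.subspace (coord_subspace d)"
  unfolding coord_subspace_def vec.subspace_def by simp

lemma dim_coord_subspace: "vec.dim (coord_subspace d) = card d"
  unfolding coord_subspace_def by (rule dim_substandard_cart)

lemma matrix_vector_mult_axis: "A *v axis j 1 = column j (A :: 'k::field ^ 'n ^ 'm)"
  by (simp add: cart_eq_iff matrix_vector_mult_def column_def axis_def if_distrib cong: if_cong)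

lemma invertible_kernel:
  "invertible (A :: 'k::field ^ 'n ^ 'n) \<longleftrightarrow> (\<forall>x. A *v x = 0 \<longrightarrow> x = 0)"
  by (simp add: invertible_left_inverse matrix_left_invertible_ker)

lemma dim_matrix_image:
  fixes g :: "'k::field ^ 'n ^ 'n"
  assumes "invertible g" shows "vec.dim ((*v) g ` S) = vec.dim S"
  using inj_matrix_vector_mult[OF assms]
  by (intro vec.dim_image_eq matrix_vector_mul_linear_gen) (auto intro: inj_on_subset)

lemma column_flag_image:
  fixes g :: "('k::field, 'n::{finite,linorder}) square_matrix"
  shows "column_flag g p = (*v) g ` coord_subspace {..p}"
proof
  have "vec.subspace ((*v) g ` coord_subspace {..p})"
    by (intro vec.linear_subspace_image matrix_vector_mul_linear_gen subspace_coord_subspace)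
  moreover have "{column j g | j. j \<le> p} \<subseteq> (*v) g ` coord_subspace {..p}"
    unfolding matrix_vector_mult_axis[symmetric]
    by (auto simp: coord_subspace_def axis_def)
  ultimately show "column_flag g p \<subseteq> (*v) g ` coord_subspace {..p}"
    unfolding column_flag_def by (intro vec.span_minimal)
next
  show "(*v) g ` coord_subspace {..p} \<subseteq> column_flag g p"
  proof (rule image_subsetI)
    fix x :: "('k, 'n) Finite_Cartesian_Product.vec" assume x: "x \<in> coord_subspace {..p}"
    have "x $ i *s column i g \<in> vec.span {column j g | j. j \<le> p}" for i
    proof (cases "i \<le> p")
      case True
      then show ?thesis by (intro vec.span_scale vec.span_base) blast
    next
      case False
      then have "x $ i = 0" using x by (simp add: coord_subspace_def)
      then show ?thesis by (simp add: vec.span_zero)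
    qed
    then show "g *v x \<in> column_flag g p"
      unfolding matrix_mult_sum column_flag_def by (intro vec.span_sum)
  qed
qed

lemma column_in_column_flag: "j \<le> p \<Longrightarrow> column j g \<in> column_flag g p"
  unfolding column_flag_def by (intro vec.span_base) blast

lemma column_flag_mult: "column_flag (g ** h) p = (*v) g ` column_flag h p"
  unfolding column_flag_image by (simp add: image_image matrix_vector_mul_assoc)

lemma dim_column_flag: "invertible g \<Longrightarrow> vec.dim (column_flag g p) = card {..p}"
  by (simp add: column_flag_image dim_matrix_image dim_coord_subspace)

lemma subspace_column_flag: "vec.subspace (column_flag g p)"
  unfolding column_flag_def by (rule vec.subspace_span)

lemma column_flag_complete:
  fixes g :: "('k::field, 'n::{finite,linorder}) square_matrix"
  shows "invertible g \<Longrightarrow> column_flag g \<in> complete_flags"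
  unfolding complete_flags_def
proof (intro CollectI conjI allI impI)
  fix p q :: 'n assume "p \<le> q"
  then have "{column j g | j. j \<le> p} \<subseteq> {column j g | j. j \<le> q}" by (blast intro: order_trans)
  then show "column_flag g p \<subseteq> column_flag g q" unfolding column_flag_def by (rule vec.span_mono)
qed (simp_all add: dim_column_flag subspace_column_flag)

lemma column_flag_eqI:
  assumes W: "W \<in> complete_flags" and g: "invertible g"
    and "\<And>p. column p g \<in> W p"
  shows "column_flag g = W"
proof
  fix p
  have "{column j g | j. j \<le> p} \<subseteq> W p" using assms unfolding complete_flags_def by blast
  then have "column_flag g p \<subseteq> W p"
    unfolding column_flag_def using W by (intro vec.span_minimal) (auto simp: complete_flags_def)
  then show "column_flag g p = W p"
    using W g by (intro vec.subspace_dim_equal)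
      (auto simp: complete_flags_def dim_column_flag subspace_column_flag)
qed

text \<open>In a nontrivial linear relation take the last column involved: it would lie in the
  preceding member of the flag, or be zero if there is none.\<close>

lemma invertible_from_flag:
  fixes W :: "('k::field, 'n::{finite,linorder}) flag"
  assumes W: "W \<in> complete_flags"
    and "\<And>p. column p g \<in> W p" and nz: "\<And>p. column p g \<noteq> 0"
    and new: "\<And>p q. q < p \<Longrightarrow> column p g \<notin> W q"
  shows "invertible g"
  unfolding invertible_kernel
proof (intro allI impI, rule ccontr)
  fix x assume gx: "g *v x = 0" and "x \<noteq> 0"
  then have ne: "{i. x $ i \<noteq> 0} \<noteq> {}" by (auto simp: cart_eq_iff)
  define m where "m = Max {i. x $ i \<noteq> 0}"
  have xm: "x $ m \<noteq> 0" using Max_in[OF _ ne] unfolding m_def by simp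
  have le: "i \<le> m" if "x $ i \<noteq> 0" for i using that unfolding m_def by simp
  have "(\<Sum>i\<in>UNIV. x $ i *s column i g) = 0" using gx by (simp add: matrix_mult_sum)
  then have eq: "x $ m *s column m g = - (\<Sum>i\<in>UNIV - {m}. x $ i *s column i g)"
    by (subst (asm) sum.remove[of _ m]) (auto simp: add_eq_0_iff2)
  show False
  proof (cases "\<exists>q. q < m")
    case False
    then have "x $ i = 0" if "i \<noteq> m" for i using le[of i] that by (meson order_le_less)
    then have "x $ m *s column m g = 0" unfolding eq by (simp add: sum.neutral)
    then show False using xm nz by (simp add: vec.scale_eq_0_iff)
  next
    case True
    define q where "q = Max {q. q < m}"
    have q: "q < m" using Max_in[of "{q. q < m}"] True unfolding q_def by auto
    have qle: "i \<le> q" if "i < m" for i using that unfolding q_def by simp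
    have sub: "vec.subspace (W q)" using W by (simp add: complete_flags_def)
    have "x $ i *s column i g \<in> W q" if "i \<noteq> m" for i
    proof (cases "x $ i = 0")
      case True
      then show ?thesis using sub by (simp add: vec.subspace_0)
    next
      case False
      then have "i \<le> q" using le[of i] that qle by (simp add: order_less_le)
      then have "column i g \<in> W q" using assms(2)[of i] W unfolding complete_flags_def by blast
      then show ?thesis using sub by (simp add: vec.subspace_scale)
    qed
    then have "x $ m *s column m g \<in> W q" unfolding eq
      using sub by (intro vec.subspace_neg vec.subspace_sum) auto
    then have "inverse (x $ m) *s (x $ m *s column m g) \<in> W q" using sub by (rule vec.subspace_scale[rotated])
    then show False using xm new[OF q] by simp
  qed
qed

lemma matrix_of_columns: "\<exists>g. \<forall>p. column p g = (f p :: 'k ^ 'n)"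
  by (intro exI[of _ "\<chi> i j. f j $ i"]) (simp add: column_def cart_eq_iff)

text \<open>Dimensions increase strictly, so each \<open>W p\<close> has a nonzero vector outside
  all smaller members; these vectors are the columns.\<close>

lemma complete_flag_column_flag:
  fixes W :: "('k::field, 'n::{finite,linorder}) flag"
  assumes W: "W \<in> complete_flags"
  obtains g where "invertible g" "column_flag g = W"
proof -
  have "\<exists>x. x \<in> W p \<and> x \<noteq> 0 \<and> (\<forall>q<p. x \<notin> W q)" for p
  proof (cases "\<exists>q. q < p")
    case False
    have "vec.dim (W p) \<noteq> 0" using W by (simp add: complete_flags_def)
    then have "\<not> W p \<subseteq> {0}" using vec.dim_le_card[of "W p" "{}"] by auto
    then show ?thesis using False by blast
  next
    case True
    define q where "q = Max {q. q < p}"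
    have q: "q < p" using Max_in[of "{q. q < p}"] True unfolding q_def by auto
    have qle: "i \<le> q" if "i < p" for i using that unfolding q_def by simp
    have "card {..q} < card {..p}" using q by (intro psubset_card_mono) auto
    then have "vec.dim (W q) < vec.dim (W p)" using W by (simp add: complete_flags_def)
    then have "\<not> W p \<subseteq> W q" using vec.dim_subset[of "W p" "W q"] by linarith
    then obtain x where x: "x \<in> W p" "x \<notin> W q" by blast
    moreover have "x \<noteq> 0" using x W vec.subspace_0 by (auto simp: complete_flags_def)
    moreover have "x \<notin> W i" if "i < p" for i
      using x(2) qle[OF that] W unfolding complete_flags_def by blast
    ultimately show ?thesis by blast
  qed
  then obtain f where f: "\<And>p. f p \<in> W p \<and> f p \<noteq> 0 \<and> (\<forall>q<p. f p \<notin> W q)" by metis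
  obtain g where g: "\<forall>p. column p g = f p" using matrix_of_columns by blast
  have "invertible g" by (rule invertible_from_flag[OF W]) (use f g in auto)
  moreover from this have "column_flag g = W" by (rule column_flag_eqI[OF W]) (use f g in auto)
  ultimately show ?thesis using that by blast
qed

lemma wf_order_on_finite: "wf {(j, i). (f :: 'n::finite \<Rightarrow> 'b::linorder) j < f i}"
proof (rule finite_acyclic_wf)
  show "acyclic {(j, i). f j < f i}"
    unfolding acyclic_def
  proof (intro allI notI)
    fix x assume "(x, x) \<in> {(j, i). f j < f i}\<^sup>+"
    moreover have "trans {(j, i). f j < f i}" by (auto intro: transI)
    ultimately show False by simp
  qed
qed simp

text \<open>A vector killed by a unitriangular square submatrix, whose rows and columns are the support
  of the vector, vanishes: look at a minimal index of the support.\<close>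

lemma unitriangular_kernel:
  fixes A :: "'k::field ^ 'n::finite ^ 'n" and x :: "'k ^ 'n"
  assumes "wf r"
    and "\<And>i. x $ i \<noteq> 0 \<Longrightarrow> A $ i $ i = 1"
    and "\<And>i j. x $ i \<noteq> 0 \<Longrightarrow> x $ j \<noteq> 0 \<Longrightarrow> A $ i $ j \<noteq> 0 \<Longrightarrow> i = j \<or> (j, i) \<in> r"
    and "\<And>i. x $ i \<noteq> 0 \<Longrightarrow> (A *v x) $ i = 0"
  shows "x = 0"
proof (rule ccontr)
  assume "x \<noteq> 0"
  then obtain i0 where "i0 \<in> {i. x $ i \<noteq> 0}" by (auto simp: cart_eq_iff)
  then obtain i where i: "x $ i \<noteq> 0" and min: "\<And>j. (j, i) \<in> r \<Longrightarrow> x $ j = 0"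
    using wfE_min[OF assms(1)] by (metis (mono_tags, lifting) mem_Collect_eq)
  have "(A *v x) $ i = (\<Sum>j\<in>UNIV. A $ i $ j * x $ j)" by (simp add: matrix_vector_mult_def)
  also have "\<dots> = (\<Sum>j\<in>UNIV. if j = i then A $ i $ i * x $ i else 0)"
    using assms(3)[OF i] min by (intro sum.cong refl) (metis mult_eq_0_iff)
  also have "\<dots> = x $ i" using assms(2)[OF i] by simp
  finally show False using assms(4)[OF i] i by simp
qed

definition lower_unitriangular :: "('k::field, 'n::{finite,linorder}) square_matrix set" where
  "lower_unitriangular = {u. \<forall>j i. (j = i \<longrightarrow> u $ j $ i = 1) \<and> (j < i \<longrightarrow> u $ j $ i = 0)}"

text \<open>Only rows in the support of \<open>x\<close> need to be tested. This is what makes the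
  lemma usable for vectors known in part of the rows, such as those in
  \<open>incidence_space\<close>.\<close>

lemma lower_unitriangular_kernel:
  assumes "u \<in> lower_unitriangular" "\<And>i. x $ i \<noteq> 0 \<Longrightarrow> (u *v x) $ i = 0"
  shows "x = 0"
  by (rule unitriangular_kernel[OF wf_order_on_finite[of id], of x u])
     (use assms in \<open>auto simp: lower_unitriangular_def not_less_iff_gr_or_eq intro: ccontr\<close>)

lemma lower_unitriangular_invertible: "u \<in> lower_unitriangular \<Longrightarrow> invertible u"
  unfolding invertible_kernel using lower_unitriangular_kernel by (metis zero_index)

section \<open>The normal form of a generic flag\<close>

text \<open>The determinant of \<open>corner_matrix h i\<close> is the leading principal minor of \<open>h\<close> ending at \<open>i\<close>.\<close>

definition corner_matrix ::
  "('k::field, 'n::{finite,linorder}) square_matrix \<Rightarrow> 'n \<Rightarrow> ('k, 'n) square_matrix" where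
  "corner_matrix h i = (\<chi> r s. if s \<le> i then h $ r $ s else if r = s then 1 else 0)"

text \<open>The numerator in Cramer's rule for coordinate \<open>j\<close> of the solution of the
  system with matrix \<open>corner_matrix h i\<close> and right-hand side
  \<open>axis i 1\<close>.\<close>

definition corner_numerator ::
  "('k::field, 'n::{finite,linorder}) square_matrix \<Rightarrow> 'n \<Rightarrow> 'n \<Rightarrow> 'k" where
  "corner_numerator h i j =
     Determinants.det (\<chi> r s. if s = j then axis i 1 $ r else corner_matrix h i $ r $ s)"

definition generic_flag_matrix :: "('k::field, 'n::{finite,linorder}) square_matrix \<Rightarrow> bool" where
  "generic_flag_matrix h \<longleftrightarrow> (\<forall>i. Determinants.det (corner_matrix h i) \<noteq> 0)"

definition flag_normal_form ::
  "('k::field, 'n::{finite,linorder}) square_matrix \<Rightarrow> ('k, 'n) square_matrix" where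
  "flag_normal_form h = (\<chi> j i. if j = i then 1 else if j < i then 0
     else - corner_numerator h i j / Determinants.det (corner_matrix h i))"

lemma flag_normal_form_lower: "flag_normal_form h \<in> lower_unitriangular"
  unfolding flag_normal_form_def lower_unitriangular_def by simp

lemma corner_matrix_mult:
  "(corner_matrix h i *v x) $ r = (h *v (\<chi> s. if s \<le> i then x $ s else 0)) $ r + (if r \<le> i then 0 else x $ r)"
proof -
  have "(corner_matrix h i *v x) $ r = (\<Sum>s\<in>UNIV. corner_matrix h i $ r $ s * x $ s)"
    by (simp add: matrix_vector_mult_def)
  also have "\<dots> =
      (\<Sum>s\<in>UNIV. h $ r $ s * (if s \<le> i then x $ s else 0) + (if s = r then if r \<le> i then 0 else x $ r else 0))"
    by (intro sum.cong refl) (auto simp: corner_matrix_def)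
  finally have "(corner_matrix h i *v x) $ r =
      (\<Sum>s\<in>UNIV. h $ r $ s * (if s \<le> i then x $ s else 0) + (if s = r then if r \<le> i then 0 else x $ r else 0))" .
  then show ?thesis by (simp add: sum.distrib matrix_vector_mult_def)
qed

text \<open>One system yields everything: the coordinates of its solution up to \<open>i\<close> are
  the coefficients of the wanted combination of columns of \<open>h\<close>, and those beyond
  \<open>i\<close> are the negatives of the entries of that combination below row
  \<open>i\<close>.\<close>

lemma flag_normal_form_column:
  assumes "generic_flag_matrix h"
  shows "column i (flag_normal_form h) \<in> column_flag h i"
proof -
  define d where "d = Determinants.det (corner_matrix h i)"
  have d: "d \<noteq> 0" using assms by (simp add: generic_flag_matrix_def d_def)
  define \<mu> where "\<mu> = (\<chi> j. corner_numerator h i j / d)"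
  have "corner_matrix h i *v \<mu> = axis i 1"
    unfolding cramer[OF d[unfolded d_def]] \<mu>_def corner_numerator_def d_def by simp
  then have eq: "axis i 1 $ r = (h *v (\<chi> s. if s \<le> i then \<mu> $ s else 0)) $ r + (if r \<le> i then 0 else \<mu> $ r)" for r
    using corner_matrix_mult[of h i \<mu> r] by simp
  have "(h *v (\<chi> s. if s \<le> i then \<mu> $ s else 0)) $ r = column i (flag_normal_form h) $ r" for r
    using eq[of r] unfolding column_def flag_normal_form_def
    by (auto simp: axis_def \<mu>_def d_def eq_neg_iff_add_eq_0 split: if_splits)
  then have "h *v (\<chi> s. if s \<le> i then \<mu> $ s else 0) = column i (flag_normal_form h)"
    by (simp add: cart_eq_iff)
  then show ?thesis unfolding column_flag_image coord_subspace_def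
    by (intro image_eqI[of _ _ "\<chi> s. if s \<le> i then \<mu> $ s else 0"]) auto
qed

lemma column_flag_normal_form:
  assumes "generic_flag_matrix h" "invertible h"
  shows "column_flag (flag_normal_form h) = column_flag h"
  by (intro column_flag_eqI column_flag_complete assms flag_normal_form_column
      lower_unitriangular_invertible flag_normal_form_lower)

text \<open>Column \<open>i\<close> of \<open>u'\<close> is \<open>u *v z\<close> with
  \<open>z\<close> supported up to \<open>i\<close>. In these rows the columns of \<open>u\<close>
  and \<open>u'\<close> agree, so \<open>u\<close> kills \<open>z - axis i 1\<close> on its
  support.\<close>

lemma lower_unitriangular_column_flag_unique:
  assumes u: "u \<in> lower_unitriangular" and u': "u' \<in> lower_unitriangular"
    and "column_flag u = column_flag u'"
  shows "u = u'"
proof -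
  have "column i u' = column i u" for i
  proof -
    have "column i u' \<in> column_flag u i" using assms(3) column_in_column_flag[of i i u'] by simp
    then obtain z where z: "column i u' = u *v z" "z \<in> coord_subspace {..i}"
      unfolding column_flag_image by blast
    have "z - axis i 1 = 0"
    proof (rule lower_unitriangular_kernel[OF u])
      fix r assume "(z - axis i 1) $ r \<noteq> 0"
      then have "r \<le> i" using z(2) by (auto simp: coord_subspace_def axis_def split: if_splits)
      moreover have "(u *v (z - axis i 1)) = column i u' - column i u"
        by (simp add: vec.diff matrix_vector_mult_axis z(1))
      ultimately show "(u *v (z - axis i 1)) $ r = 0"
        using u u' unfolding lower_unitriangular_def column_def by (cases "r = i") auto
    qed
    then show ?thesis using z by (simp add: matrix_vector_mult_axis)
  qed
  then show ?thesis by (simp add: column_def cart_eq_iff)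
qed

text \<open>A kernel vector of a corner matrix has a truncation \<open>y\<close> for which
  \<open>h *v y\<close> vanishes in rows up to \<open>i\<close> and lies in the span of the first
  columns of \<open>u\<close>. Triangularity makes it zero, invertibility of \<open>h\<close> gives
  \<open>y = 0\<close>, and the remaining coordinates vanish row by row.\<close>

lemma generic_flag_matrixI:
  assumes u: "u \<in> lower_unitriangular" and h: "invertible h" and eq: "column_flag h = column_flag u"
  shows "generic_flag_matrix h"
  unfolding generic_flag_matrix_def
proof
  fix i
  have "x = 0" if x: "corner_matrix h i *v x = 0" for x
  proof -
    define y where "y = (\<chi> s. if s \<le> i then x $ s else 0)"
    have hy: "(h *v y) $ r = - (if r \<le> i then 0 else x $ r)" for r
      using corner_matrix_mult[of h i x r] x unfolding y_def by (simp add: add_eq_0_iff2)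
    have "h *v y \<in> column_flag h i" unfolding column_flag_image by (auto simp: coord_subspace_def y_def)
    then obtain z where z: "h *v y = u *v z" "z \<in> coord_subspace {..i}"
      unfolding eq unfolding column_flag_image by blast
    have "z = 0"
      by (rule lower_unitriangular_kernel[OF u])
         (use z hy in \<open>auto simp: coord_subspace_def split: if_splits\<close>)
    then have "h *v y = 0" using z by simp
    then have "y = 0" using h unfolding invertible_kernel by blast
    show ?thesis unfolding cart_eq_iff
    proof
      fix r show "x $ r = 0 $ r"
        using hy[of r] \<open>y = 0\<close> unfolding y_def by (auto simp: cart_eq_iff \<open>h *v y = 0\<close>[unfolded y_def] split: if_splits)
    qed
  qed
  then show "Determinants.det (corner_matrix h i) \<noteq> 0"
    by (metis invertible_det_nz invertible_kernel)
qed

lemma flag_normal_form_eq: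
  assumes u: "u \<in> lower_unitriangular" and h: "invertible h" and eq: "column_flag h = column_flag u"
  shows "flag_normal_form h = u"
  by (rule lower_unitriangular_column_flag_unique[OF flag_normal_form_lower u])
     (simp add: column_flag_normal_form generic_flag_matrixI[OF assms] h eq)

section \<open>Charts of the flag variety\<close>

definition matrix_entries :: "(('k::field, 'n::finite) square_matrix \<Rightarrow> 'k) set" where
  "matrix_entries = {(\<lambda>g. vec_nth (vec_nth g i) j) | i j. True}"

lemma polynomial_matrix_entry: "(\<lambda>g. g $ i $ j) \<in> polynomial_functions matrix_entries"
  unfolding matrix_entries_def by (intro polynomial_functions.coord) blast

lemma polynomial_det:
  assumes "\<And>i j. (\<lambda>x. A x $ i $ j) \<in> polynomial_functions C"
  shows "(\<lambda>x. Determinants.det (A x :: ('k::field, 'n::finite) square_matrix)) \<in> polynomial_functions C"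
  unfolding Determinants.det_def
  by (intro polynomial_functions_sum polynomial_functions.mult polynomial_functions.const
      polynomial_functions_prod assms)

lemma polynomial_matrix_mult_left:
  fixes A :: "('k::field, 'n::finite) square_matrix"
  assumes "p \<in> polynomial_functions matrix_entries"
  shows "(\<lambda>u. p (A ** u)) \<in> polynomial_functions matrix_entries"
proof -
  have "\<exists>g\<in>polynomial_functions matrix_entries. \<forall>x\<in>UNIV. p (A ** x) = g x"
  proof (rule polynomial_functions_compose[OF assms])
    fix e :: "('k, 'n) square_matrix \<Rightarrow> 'k" assume "e \<in> matrix_entries"
    then obtain i j where e: "e = (\<lambda>g. g $ i $ j)" unfolding matrix_entries_def by blast
    have "(\<lambda>u. \<Sum>k\<in>UNIV. A $ i $ k * u $ k $ j) \<in> polynomial_functions matrix_entries"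
      by (intro polynomial_functions_sum polynomial_functions.mult polynomial_functions.const
          polynomial_matrix_entry)
    then show "\<exists>g\<in>polynomial_functions matrix_entries. \<forall>x\<in>UNIV. e (A ** x) = g x"
      by (intro bexI[of _ "\<lambda>u. \<Sum>k\<in>UNIV. A $ i $ k * u $ k $ j"]) (simp_all add: e matrix_matrix_mult_def)
  qed
  then obtain g where "g \<in> polynomial_functions matrix_entries" "\<forall>x. p (A ** x) = g x" by auto
  moreover from this have "(\<lambda>u. p (A ** u)) = g" by auto
  ultimately show ?thesis by simp
qed

lemma openin_flag_variety [simp]: "openin (top_of flag_variety) U \<longleftrightarrow> flag_open U"
  by (simp add: flag_variety_def istopology_flag_open)

lemma flag_open_iff:
  "flag_open U \<longleftrightarrow> U \<subseteq> complete_flags \<and>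
     zariski_open {g. invertible g} matrix_entries (flag_preimage U)"
  unfolding flag_open_def general_linear_group_def matrix_entries_def
  by (simp add: openin_subspace_coordinate_space)

lemma reg_flag_variety:
  assumes "flag_open U"
  shows "f \<in> reg flag_variety U \<longleftrightarrow>
     f \<circ> column_flag \<in> reg (coordinate_space {g. invertible g} matrix_entries) (flag_preimage U)"
proof -
  have "zariski_open {g. invertible g} matrix_entries (flag_preimage U)"
    using assms by (simp add: flag_open_iff)
  then show ?thesis
    unfolding flag_variety_def general_linear_group_def matrix_entries_def
    by (simp add: reg_subspace_coordinate_space)
qed

lemma topspace_flag_variety [simp]:
  "topspace (top_of (flag_variety :: (('k::field, 'n::{finite,linorder}) flag, 'k) space_with_functions))
     = complete_flags"
proof
  have "flag_open (topspace (top_of (flag_variety :: (('k, 'n) flag, 'k) space_with_functions)))"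
    by (metis openin_flag_variety openin_topspace)
  then show "topspace (top_of (flag_variety :: (('k, 'n) flag, 'k) space_with_functions)) \<subseteq> complete_flags"
    by (simp add: flag_open_def)
  have "flag_preimage complete_flags = {g :: ('k, 'n) square_matrix. invertible g}"
    unfolding flag_preimage_def using column_flag_complete by auto
  then have "flag_open (complete_flags :: ('k, 'n) flag set)"
    by (simp add: flag_open_iff zariski_open_whole)
  then show "complete_flags \<subseteq> topspace (top_of (flag_variety :: (('k, 'n) flag, 'k) space_with_functions))"
    by (metis openin_flag_variety openin_subset)
qed

locale flag_chart =
  fixes g1 G :: "('k::field, 'n::{finite,linorder}) square_matrix"
  assumes left_inv: "G ** g1 = Finite_Cartesian_Product.mat 1"
    and right_inv: "g1 ** G = Finite_Cartesian_Product.mat 1"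
begin

definition chart :: "('k, 'n) square_matrix \<Rightarrow> ('k, 'n) flag" where
  "chart u = column_flag (g1 ** u)"

definition normal :: "('k, 'n) square_matrix \<Rightarrow> ('k, 'n) square_matrix" where
  "normal g = flag_normal_form (G ** g)"

text \<open>A polynomial whose nonvanishing locus among invertible matrices is the preimage of the
  chart domain in the flag variety.\<close>

definition discriminant :: "('k, 'n) square_matrix \<Rightarrow> 'k" where
  "discriminant g = (\<Prod>i\<in>UNIV. Determinants.det (corner_matrix (G ** g) i))"

definition chart_inverse :: "('k, 'n) flag \<Rightarrow> ('k, 'n) square_matrix" where
  "chart_inverse = inv_into lower_unitriangular chart"

lemma invertible_g1: "invertible g1" and invertible_G: "invertible G"
  using left_inv right_inv unfolding invertible_def by blast+

lemma discriminant_nonzero: "discriminant g \<noteq> 0 \<longleftrightarrow> generic_flag_matrix (G ** g)"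
  unfolding discriminant_def generic_flag_matrix_def by simp

lemma invertible_chart: "u \<in> lower_unitriangular \<Longrightarrow> invertible (g1 ** u)"
  by (intro invertible_mult invertible_g1 lower_unitriangular_invertible)

lemma chart_complete: "u \<in> lower_unitriangular \<Longrightarrow> chart u \<in> complete_flags"
  unfolding chart_def by (intro column_flag_complete invertible_chart)

lemma column_flag_normal:
  assumes "invertible g" "discriminant g \<noteq> 0"
  shows "normal g \<in> lower_unitriangular" "chart (normal g) = column_flag g"
proof -
  show "normal g \<in> lower_unitriangular" unfolding normal_def by (rule flag_normal_form_lower)
  have "column_flag (normal g) = column_flag (G ** g)"
    unfolding normal_def
    using assms invertible_G by (intro column_flag_normal_form) (auto simp: discriminant_nonzero invertible_mult)
  then have "chart (normal g) = column_flag (g1 ** (G ** g))"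
    unfolding chart_def by (intro ext) (simp add: column_flag_mult)
  then show "chart (normal g) = column_flag g" by (simp add: matrix_mul_assoc right_inv)
qed

lemma normal_unique:
  assumes g: "invertible g" and eq: "column_flag g = chart u" and u: "u \<in> lower_unitriangular"
  shows "discriminant g \<noteq> 0" "normal g = u"
proof -
  have "column_flag (G ** g) p = column_flag u p" for p
  proof -
    have "column_flag (G ** g) p = (*v) G ` (*v) g1 ` column_flag u p"
      by (simp add: column_flag_mult eq chart_def)
    then show ?thesis by (simp add: image_image matrix_vector_mul_assoc left_inv)
  qed
  then have eq': "column_flag (G ** g) = column_flag u" by blast
  have inv: "invertible (G ** g)" using g invertible_G by (simp add: invertible_mult)
  show "discriminant g \<noteq> 0" unfolding discriminant_nonzero by (rule generic_flag_matrixI[OF u inv eq'])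
  show "normal g = u" unfolding normal_def by (rule flag_normal_form_eq[OF u inv eq'])
qed

lemma inj_chart: "inj_on chart lower_unitriangular"
proof (rule inj_onI)
  fix u u' assume u: "u \<in> lower_unitriangular" "u' \<in> lower_unitriangular" "chart u = chart u'"
  have "normal (g1 ** u) = u"
    by (rule normal_unique(2)[OF invertible_chart[OF u(1)] _ u(1)]) (simp only: chart_def)
  moreover have "normal (g1 ** u) = u'"
    by (rule normal_unique(2)[OF invertible_chart[OF u(1)] _ u(2)]) (use u(3) in \<open>simp only: chart_def\<close>)
  ultimately show "u = u'" by simp
qed

lemma chart_inverse_chart: "u \<in> lower_unitriangular \<Longrightarrow> chart_inverse (chart u) = u"
  unfolding chart_inverse_def using inj_chart by simp

lemma chart_inverse_column_flag:
  "invertible g \<Longrightarrow> discriminant g \<noteq> 0 \<Longrightarrow> chart_inverse (column_flag g) = normal g"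
  using chart_inverse_chart[OF column_flag_normal(1), of g] column_flag_normal(2)[of g] by simp

section \<open>Rationality of the inverse chart on invertible matrices\<close>

lemma polynomial_corner_entry:
  "(\<lambda>g. corner_matrix (G ** g) i $ r $ s) \<in> polynomial_functions matrix_entries"
proof (cases "s \<le> i")
  case True
  then show ?thesis unfolding corner_matrix_def
    using polynomial_matrix_mult_left[OF polynomial_matrix_entry] by simp
next
  case False
  then show ?thesis unfolding corner_matrix_def by (simp add: polynomial_functions.const)
qed

lemma polynomial_corner_det:
  "(\<lambda>g. Determinants.det (corner_matrix (G ** g) i)) \<in> polynomial_functions matrix_entries"
  by (intro polynomial_det polynomial_corner_entry)

lemma polynomial_corner_numerator:
  "(\<lambda>g. corner_numerator (G ** g) i j) \<in> polynomial_functions matrix_entries"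
  unfolding corner_numerator_def
proof (rule polynomial_det)
  fix r s
  show "(\<lambda>x. (\<chi> r s. if s = j then axis i 1 $ r else corner_matrix (G ** x) i $ r $ s) $ r $ s)
     \<in> polynomial_functions matrix_entries"
    by (cases "s = j") (simp_all add: polynomial_functions.const polynomial_corner_entry)
qed

lemma polynomial_discriminant: "discriminant \<in> polynomial_functions matrix_entries"
  unfolding discriminant_def[abs_def]
  by (intro polynomial_functions_prod polynomial_corner_det)

text \<open>Entries of the normal form have leading minors of \<open>G ** g\<close> as denominators,
  and products of these remain nonzero wherever \<open>discriminant\<close> is.\<close>

lemma normal_rational:
  assumes "p \<in> polynomial_functions matrix_entries"
  shows "\<exists>A\<in>polynomial_functions matrix_entries. \<exists>B\<in>polynomial_functions matrix_entries.
     \<forall>g. discriminant g \<noteq> 0 \<longrightarrow> B g \<noteq> 0 \<and> p (normal g) = A g / B g"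
  using assms
proof induction
  case (const c)
  show ?case by (intro bexI[of _ "\<lambda>_. c"] bexI[of _ "\<lambda>_. 1"]) (simp_all add: polynomial_functions.const)
next
  case (coord f)
  then obtain j i where f: "f = (\<lambda>g. g $ j $ i)" unfolding matrix_entries_def by blast
  show ?case
  proof (cases "j > i")
    case False
    then show ?thesis unfolding f normal_def flag_normal_form_def
      by (intro bexI[of _ "\<lambda>_. if j = i then 1 else 0"] bexI[of _ "\<lambda>_. 1"])
         (auto simp: polynomial_functions.const)
  next
    case True
    then show ?thesis unfolding f normal_def flag_normal_form_def discriminant_nonzero generic_flag_matrix_def
      by (intro bexI[of _ "\<lambda>g. - corner_numerator (G ** g) i j"]
           bexI[of _ "\<lambda>g. Determinants.det (corner_matrix (G ** g) i)"])
         (auto simp: polynomial_corner_det polynomial_functions_uminus polynomial_corner_numerator)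
  qed
next
  case (add f g)
  then obtain A B A' B' where *: "A \<in> polynomial_functions matrix_entries" "B \<in> polynomial_functions matrix_entries"
     "A' \<in> polynomial_functions matrix_entries" "B' \<in> polynomial_functions matrix_entries"
     "\<forall>g. discriminant g \<noteq> 0 \<longrightarrow> B g \<noteq> 0 \<and> f (normal g) = A g / B g"
     "\<forall>x. discriminant x \<noteq> 0 \<longrightarrow> B' x \<noteq> 0 \<and> g (normal x) = A' x / B' x" by blast
  show ?case
  proof (rule bexI[of _ "\<lambda>x. A x * B' x + A' x * B x"], rule bexI[of _ "\<lambda>x. B x * B' x"])
    show "\<forall>ga. discriminant ga \<noteq> 0 \<longrightarrow> B ga * B' ga \<noteq> 0 \<and>
        f (normal ga) + g (normal ga) = (A ga * B' ga + A' ga * B ga) / (B ga * B' ga)"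
      using *(5,6) by (auto simp: add_frac_eq)
  qed (intro polynomial_functions.add polynomial_functions.mult *)+
next
  case (mult f g)
  then obtain A B A' B' where *: "A \<in> polynomial_functions matrix_entries" "B \<in> polynomial_functions matrix_entries"
     "A' \<in> polynomial_functions matrix_entries" "B' \<in> polynomial_functions matrix_entries"
     "\<forall>g. discriminant g \<noteq> 0 \<longrightarrow> B g \<noteq> 0 \<and> f (normal g) = A g / B g"
     "\<forall>x. discriminant x \<noteq> 0 \<longrightarrow> B' x \<noteq> 0 \<and> g (normal x) = A' x / B' x" by blast
  show ?case
  proof (rule bexI[of _ "\<lambda>x. A x * A' x"], rule bexI[of _ "\<lambda>x. B x * B' x"])
    show "\<forall>ga. discriminant ga \<noteq> 0 \<longrightarrow> B ga * B' ga \<noteq> 0 \<and>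
        f (normal ga) * g (normal ga) = (A ga * A' ga) / (B ga * B' ga)"
      using *(5,6) by auto
  qed (intro polynomial_functions.mult *)+
qed

definition principal_flags :: "(('k, 'n) square_matrix \<Rightarrow> 'k) \<Rightarrow> ('k, 'n) flag set" where
  "principal_flags s = chart ` {u \<in> lower_unitriangular. s u \<noteq> 0}"

lemma flag_preimage_principal:
  "flag_preimage (principal_flags s) = {g. invertible g \<and> discriminant g \<noteq> 0 \<and> s (normal g) \<noteq> 0}"
  unfolding flag_preimage_def principal_flags_def
  using column_flag_normal normal_unique by (auto simp: image_iff) metis+

lemma flag_open_principal:
  assumes "s \<in> polynomial_functions matrix_entries"
  shows "flag_open (principal_flags s)"
  unfolding flag_open_iff
proof
  show "principal_flags s \<subseteq> complete_flags" unfolding principal_flags_def using chart_complete by auto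
  obtain A B where AB: "A \<in> polynomial_functions matrix_entries" "B \<in> polynomial_functions matrix_entries"
     "\<forall>g. discriminant g \<noteq> 0 \<longrightarrow> B g \<noteq> 0 \<and> s (normal g) = A g / B g"
    using normal_rational[OF assms] by blast
  \<comment> \<open>Since \<open>B\<close> does not vanish where \<open>discriminant\<close> does
    not, one product polynomial expresses both conditions.\<close>
  have "flag_preimage (principal_flags s) = {g \<in> {g. invertible g}. A g * discriminant g \<noteq> 0}"
    unfolding flag_preimage_principal using AB(3) by auto
  then show "zariski_open {g. invertible g} matrix_entries (flag_preimage (principal_flags s))"
    by (simp only:) (intro zariski_open_nonzero polynomial_functions.mult AB polynomial_discriminant)
qed

lemma topspace_chart_image:
  assumes "Z \<subseteq> lower_unitriangular"
  shows "topspace (top_of (subspace_of flag_variety (chart ` Z))) = chart ` Z"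
  using assms chart_complete by (auto simp: topspace_subtopology)

text \<open>The chart factors through the map \<open>u \<mapsto> g1 ** u\<close> into invertible
  matrices, and functions on flags are tested there; polynomials in \<open>g1 ** u\<close> are
  polynomials in \<open>u\<close>.\<close>

lemma chart_morphism:
  assumes Z: "Z \<subseteq> lower_unitriangular"
  shows "is_morphism (coordinate_space Z matrix_entries) (subspace_of flag_variety (chart ` Z)) chart"
proof -
  let ?X = "subspace_of flag_variety (chart ` Z)"
  have inv: "invertible (g1 ** u)" if "u \<in> Z" for u using that Z invertible_chart by blast
  have op: "zariski_open Z matrix_entries {u \<in> Z. chart u \<in> O'}" if O': "openin (top_of ?X) O'" for O'
  proof -
    obtain T where T: "flag_open T" "O' = T \<inter> chart ` Z" using O' by (auto simp: openin_subtopology)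
    have "zariski_open {g. invertible g} matrix_entries (flag_preimage T)" using T by (simp add: flag_open_iff)
    note * = this[unfolded zariski_open_principal]
    show ?thesis unfolding zariski_open_principal
    proof (intro conjI ballI)
      fix u assume u: "u \<in> {u \<in> Z. chart u \<in> O'}"
      then have "g1 ** u \<in> flag_preimage T" using T inv by (auto simp: flag_preimage_def chart_def)
      with * obtain s where s: "s \<in> polynomial_functions matrix_entries" "s (g1 ** u) \<noteq> 0"
         "\<forall>y\<in>{g. invertible g}. s y \<noteq> 0 \<longrightarrow> y \<in> flag_preimage T" by blast
      have "s (g1 ** u) \<noteq> 0 \<and> (\<forall>y\<in>Z. s (g1 ** y) \<noteq> 0 \<longrightarrow> y \<in> {u \<in> Z. chart u \<in> O'})"
        using s T inv by (auto simp: flag_preimage_def chart_def)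
      then show "\<exists>s\<in>polynomial_functions matrix_entries. s u \<noteq> 0 \<and>
          (\<forall>y\<in>Z. s y \<noteq> 0 \<longrightarrow> y \<in> {u \<in> Z. chart u \<in> O'})"
        using polynomial_matrix_mult_left[OF s(1), of g1] by (intro bexI)
    qed auto
  qed
  have rg: "f \<circ> chart \<in> reg (coordinate_space Z matrix_entries) {u \<in> Z. chart u \<in> O'}"
    if O': "openin (top_of ?X) O'" and f: "f \<in> reg ?X O'" for O' f
  proof (subst reg_coordinate_space, blast, intro ballI)
    fix u assume u: "u \<in> {u \<in> Z. chart u \<in> O'}"
    then obtain T g where T: "flag_open T" "chart u \<in> T" "g \<in> reg flag_variety T" "\<forall>y\<in>T \<inter> O'. f y = g y"
      using f by (auto simp: subspace_of_def)
    have sub: "flag_preimage T \<subseteq> {g. invertible g}" by (auto simp: flag_preimage_def)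
    have "g1 ** u \<in> flag_preimage T" using u T inv by (auto simp: flag_preimage_def chart_def)
    from bspec[OF T(3)[unfolded reg_flag_variety[OF T(1)] reg_coordinate_space[OF sub]] this]
    obtain a b where ab: "a \<in> polynomial_functions matrix_entries" "b \<in> polynomial_functions matrix_entries"
      "b (g1 ** u) \<noteq> 0"
      "\<forall>y\<in>{g. invertible g}. b y \<noteq> 0 \<longrightarrow> y \<in> flag_preimage T \<and> (g \<circ> column_flag) y = a y / b y" by blast
    obtain s where s: "s \<in> polynomial_functions matrix_entries" "s u \<noteq> 0"
        "\<forall>y\<in>Z. s y \<noteq> 0 \<longrightarrow> y \<in> {u \<in> Z. chart u \<in> O'}"
      using op[OF O', unfolded zariski_open_principal] u by blast
    note polynomial_functions.mult[OF polynomial_matrix_mult_left[OF ab(1), of g1] s(1)]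
      polynomial_functions.mult[OF polynomial_matrix_mult_left[OF ab(2), of g1] s(1)]
    moreover have "b (g1 ** u) * s u \<noteq> 0 \<and> (\<forall>y\<in>Z. b (g1 ** y) * s y \<noteq> 0 \<longrightarrow>
        y \<in> {u \<in> Z. chart u \<in> O'} \<and> (f \<circ> chart) y = (a (g1 ** y) * s y) / (b (g1 ** y) * s y))"
    proof (intro conjI ballI impI)
      show "b (g1 ** u) * s u \<noteq> 0" using ab s by simp
      fix y assume y: "y \<in> Z" "b (g1 ** y) * s y \<noteq> 0"
      then show "y \<in> {u \<in> Z. chart u \<in> O'}" using s by simp
      then have "chart y \<in> O'" by simp
      moreover have "g1 ** y \<in> flag_preimage T" "g (chart y) = a (g1 ** y) / b (g1 ** y)"
        using ab(4) inv[OF y(1)] y(2) unfolding chart_def by auto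
      ultimately show "(f \<circ> chart) y = (a (g1 ** y) * s y) / (b (g1 ** y) * s y)"
        using T(4) y(2) by (simp add: flag_preimage_def chart_def)
    qed
    ultimately show "\<exists>a\<in>polynomial_functions matrix_entries. \<exists>b\<in>polynomial_functions matrix_entries.
       b u \<noteq> 0 \<and> (\<forall>y\<in>Z. b y \<noteq> 0 \<longrightarrow> y \<in> {u \<in> Z. chart u \<in> O'} \<and> (f \<circ> chart) y = a y / b y)"
      by (intro bexI)
  qed
  show ?thesis unfolding is_morphism_def continuous_map_def topspace_chart_image[OF Z]
      topspace_coordinate_space openin_coordinate_space
    using op rg by blast
qed

text \<open>A function on flags is regular if its lift to invertible matrices is. The lift of the
  inverse chart is \<open>normal\<close>, whose entries are rational, so fractions in
  \<open>u\<close> lift to fractions in \<open>g\<close>.\<close>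

lemma chart_inverse_morphism:
  assumes Z: "Z \<subseteq> lower_unitriangular"
  shows "is_morphism (subspace_of flag_variety (chart ` Z)) (coordinate_space Z matrix_entries) chart_inverse"
proof -
  let ?X = "subspace_of flag_variety (chart ` Z)"
  have inverse: "chart_inverse (chart u) = u" if "u \<in> Z" for u using that Z chart_inverse_chart by blast
  have op: "openin (top_of ?X) {x \<in> chart ` Z. chart_inverse x \<in> V}"
    if V: "zariski_open Z matrix_entries V" for V
  proof (subst openin_subopen, intro ballI)
    fix x assume x: "x \<in> {x \<in> chart ` Z. chart_inverse x \<in> V}"
    then obtain u where u: "u \<in> Z" "u \<in> V" "x = chart u" using inverse by auto
    obtain s where s: "s \<in> polynomial_functions matrix_entries" "s u \<noteq> 0" "\<forall>y\<in>Z. s y \<noteq> 0 \<longrightarrow> y \<in> V"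
      using V[unfolded zariski_open_principal] u by blast
    have "openin (top_of ?X) (principal_flags s \<inter> chart ` Z)"
      using flag_open_principal[OF s(1)] by (auto simp: openin_subtopology)
    moreover have "x \<in> principal_flags s \<inter> chart ` Z" using u s Z by (auto simp: principal_flags_def)
    moreover have "principal_flags s \<inter> chart ` Z \<subseteq> {x \<in> chart ` Z. chart_inverse x \<in> V}"
    proof
      fix y assume y: "y \<in> principal_flags s \<inter> chart ` Z"
      then obtain u u' where "u' \<in> Z" "y = chart u'" "y = chart u" "u \<in> lower_unitriangular" "s u \<noteq> 0"
        by (auto simp: principal_flags_def)
      moreover from this have "u = u'" using inj_chart Z by (metis inj_onD subsetD)
      ultimately show "y \<in> {x \<in> chart ` Z. chart_inverse x \<in> V}" using s inverse by auto
    qed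
    ultimately show "\<exists>T. openin (top_of ?X) T \<and> x \<in> T \<and> T \<subseteq> {x \<in> chart ` Z. chart_inverse x \<in> V}" by blast
  qed
  have rg: "f \<circ> chart_inverse \<in> reg ?X {x \<in> chart ` Z. chart_inverse x \<in> V}"
    if V: "zariski_open Z matrix_entries V" and f: "f \<in> reg (coordinate_space Z matrix_entries) V" for V f
  proof -
    have VZ: "V \<subseteq> Z" using V by (simp add: zariski_open_principal)
    have "\<exists>T g. flag_open T \<and> x \<in> T \<and> g \<in> reg flag_variety T \<and>
         (\<forall>y\<in>T \<inter> {x \<in> chart ` Z. chart_inverse x \<in> V}. (f \<circ> chart_inverse) y = g y)"
      if x: "x \<in> {x \<in> chart ` Z. chart_inverse x \<in> V}" for x
    proof -
      obtain u where u: "u \<in> Z" "u \<in> V" "x = chart u" using x inverse by auto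
      obtain a b where ab: "a \<in> polynomial_functions matrix_entries" "b \<in> polynomial_functions matrix_entries"
        "b u \<noteq> 0" "\<forall>y\<in>Z. b y \<noteq> 0 \<longrightarrow> y \<in> V \<and> f y = a y / b y"
        using bspec[OF f[unfolded reg_coordinate_space[OF VZ]] u(2)] by blast
      define g where "g = (\<lambda>W. a (chart_inverse W) / b (chart_inverse W))"
      have T: "flag_open (principal_flags b)" by (rule flag_open_principal[OF ab(2)])
      obtain A B where A: "A \<in> polynomial_functions matrix_entries" "B \<in> polynomial_functions matrix_entries"
         "\<forall>g. discriminant g \<noteq> 0 \<longrightarrow> B g \<noteq> 0 \<and> a (normal g) = A g / B g"
        using normal_rational[OF ab(1)] by blast
      obtain A' B' where A': "A' \<in> polynomial_functions matrix_entries" "B' \<in> polynomial_functions matrix_entries"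
         "\<forall>g. discriminant g \<noteq> 0 \<longrightarrow> B' g \<noteq> 0 \<and> b (normal g) = A' g / B' g"
        using normal_rational[OF ab(2)] by blast
      have sub: "flag_preimage (principal_flags b) \<subseteq> {g. invertible g}" by (auto simp: flag_preimage_def)
      have "g \<circ> column_flag \<in> reg (coordinate_space {g. invertible g} matrix_entries) (flag_preimage (principal_flags b))"
        unfolding reg_coordinate_space[OF sub]
      proof
        fix h assume h: "h \<in> flag_preimage (principal_flags b)"
        \<comment> \<open>Numerator and denominator of (A / B) / (A' / B'), each multiplied by
          \<open>discriminant\<close> so that the denominator can be nonzero only over the
          chart.\<close>
        note polynomial_functions.mult[OF polynomial_functions.mult[OF A(1) A'(2)] polynomial_discriminant]
          polynomial_functions.mult[OF polynomial_functions.mult[OF A(2) A'(1)] polynomial_discriminant]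
        moreover have "B h * A' h * discriminant h \<noteq> 0 \<and> (\<forall>y\<in>{g. invertible g}. B y * A' y * discriminant y \<noteq> 0 \<longrightarrow>
            y \<in> flag_preimage (principal_flags b) \<and>
            (g \<circ> column_flag) y = (A y * B' y * discriminant y) / (B y * A' y * discriminant y))"
        proof (intro conjI ballI impI)
          show "B h * A' h * discriminant h \<noteq> 0"
            using h A A' unfolding flag_preimage_principal by auto
          fix y :: "('k, 'n) square_matrix" assume y: "y \<in> {g. invertible g}" "B y * A' y * discriminant y \<noteq> 0"
          then show "y \<in> flag_preimage (principal_flags b)"
            using A'(3) unfolding flag_preimage_principal by auto
          have "(g \<circ> column_flag) y = a (normal y) / b (normal y)"
            using y by (simp add: g_def chart_inverse_column_flag)
          also have "\<dots> = (A y / B y) / (A' y / B' y)" using A(3) A'(3) y by simp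
          finally show "(g \<circ> column_flag) y = (A y * B' y * discriminant y) / (B y * A' y * discriminant y)"
            using y by simp
        qed
        ultimately show "\<exists>a\<in>polynomial_functions matrix_entries. \<exists>ba\<in>polynomial_functions matrix_entries.
          ba h \<noteq> 0 \<and> (\<forall>y\<in>{g. invertible g}. ba y \<noteq> 0 \<longrightarrow> y \<in> flag_preimage (principal_flags b) \<and>
             (g \<circ> column_flag) y = a y / ba y)" by (intro bexI)
      qed
      then have "g \<in> reg flag_variety (principal_flags b)" unfolding reg_flag_variety[OF T] .
      moreover have "x \<in> principal_flags b" using u ab Z by (auto simp: principal_flags_def)
      moreover have "(f \<circ> chart_inverse) y = g y"
        if "y \<in> principal_flags b \<inter> {x \<in> chart ` Z. chart_inverse x \<in> V}" for y
      proof -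
        obtain u u' where "u' \<in> Z" "y = chart u'" "y = chart u" "u \<in> lower_unitriangular" "b u \<noteq> 0"
          using \<open>y \<in> principal_flags b \<inter> _\<close> by (auto simp: principal_flags_def)
        moreover from this have "u = u'" using inj_chart Z by (metis inj_onD subsetD)
        ultimately show ?thesis using ab inverse by (simp add: g_def)
      qed
      ultimately show ?thesis using T by blast
    qed
    then show ?thesis by (simp add: subspace_of_def)
  qed
  show ?thesis unfolding is_morphism_def continuous_map_def topspace_chart_image[OF Z]
      topspace_coordinate_space openin_coordinate_space
    using op rg inverse by auto
qed

text \<open>Stated for an arbitrary \<open>Z\<close>, to cover at once the whole chart, the Schubert
  cell and the part of the Schubert variety in the chart.\<close>

theorem chart_isomorphism:
  assumes Z: "Z \<subseteq> lower_unitriangular"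
  shows "isomorphic_spaces (subspace_of flag_variety (chart ` Z)) (coordinate_space Z matrix_entries)"
  unfolding isomorphic_spaces_def topspace_chart_image[OF Z] topspace_coordinate_space
  using chart_morphism[OF Z] chart_inverse_morphism[OF Z] Z chart_inverse_chart
  by (intro exI[of _ chart_inverse] exI[of _ chart]) auto

lemma chart_open: "openin (top_of flag_variety) (chart ` lower_unitriangular)"
  using flag_open_principal[OF polynomial_functions.const[of 1]] by (simp add: principal_flags_def)

end

section \<open>Unipotent matrices with prescribed support\<close>

definition pattern_matrices :: "('n \<times> 'n) set \<Rightarrow> ('k::field, 'n::finite) square_matrix set" where
  "pattern_matrices I = {b. \<forall>j i. b $ j $ i = (if j = i then 1 else if (j, i) \<in> I then b $ j $ i else 0)}"

lemma pattern_matrices_iff: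
  "b \<in> pattern_matrices I \<longleftrightarrow> (\<forall>j. b $ j $ j = 1) \<and> (\<forall>j i. j \<noteq> i \<longrightarrow> (j, i) \<notin> I \<longrightarrow> b $ j $ i = 0)"
  unfolding pattern_matrices_def by auto

lemma lower_unitriangular_pattern: "lower_unitriangular = pattern_matrices {(j, i). i < j}"
  unfolding lower_unitriangular_def pattern_matrices_def
  by (auto simp: not_less_iff_gr_or_eq)

lemma pattern_matrices_affine:
  fixes I :: "('n::finite \<times> 'n) set"
  assumes diag: "\<And>i. (i, i) \<notin> I"
  shows "isomorphic_spaces (coordinate_space (pattern_matrices I :: ('k::field, 'n) square_matrix set) matrix_entries)
     (affine_space (card I))"
proof -
  obtain e where e: "bij_betw e {..<card I} I"
    using ex_bij_betw_nat_finite[of I] by (auto simp: atLeast0LessThan)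
  define ei where "ei = inv_into {..<card I} e"
  have ei: "ei ji < card I" "e (ei ji) = ji" if "ji \<in> I" for ji
    using bij_betw_inv_into_right[OF e that] bij_betw_apply[OF bij_betw_inv_into[OF e] that]
    by (auto simp: ei_def)
  have ie: "ei (e k) = k" "e k \<in> I" if "k < card I" for k
    using bij_betw_inv_into_left[OF e] bij_betw_apply[OF e] that by (auto simp: ei_def)
  define \<phi> :: "('k, 'n) square_matrix \<Rightarrow> nat \<Rightarrow> 'k"
    where "\<phi> = (\<lambda>b k. if k < card I then b $ fst (e k) $ snd (e k) else 0)"
  define \<psi> :: "(nat \<Rightarrow> 'k) \<Rightarrow> ('k, 'n) square_matrix"
    where "\<psi> = (\<lambda>x. \<chi> j i. if j = i then 1 else if (j, i) \<in> I then x (ei (j, i)) else 0)"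
  show ?thesis unfolding affine_space_def
  proof (rule isomorphic_coordinate_spaces[of _ \<phi> _ \<psi>])
    show "\<phi> b \<in> {x. \<forall>i\<ge>card I. x i = 0}" for b by (simp add: \<phi>_def)
    show "\<psi> x \<in> pattern_matrices I" for x by (simp add: \<psi>_def pattern_matrices_def)
    show "\<psi> (\<phi> b) = b" if "b \<in> pattern_matrices I" for b
      using that ei unfolding \<psi>_def \<phi>_def pattern_matrices_iff by (auto simp: cart_eq_iff)
    show "\<phi> (\<psi> x) = x" if "x \<in> {x. \<forall>i\<ge>card I. x i = 0}" for x
    proof
      fix k show "\<phi> (\<psi> x) k = x k"
      proof (cases "k < card I")
        case True
        moreover have "fst (e k) \<noteq> snd (e k)" using ie(2)[OF True] diag by (metis prod.collapse)
        ultimately show ?thesis using ie[OF True] by (simp add: \<phi>_def \<psi>_def)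
      qed (use that in \<open>simp add: \<phi>_def\<close>)
    qed
    show "\<exists>g\<in>polynomial_functions matrix_entries. \<forall>x\<in>pattern_matrices I. c (\<phi> x) = g x"
      if c: "c \<in> {(\<lambda>x. x i) |i. i < card I}" for c
    proof -
      obtain k where k: "c = (\<lambda>x. x k)" "k < card I" using c by blast
      show ?thesis
        by (rule bexI[OF _ polynomial_matrix_entry[of "fst (e k)" "snd (e k)"]]) (simp add: k \<phi>_def)
    qed
    show "\<exists>g\<in>polynomial_functions {(\<lambda>x. x i) |i. i < card I}. \<forall>y\<in>{x. \<forall>i\<ge>card I. x i = 0}. c (\<psi> y) = g y"
      if "c \<in> matrix_entries" for c
    proof -
      obtain j i where c: "c = (\<lambda>g. g $ j $ i)" using \<open>c \<in> matrix_entries\<close> unfolding matrix_entries_def by blast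
      consider "j = i" | "j \<noteq> i" "(j, i) \<in> I" | "j \<noteq> i" "(j, i) \<notin> I" by blast
      then show ?thesis
      proof cases
        case 1
        then show ?thesis
          by (intro bexI[of _ "\<lambda>_. 1"] polynomial_functions.const) (simp add: c \<psi>_def)
      next
        case 2
        then have "(\<lambda>x :: nat \<Rightarrow> 'k. x (ei (j, i))) \<in> polynomial_functions {(\<lambda>x. x i) |i. i < card I}"
          using ei by (intro polynomial_functions.coord) blast
        then show ?thesis using 2
          by (intro bexI[of _ "\<lambda>x. x (ei (j, i))"]) (simp_all add: c \<psi>_def)
      next
        case 3
        then show ?thesis
          by (intro bexI[of _ "\<lambda>_. 0"] polynomial_functions.const) (simp add: c \<psi>_def)
      qed
    qed
  qed
qed

lemma affine_space_is_affine_variety: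
  fixes X :: "('p, 'k::field) space_with_functions"
  assumes "isomorphic_spaces X (affine_space d)"
  shows "is_affine_variety X"
proof -
  let ?A = "affine_space d :: (nat \<Rightarrow> 'k, 'k) space_with_functions"
  have "isomorphic_spaces (subspace_of ?A {x. \<forall>i\<ge>d. x i = 0}) ?A"
    unfolding affine_space_def by (rule subspace_of_coordinate_space) simp
  then have "isomorphic_spaces X (subspace_of ?A {x. \<forall>i\<ge>d. x i = 0})"
    using assms isomorphic_spaces_trans isomorphic_spaces_sym by blast
  moreover have "closedin (top_of ?A) {x. \<forall>i\<ge>d. x i = 0}"
    using closedin_topspace[of "top_of ?A"] by (simp add: affine_space_def)
  ultimately show ?thesis unfolding is_affine_variety_def by blast
qed

section \<open>Factorization of lower unitriangular matrices\<close>

definition cell_pattern :: "('n::linorder \<Rightarrow> 'n) \<Rightarrow> ('n \<times> 'n) set" where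
  "cell_pattern v = {(j, i). i < j \<and> v j < v i}"

definition slice_pattern :: "('n::linorder \<Rightarrow> 'n) \<Rightarrow> ('n \<times> 'n) set" where
  "slice_pattern v = {(j, i). i < j \<and> v i < v j}"

definition restrict_pattern :: "('n \<times> 'n) set \<Rightarrow> ('k::field, 'n::finite) square_matrix \<Rightarrow> ('k, 'n) square_matrix" where
  "restrict_pattern I x = (\<chi> j i. if j = i then 1 else if (j, i) \<in> I then x $ j $ i else 0)"

lemma restrict_pattern_in: "restrict_pattern I x \<in> pattern_matrices I"
  by (simp add: restrict_pattern_def pattern_matrices_def)

lemma pattern_mono: "I \<subseteq> J \<Longrightarrow> pattern_matrices I \<subseteq> pattern_matrices J"
  by (rule subsetI) (simp add: pattern_matrices_iff, blast)

lemma cell_pattern_lower: "pattern_matrices (cell_pattern v) \<subseteq> lower_unitriangular"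
  and slice_pattern_lower: "pattern_matrices (slice_pattern v) \<subseteq> lower_unitriangular"
  unfolding lower_unitriangular_pattern
  by (auto intro!: pattern_mono simp: cell_pattern_def slice_pattern_def)

lemma lower_unitriangular_product_entry:
  assumes b: "b \<in> lower_unitriangular" and c: "c \<in> lower_unitriangular"
  shows "i < j \<Longrightarrow> (b ** c) $ j $ i = b $ j $ i + c $ j $ i + (\<Sum>t\<in>{i<..<j}. b $ j $ t * c $ t $ i)"
    and "(b ** c) $ i $ i = 1"
    and "j < i \<Longrightarrow> (b ** c) $ j $ i = 0"
proof -
  have b': "b $ j $ i = 0" if "j < i" for j i using b that by (simp add: lower_unitriangular_def)
  have c': "c $ j $ i = 0" if "j < i" for j i using c that by (simp add: lower_unitriangular_def)
  have d: "b $ i $ i = 1" "c $ i $ i = 1" for i using b c by (simp_all add: lower_unitriangular_def)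
  have sum: "(b ** c) $ j $ i = (\<Sum>t\<in>{i..j}. b $ j $ t * c $ t $ i)" for i j
    unfolding matrix_matrix_mult_def
    by (simp, rule sum.mono_neutral_right) (auto simp: not_le b' c')
  show "(b ** c) $ i $ i = 1" by (simp add: sum d)
  show "j < i \<Longrightarrow> (b ** c) $ j $ i = 0" by (simp add: sum)
  assume ij: "i < j"
  have "{i..j} = insert i (insert j {i<..<j})" using ij by auto
  then show "(b ** c) $ j $ i = b $ j $ i + c $ j $ i + (\<Sum>t\<in>{i<..<j}. b $ j $ t * c $ t $ i)"
    using ij by (simp add: sum d)
qed

lemma lower_unitriangular_product:
  "b \<in> lower_unitriangular \<Longrightarrow> c \<in> lower_unitriangular \<Longrightarrow> b ** c \<in> lower_unitriangular"
  by (subst lower_unitriangular_def) (simp add: lower_unitriangular_product_entry)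

text \<open>The factors of \<open>h = b c\<close> are found by fixed point iteration: the entry of \<open>b + c - 1\<close> at
  \<open>(j, i)\<close> is that of \<open>h\<close>, corrected by entries closer to the diagonal.\<close>

definition factor_step ::
  "('n \<Rightarrow> 'n) \<Rightarrow> ('k::field, 'n::{finite,linorder}) square_matrix \<Rightarrow> ('k, 'n) square_matrix \<Rightarrow> ('k, 'n) square_matrix" where
  "factor_step v h x = (\<chi> j i. h $ j $ i -
     (\<Sum>t\<in>{i<..<j}. restrict_pattern (cell_pattern v) x $ j $ t * restrict_pattern (slice_pattern v) x $ t $ i))"

definition factor_limit ::
  "('n \<Rightarrow> 'n) \<Rightarrow> ('k::field, 'n::{finite,linorder}) square_matrix \<Rightarrow> ('k, 'n) square_matrix" where
  "factor_limit v h = (factor_step v h ^^ CARD('n)) h"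

lemma factor_step_cong:
  assumes "\<And>t. i < t \<Longrightarrow> t < j \<Longrightarrow> x $ j $ t = y $ j $ t \<and> x $ t $ i = y $ t $ i"
  shows "factor_step v h x $ j $ i = factor_step v h y $ j $ i"
  unfolding factor_step_def restrict_pattern_def
  using assms by (auto intro!: sum.cong)

lemma card_subinterval:
  fixes i j t :: "'n::{finite,linorder}"
  assumes "i < t" "t < j"
  shows "card {t<..<j} < card {i<..<j}" "card {i<..<t} < card {i<..<j}"
  using assms by (auto intro!: psubset_card_mono)

text \<open>An entry depends only on entries whose indices enclose a strictly smaller interval, so
  it is final after as many steps as there are indices strictly between \<open>i\<close> and
  \<open>j\<close>.\<close>

lemma factor_step_stable:
  "card {i<..<j} \<le> k \<Longrightarrow> (factor_step v h ^^ Suc k) h $ j $ i = (factor_step v h ^^ k) h $ j $ i"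
proof (induction k arbitrary: i j)
  case 0
  then have "{i<..<j} = {}" by simp
  then show ?case by (simp add: factor_step_def)
next
  case (Suc k)
  have "factor_step v h ((factor_step v h ^^ Suc k) h) $ j $ i = factor_step v h ((factor_step v h ^^ k) h) $ j $ i"
  proof (rule factor_step_cong)
    fix t assume t: "i < t" "t < j"
    show "(factor_step v h ^^ Suc k) h $ j $ t = (factor_step v h ^^ k) h $ j $ t \<and>
       (factor_step v h ^^ Suc k) h $ t $ i = (factor_step v h ^^ k) h $ t $ i"
      using Suc.IH[of t j] Suc.IH[of i t] card_subinterval[OF t] Suc.prems by linarith
  qed
  then show ?case by simp
qed

lemma factor_limit_fixpoint:
  fixes h :: "('k::field, 'n::{finite,linorder}) square_matrix"
  shows "factor_step v h (factor_limit v h) = factor_limit v h"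
proof -
  have "card {i<..<j} \<le> CARD('n)" for i j :: 'n by (simp add: card_mono)
  then show ?thesis
    using factor_step_stable[where k = "CARD('n)" and v = v and h = h]
    unfolding factor_limit_def by (simp add: cart_eq_iff)
qed

lemma factor_fixpoint_unique:
  assumes "factor_step v h x = x" "factor_step v h y = y"
  shows "x = y"
proof -
  have "x $ j $ i = y $ j $ i" for i j
  proof (induction "card {i<..<j}" arbitrary: i j rule: less_induct)
    case less
    have "factor_step v h x $ j $ i = factor_step v h y $ j $ i"
      by (rule factor_step_cong) (use less card_subinterval in blast)
    then show ?case by (simp add: assms)
  qed
  then show ?thesis by (simp add: cart_eq_iff)
qed

text \<open>Below the diagonal exactly one of the two patterns contains a given position, as
  \<open>v\<close> is injective. Hence the entries of both factors add up to that of the fixed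
  point, and the fixed point equation is the product formula.\<close>

lemma factor_limit_product:
  assumes "inj v" and h: "h \<in> lower_unitriangular"
  shows "restrict_pattern (cell_pattern v) (factor_limit v h) **
      restrict_pattern (slice_pattern v) (factor_limit v h) = h"
proof -
  define x where "x = factor_limit v h"
  define b where "b = restrict_pattern (cell_pattern v) x"
  define c where "c = restrict_pattern (slice_pattern v) x"
  have b: "b \<in> lower_unitriangular" and c: "c \<in> lower_unitriangular"
    using restrict_pattern_in cell_pattern_lower slice_pattern_lower unfolding b_def c_def by blast+
  have fp: "x $ j $ i = h $ j $ i - (\<Sum>t\<in>{i<..<j}. b $ j $ t * c $ t $ i)" for i j
    using arg_cong[OF factor_limit_fixpoint[of v h], of "\<lambda>y. y $ j $ i"]
    unfolding x_def[symmetric] by (simp add: factor_step_def b_def c_def)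
  have "(b ** c) $ j $ i = h $ j $ i" for i j
  proof (cases i j rule: linorder_cases)
    case less
    then have "v i \<noteq> v j" using assms(1) by (auto dest: injD)
    then have "b $ j $ i + c $ j $ i = x $ j $ i"
      using less by (auto simp: b_def c_def restrict_pattern_def cell_pattern_def slice_pattern_def)
    then show ?thesis using lower_unitriangular_product_entry(1)[OF b c less] fp[of j i] by simp
  qed (use lower_unitriangular_product_entry(2,3)[OF b c] h in \<open>auto simp: lower_unitriangular_def\<close>)
  then show ?thesis by (simp add: cart_eq_iff b_def c_def x_def)
qed

lemma factor_limit_unique:
  assumes "b \<in> pattern_matrices (cell_pattern v)" "c \<in> pattern_matrices (slice_pattern v)"
  shows "restrict_pattern (cell_pattern v) (factor_limit v (b ** c)) = b"
    and "restrict_pattern (slice_pattern v) (factor_limit v (b ** c)) = c"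
proof -
  \<comment> \<open>The sum of the factors minus the identity, since both have unit diagonal; this
    is shown to be the fixed point for \<open>b ** c\<close>.\<close>
  define x where "x = (\<chi> j i. b $ j $ i + c $ j $ i - (if j = i then 1 else 0))"
  have bx: "restrict_pattern (cell_pattern v) x = b" and cx: "restrict_pattern (slice_pattern v) x = c"
    using assms unfolding x_def pattern_matrices_iff restrict_pattern_def cart_eq_iff
    by (auto simp: cell_pattern_def slice_pattern_def)
  have bc: "b \<in> lower_unitriangular" "c \<in> lower_unitriangular"
    using assms cell_pattern_lower slice_pattern_lower by blast+
  have "factor_step v (b ** c) x $ j $ i = x $ j $ i" for i j
    using lower_unitriangular_product_entry(1,3)[OF bc] lower_unitriangular_product_entry(2)[OF bc, of i] bc
    unfolding factor_step_def bx cx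
    by (cases i j rule: linorder_cases) (auto simp: x_def lower_unitriangular_def)
  then have "factor_limit v (b ** c) = x"
    by (intro factor_fixpoint_unique[OF factor_limit_fixpoint]) (simp add: cart_eq_iff)
  then show "restrict_pattern (cell_pattern v) (factor_limit v (b ** c)) = b"
    "restrict_pattern (slice_pattern v) (factor_limit v (b ** c)) = c" using bx cx by simp_all
qed

section \<open>Polynomiality of the factorization\<close>

lemma polynomial_restrict_pattern:
  assumes "\<And>j i. (\<lambda>h. x h $ j $ i) \<in> polynomial_functions C"
  shows "(\<lambda>h. restrict_pattern I (x h) $ j $ i) \<in> polynomial_functions C"
  unfolding restrict_pattern_def
  by (cases "j = i"; cases "(j, i) \<in> I") (simp_all add: assms polynomial_functions.const)

text \<open>Every iterate is polynomial in \<open>h\<close>, and the number of steps in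
  \<open>factor_limit\<close> is the same for all \<open>h\<close>.\<close>

lemma polynomial_factor_limit:
  "(\<lambda>h :: ('k::field, 'n::{finite,linorder}) square_matrix. factor_limit v h $ j $ i)
     \<in> polynomial_functions matrix_entries"
proof -
  have "(\<lambda>h :: ('k, 'n) square_matrix. (factor_step v h ^^ k) h $ j $ i) \<in> polynomial_functions matrix_entries" for k
  proof (induction k arbitrary: j i)
    case 0
    show ?case by (simp add: polynomial_matrix_entry)
  next
    case (Suc k)
    have "(\<lambda>h :: ('k, 'n) square_matrix. h $ j $ i - (\<Sum>t\<in>{i<..<j}.
        restrict_pattern (cell_pattern v) ((factor_step v h ^^ k) h) $ j $ t *
        restrict_pattern (slice_pattern v) ((factor_step v h ^^ k) h) $ t $ i)) \<in> polynomial_functions matrix_entries"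
      by (intro polynomial_functions_diff polynomial_matrix_entry
          polynomial_functions_sum polynomial_functions.mult polynomial_restrict_pattern Suc.IH)
    then show ?case by (simp only: funpow.simps comp_apply) (simp add: factor_step_def)
  qed
  then show ?thesis unfolding factor_limit_def .
qed

lemma factorization_isomorphism:
  fixes S :: "('k::field, 'n::{finite,linorder}) square_matrix set"
  assumes S: "S \<subseteq> pattern_matrices (slice_pattern v)"
  shows "isomorphic_spaces
     (coordinate_space {b ** c | b c. b \<in> pattern_matrices (cell_pattern v) \<and> c \<in> S} matrix_entries)
     (coordinate_space (pattern_matrices (cell_pattern v) \<times> S) (product_coordinates matrix_entries matrix_entries))"
proof (rule isomorphic_coordinate_spaces[where
      \<phi> = "\<lambda>h. (restrict_pattern (cell_pattern v) (factor_limit v h), restrict_pattern (slice_pattern v) (factor_limit v h))"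
      and \<psi> = "\<lambda>(b, c). b ** c"])
  note uniq = factor_limit_unique[OF _ subsetD[OF S]]
  show "(restrict_pattern (cell_pattern v) (factor_limit v h), restrict_pattern (slice_pattern v) (factor_limit v h))
      \<in> pattern_matrices (cell_pattern v) \<times> S"
    if "h \<in> {b ** c | b c. b \<in> pattern_matrices (cell_pattern v) \<and> c \<in> S}" for h
    using that by (auto simp: uniq)
  show "(case (restrict_pattern (cell_pattern v) (factor_limit v h), restrict_pattern (slice_pattern v) (factor_limit v h)) of (b, c) \<Rightarrow> b ** c) = h"
    if "h \<in> {b ** c | b c. b \<in> pattern_matrices (cell_pattern v) \<and> c \<in> S}" for h
    using that by (auto simp: uniq)
  show "(case z of (b, c) \<Rightarrow> b ** c) \<in> {b ** c | b c. b \<in> pattern_matrices (cell_pattern v) \<and> c \<in> S}"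
    if "z \<in> pattern_matrices (cell_pattern v) \<times> S" for z
    using that by auto
  show "(restrict_pattern (cell_pattern v) (factor_limit v (case z of (b, c) \<Rightarrow> b ** c)),
        restrict_pattern (slice_pattern v) (factor_limit v (case z of (b, c) \<Rightarrow> b ** c))) = z"
    if "z \<in> pattern_matrices (cell_pattern v) \<times> S" for z
    using that by (auto simp: uniq)
  let ?P = "{b ** c | b c. b \<in> pattern_matrices (cell_pattern v) \<and> c \<in> S}"
  show "\<exists>g\<in>polynomial_functions matrix_entries. \<forall>h\<in>?P. e (restrict_pattern (cell_pattern v) (factor_limit v h),
        restrict_pattern (slice_pattern v) (factor_limit v h)) = g h"
    if e: "e \<in> product_coordinates matrix_entries matrix_entries"
    for e :: "('k, 'n) square_matrix \<times> ('k, 'n) square_matrix \<Rightarrow> 'k"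
  proof -
    have *: "(\<lambda>h. restrict_pattern I (factor_limit v h) $ j $ i) \<in> polynomial_functions matrix_entries" for I j i
      by (rule polynomial_restrict_pattern[OF polynomial_factor_limit])
    consider j i where "e = (\<lambda>g. g $ j $ i) \<circ> fst" | j i where "e = (\<lambda>g. g $ j $ i) \<circ> snd"
      using e unfolding product_coordinates_def matrix_entries_def by blast
    then show ?thesis
    proof cases
      case (1 j i)
      show ?thesis by (rule bexI[OF _ *[of "cell_pattern v" j i]]) (simp add: 1)
    next
      case (2 j i)
      show ?thesis by (rule bexI[OF _ *[of "slice_pattern v" j i]]) (simp add: 2)
    qed
  qed
  show "\<exists>g\<in>polynomial_functions (product_coordinates matrix_entries matrix_entries).
      \<forall>z\<in>pattern_matrices (cell_pattern v) \<times> S. e (case z of (b, c) \<Rightarrow> b ** c) = g z"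
    if e: "e \<in> matrix_entries" for e :: "('k, 'n) square_matrix \<Rightarrow> 'k"
  proof -
    let ?C = "product_coordinates matrix_entries matrix_entries ::
        (('k, 'n) square_matrix \<times> ('k, 'n) square_matrix \<Rightarrow> 'k) set"
    obtain j i where e: "e = (\<lambda>g. g $ j $ i)" using e unfolding matrix_entries_def by blast
    have "(\<lambda>g. g $ j $ t) \<circ> fst \<in> ?C" for t
      unfolding product_coordinates_def matrix_entries_def by blast
    then have 1: "(\<lambda>z. fst z $ j $ t) \<in> polynomial_functions ?C" for t
      by (auto dest: polynomial_functions.coord simp: comp_def)
    have "(\<lambda>g. g $ t $ i) \<circ> snd \<in> ?C" for t
      unfolding product_coordinates_def matrix_entries_def by blast
    then have 2: "(\<lambda>z. snd z $ t $ i) \<in> polynomial_functions ?C" for t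
      by (auto dest: polynomial_functions.coord simp: comp_def)
    have "(\<lambda>z. \<Sum>t\<in>UNIV. fst z $ j $ t * snd z $ t $ i) \<in> polynomial_functions ?C"
      by (intro polynomial_functions_sum polynomial_functions.mult 1 2)
    then show ?thesis
      by (intro bexI[of _ "\<lambda>z. \<Sum>t\<in>UNIV. fst z $ j $ t * snd z $ t $ i"])
         (auto simp: e matrix_matrix_mult_def)
  qed
qed

section \<open>Schubert cells and varieties in the chart\<close>

text \<open>The columns of a matrix for \<open>V\<close> are permuted by \<open>v\<close>: column
  \<open>j\<close> of \<open>g1\<close> is column \<open>v j\<close> of \<open>g0\<close>, so the
  indices with \<open>v j \<le> q\<close> pick out the first columns of \<open>g0\<close>.\<close>

lemma exists_adapted_matrix:
  fixes V :: "('k::field, 'n::{finite,linorder}) flag"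
  assumes V: "V \<in> complete_flags" and v: "bij v"
  obtains g1 G where "flag_chart g1 G" "\<And>q. V q = (*v) g1 ` coord_subspace {j. v j \<le> q}"
proof -
  obtain g0 where g0: "invertible g0" "column_flag g0 = V" using complete_flag_column_flag[OF V] .
  define g1 where "g1 = (\<chi> i j. g0 $ i $ v j)"
  have mult: "g1 *v x = g0 *v (\<chi> i. x $ inv_into UNIV v i)" for x
  proof -
    have "(g1 *v x) $ r = (g0 *v (\<chi> i. x $ inv_into UNIV v i)) $ r" for r
      unfolding matrix_vector_mult_def g1_def
      using sum.reindex_bij_betw[OF v, of "\<lambda>i. g0 $ r $ i * x $ inv_into UNIV v i"] v
      by (simp add: bij_is_inj inv_f_f)
    then show ?thesis by (simp add: cart_eq_iff)
  qed
  have "x = 0" if "g1 *v x = 0" for x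
  proof -
    have "(\<chi> i. x $ inv_into UNIV v i) = 0" using that g0(1) unfolding mult invertible_kernel by blast
    then have z: "x $ inv_into UNIV v i = 0" for i by (simp add: cart_eq_iff)
    have "x $ j = 0" for j using z[of "v j"] v by (simp add: bij_is_inj inv_f_f)
    then show ?thesis by (simp add: cart_eq_iff)
  qed
  then have "invertible g1" unfolding invertible_kernel by blast
  then obtain G where G: "G ** g1 = Finite_Cartesian_Product.mat 1" "g1 ** G = Finite_Cartesian_Product.mat 1"
    unfolding invertible_def by blast
  have "V q = (*v) g1 ` coord_subspace {j. v j \<le> q}" for q
  proof -
    have "(\<lambda>x. \<chi> i. x $ inv_into UNIV v i) ` coord_subspace {j. v j \<le> q} = (coord_subspace {..q} :: ('k, 'n) Finite_Cartesian_Product.vec set)"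
    proof (intro equalityI subsetI)
      fix y :: "('k, 'n) Finite_Cartesian_Product.vec" assume y: "y \<in> coord_subspace {..q}"
      have "y = (\<chi> i. (\<chi> j. y $ v j) $ inv_into UNIV v i)"
        using v by (simp add: cart_eq_iff bij_is_surj surj_f_inv_f)
      moreover have "(\<chi> j. y $ v j) \<in> coord_subspace {j. v j \<le> q}"
        using y by (simp add: coord_subspace_def)
      ultimately show "y \<in> (\<lambda>x. \<chi> i. x $ inv_into UNIV v i) ` coord_subspace {j. v j \<le> q}" by (rule image_eqI)
    qed (use v in \<open>auto simp: coord_subspace_def bij_is_surj surj_f_inv_f\<close>)
    then have "V q = (*v) g0 ` (\<lambda>x. \<chi> i. x $ inv_into UNIV v i) ` coord_subspace {j. v j \<le> q}"
      unfolding g0(2)[symmetric] column_flag_image by simp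
    then show ?thesis by (simp add: image_image mult)
  qed
  then show ?thesis using that[of g1 G] G by (simp add: flag_chart_def)
qed

text \<open>For the flag \<open>W\<close> with matrix \<open>g1 b c\<close>, the intersection of \<open>W_p\<close> and \<open>V_q\<close> is the image of
  \<open>incidence_space v c p q\<close> under this matrix.\<close>

definition incidence_space ::
  "('n \<Rightarrow> 'n) \<Rightarrow> ('k::field, 'n::{finite,linorder}) square_matrix \<Rightarrow> 'n \<Rightarrow> 'n \<Rightarrow> ('k, 'n) Finite_Cartesian_Product.vec set" where
  "incidence_space v c p q = {x \<in> coord_subspace {..p}. c *v x \<in> coord_subspace {j. v j \<le> q}}"

lemma subspace_incidence_space: "vec.subspace (incidence_space v c p q)"
proof -
  have "incidence_space v c p q = coord_subspace {..p} \<inter> (*v) c -` coord_subspace {j. v j \<le> q}"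
    unfolding incidence_space_def by auto
  moreover have "vec.subspace ((*v) c -` coord_subspace {j. v j \<le> q})"
    by (intro vec.linear_subspace_vimage matrix_vector_mul_linear_gen subspace_coord_subspace)
  ultimately show ?thesis by (simp add: vec.subspace_inter subspace_coord_subspace)
qed

text \<open>The factor transversal to the cell, which is to be identified with the cone of each
  type.\<close>

definition slice_schubert ::
  "('n \<Rightarrow> 'n) \<Rightarrow> ('n \<Rightarrow> 'n) \<Rightarrow> ('k::field, 'n::{finite,linorder}) square_matrix set" where
  "slice_schubert v w = {c \<in> pattern_matrices (slice_pattern v).
     \<forall>p q. rank_function w p q \<le> vec.dim (incidence_space v c p q)}"

text \<open>A coordinate subspace of codimension \<open>card B\<close> meets every subspace of
  larger dimension nontrivially.\<close>

lemma subspace_vanishing_vector: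
  fixes K :: "('k::field ^ 'n::finite) set"
  assumes K: "vec.subspace K" and "card B < vec.dim K"
  obtains x where "x \<in> K" "x \<noteq> 0" "\<And>i. i \<in> B \<Longrightarrow> x $ i = 0"
proof -
  let ?E = "coord_subspace (- B) :: ('k ^ 'n) set"
  let ?S = "{x + y |x y. x \<in> K \<and> y \<in> ?E}"
  have "?S \<subseteq> coord_subspace UNIV" by (simp add: coord_subspace_def)
  then have "vec.dim ?S \<le> vec.dim (coord_subspace UNIV :: ('k ^ 'n) set)" by (rule vec.dim_subset)
  then have "vec.dim ?S \<le> CARD('n)" by (simp only: dim_coord_subspace)
  moreover have "vec.dim ?E + card B = CARD('n)"
    using card_Un_disjoint[of "- B" B] by (simp add: dim_coord_subspace)
  moreover have "vec.dim ?S + vec.dim (K \<inter> ?E) = vec.dim K + vec.dim ?E"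
    by (rule vec.dim_sums_Int[OF K subspace_coord_subspace])
  ultimately have "vec.dim (K \<inter> ?E) > 0" using assms(2) by linarith
  then have "\<not> K \<inter> ?E \<subseteq> {0}" using vec.dim_eq_0 by (metis less_irrefl)
  then show ?thesis using that unfolding coord_subspace_def by auto
qed

text \<open>If the coordinates in the block vanish, the support of \<open>x\<close> consists of
  indices with \<open>q < v a\<close>; in these rows \<open>c *v x\<close> vanishes, so
  \<open>x\<close> is killed by unitriangularity.\<close>

lemma incidence_space_determined:
  fixes c :: "('k::field, 'n::{finite,linorder}) square_matrix"
  assumes "c \<in> lower_unitriangular" "x \<in> incidence_space v c p q"
    and "\<And>a. a \<le> p \<Longrightarrow> v a \<le> q \<Longrightarrow> x $ a = 0"
  shows "x = 0"
  by (rule lower_unitriangular_kernel[OF assms(1)])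
     (use assms(2,3) in \<open>auto simp: incidence_space_def coord_subspace_def\<close>)

lemma pattern_matrices_support:
  "b \<in> pattern_matrices I \<Longrightarrow> b $ j $ i \<noteq> 0 \<Longrightarrow> j \<noteq> i \<Longrightarrow> (j, i) \<in> I"
  by (auto simp: pattern_matrices_iff)

lemma slice_lower_zero: "c \<in> pattern_matrices (slice_pattern v) \<Longrightarrow> j < i \<Longrightarrow> c $ j $ i = 0"
  using slice_pattern_lower unfolding lower_unitriangular_def by blast

text \<open>At \<open>(p, q) = (i, v i)\<close> the entries of column \<open>i\<close> are not disturbed by the pivots of the block.\<close>

lemma slice_column_vanishes:
  fixes c :: "('k::field, 'n::{finite,linorder}) square_matrix"
  assumes c: "c \<in> pattern_matrices (slice_pattern v)"
    and dim: "rank_function v i (v i) \<le> vec.dim (incidence_space v c i (v i))"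
    and j: "j \<noteq> i"
  shows "c $ j $ i = 0"
proof (rule ccontr)
  assume nz: "c $ j $ i \<noteq> 0"
  then have ij: "i < j" "v i < v j"
    using pattern_matrices_support[OF c nz] j by (auto simp: slice_pattern_def)
  let ?A = "{a. a \<le> i \<and> v a \<le> v i}"
  have lower: "c \<in> lower_unitriangular" using c slice_pattern_lower by blast
  \<comment> \<open>One condition fewer than the dimension: some nonzero vector vanishes at all
    indices of the block except possibly \<open>i\<close>.\<close>
  have "card (?A - {i}) < card ?A" by (rule psubset_card_mono) auto
  then have "card (?A - {i}) < vec.dim (incidence_space v c i (v i))"
    using dim unfolding rank_function_def by linarith
  then obtain x where x: "x \<in> incidence_space v c i (v i)" "x \<noteq> 0" "\<And>a. a \<in> ?A - {i} \<Longrightarrow> x $ a = 0"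
    using subspace_vanishing_vector[OF subspace_incidence_space] by blast
  have xi: "x $ i \<noteq> 0"
  proof
    assume "x $ i = 0"
    then have "x = 0" using x(3) by (intro incidence_space_determined[OF lower x(1)]) auto
    then show False using x by simp
  qed
  have cx: "(c *v x) $ r = 0" if "v i < v r" for r
    using x(1) that by (auto simp: incidence_space_def coord_subspace_def)
  have split: "c *v (x - x $ i *s axis i 1) = c *v x - x $ i *s column i c"
    by (simp add: vec.diff vec.scale matrix_vector_mult_axis)
  \<comment> \<open>The support left after removing \<open>i\<close> has \<open>r < i\<close> and
    \<open>v i < v r\<close>. There \<open>c *v x\<close> vanishes by incidence and column
    \<open>i\<close> of \<open>c\<close> by triangularity, so nothing is left and
    \<open>c *v x\<close> is a multiple of column \<open>i\<close>.\<close>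
  have "x - x $ i *s axis i 1 = 0"
  proof (rule lower_unitriangular_kernel[OF lower])
    fix r assume "(x - x $ i *s axis i 1) $ r \<noteq> 0"
    then have r: "x $ r \<noteq> 0" "r \<noteq> i" by (auto simp: axis_def split: if_splits)
    then have "r \<le> i" using x(1) by (auto simp: incidence_space_def coord_subspace_def)
    then have "r < i" "\<not> v r \<le> v i" using r x(3)[of r] by auto
    then have "v i < v r" by simp
    then show "(c *v (x - x $ i *s axis i 1)) $ r = 0"
      unfolding split using cx slice_lower_zero[OF c \<open>r < i\<close>] by (simp add: column_def)
  qed
  then have "c *v x - x $ i *s column i c = 0" using split by (metis matrix_vector_mult_0_right)
  then have "(c *v x) $ j - x $ i * c $ j $ i = 0" by (simp add: cart_eq_iff column_def)
  then show False using cx[OF ij(2)] nz xi by simp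
qed

text \<open>Just before \<open>(j, v j)\<close> the entries of row \<open>j\<close> are not disturbed by the pivots of the block.\<close>

lemma slice_row_vanishes:
  fixes c :: "('k::field, 'n::{finite,linorder}) square_matrix"
  assumes c: "c \<in> pattern_matrices (slice_pattern v)" and "inj v"
    and dim: "\<And>p q. (\<And>i. i \<le> p \<longleftrightarrow> i < j) \<Longrightarrow> (\<And>u. u \<le> q \<longleftrightarrow> u < v j) \<Longrightarrow>
       rank_function v p q \<le> vec.dim (incidence_space v c p q)"
    and i: "i \<noteq> j"
  shows "c $ j $ i = 0"
proof (rule ccontr)
  assume nz: "c $ j $ i \<noteq> 0"
  then have ij: "i < j" "v i < v j"
    using pattern_matrices_support[OF c nz] i by (auto simp: slice_pattern_def)
  have pred: "\<exists>p. \<forall>i. i \<le> p \<longleftrightarrow> i < k" if "\<exists>i. i < k" for k :: 'n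
  proof -
    have "Max {i. i < k} \<in> {i. i < k}" using that by (intro Max_in) auto
    then show ?thesis by (intro exI[of _ "Max {i. i < k}"]) auto
  qed
  \<comment> \<open>\<open>p\<close> and \<open>q\<close> are the predecessors of \<open>j\<close>
    and \<open>v j\<close>; they exist because \<open>i\<close> and \<open>v i\<close> lie
    below.\<close>
  obtain p where p: "\<And>i. i \<le> p \<longleftrightarrow> i < j" using pred[of j] ij by blast
  obtain q where q: "\<And>u. u \<le> q \<longleftrightarrow> u < v j" using pred[of "v j"] ij by blast
  let ?A = "{a. a \<le> p \<and> v a \<le> q}"
  have lower: "c \<in> lower_unitriangular" using c slice_pattern_lower by blast
  have "i \<in> ?A" using ij p q by simp
  then have "card (?A - {i}) < card ?A" by (intro psubset_card_mono) auto
  then have "card (?A - {i}) < vec.dim (incidence_space v c p q)"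
    using dim[OF p q] unfolding rank_function_def by linarith
  then obtain x where x: "x \<in> incidence_space v c p q" "x \<noteq> 0" "\<And>a. a \<in> ?A - {i} \<Longrightarrow> x $ a = 0"
    using subspace_vanishing_vector[OF subspace_incidence_space] by blast
  have xi: "x $ i \<noteq> 0"
  proof
    assume "x $ i = 0"
    then have "x = 0" using x(3) by (intro incidence_space_determined[OF lower x(1)]) auto
    then show False using x by simp
  qed
  have "(c *v x) $ j = 0"
    using x(1) q[of "v j"] by (auto simp: incidence_space_def coord_subspace_def)
  \<comment> \<open>A nonzero entry of row \<open>j\<close> in a column \<open>t < j\<close> forces
    \<open>v t < v j\<close>, so \<open>t\<close> is in the block, where \<open>x\<close> vanishes
    except at \<open>i\<close>.\<close>
  moreover have "c $ j $ t * x $ t = 0" if "t \<noteq> i" for t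
  proof (rule ccontr)
    assume "c $ j $ t * x $ t \<noteq> 0"
    then have t: "c $ j $ t \<noteq> 0" "x $ t \<noteq> 0" by auto
    then have "t < j" using x(1) p by (auto simp: incidence_space_def coord_subspace_def)
    then have "v t < v j" using pattern_matrices_support[OF c t(1)] by (auto simp: slice_pattern_def)
    then show False using x(3)[of t] t that \<open>t < j\<close> p q by simp
  qed
  then have "(\<Sum>t\<in>UNIV. c $ j $ t * x $ t) = (\<Sum>t\<in>{i}. c $ j $ t * x $ t)"
    by (intro sum.mono_neutral_right) auto
  ultimately have "c $ j $ i * x $ i = 0" by (simp add: matrix_vector_mult_def)
  then show False using nz xi by simp
qed

text \<open>The member with index one less, with the convention that the member of index zero is the
  zero space.\<close>

definition flag_below :: "('k::field, 'n::{finite,linorder}) flag \<Rightarrow> ('k, 'n) flag" where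
  "flag_below W p = (if \<exists>q. q < p then W (Max {q. q < p}) else {0})"

lemma flag_below_cases:
  fixes W :: "('k::field, 'n::{finite,linorder}) flag"
  obtains "\<And>q. \<not> q < p" "flag_below W p = {0}"
  | p0 where "\<And>q. q \<le> p0 \<longleftrightarrow> q < p" "flag_below W p = W p0"
proof (cases "\<exists>q. q < p")
  case True
  then have "Max {i. i < p} \<in> {i. i < p}" by (intro Max_in) auto
  then have *: "\<And>q. q \<le> Max {i. i < p} \<longleftrightarrow> q < p" by auto
  show ?thesis by (rule that(2)[OF *]) (use True in \<open>simp add: flag_below_def\<close>)
next
  case False
  then show ?thesis using that(1) unfolding flag_below_def by simp
qed

text \<open>The parameters \<open>f\<close> and \<open>Q\<close> let one lemma serve for both flags:
  \<open>f\<close> is the identity for the moving flag and \<open>v\<close> for the reference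
  flag.\<close>

lemma dim_flag_below:
  fixes W :: "('k::field, 'n::{finite,linorder}) flag"
  assumes S: "0 \<in> S" and dim: "\<And>q. vec.dim (W q \<inter> S) = card {i. f i \<le> q \<and> Q i}"
  shows "vec.dim (flag_below W p \<inter> S) = card {i. f i < p \<and> Q i}"
proof (cases rule: flag_below_cases[of p W])
  case 1
  have "flag_below W p \<inter> S = {0}" using S 1 by auto
  moreover have "vec.dim {0 :: ('k, 'n) Finite_Cartesian_Product.vec} = 0"
    using vec.dim_le_card[of "{0}" "{}"] by simp
  ultimately show ?thesis using 1(1) by simp
next
  case (2 p0)
  then show ?thesis using dim[of p0] by simp
qed

lemma flag_below_subset:
  "W \<in> complete_flags \<Longrightarrow> vec.subspace (flag_below W p) \<and> flag_below W p \<subseteq> W p \<and> (\<forall>q<p. W q \<subseteq> flag_below W p)"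
proof (cases rule: flag_below_cases[of p W])
  case 1
  assume "W \<in> complete_flags"
  then show ?thesis using 1 vec.subspace_0 by (auto simp: complete_flags_def)
next
  case (2 p0)
  assume W: "W \<in> complete_flags"
  have "p0 < p" using 2(1)[of p0] by simp
  then show ?thesis using 2 W unfolding complete_flags_def by auto
qed

section \<open>The chart adapted to the cell of \<open>v\<close>\<close>

locale schubert_chart = flag_chart g1 G
  for g1 G :: "('k::field, 'n::{finite,linorder}) square_matrix" +
  fixes v :: "'n \<Rightarrow> 'n" and V :: "('k, 'n) flag"
  assumes bij: "bij v" and V_eq: "\<And>q. V q = (*v) g1 ` coord_subspace {j. v j \<le> q}"
    and V_complete: "V \<in> complete_flags"
begin

lemma inj_v: "inj v" using bij by (rule bij_is_inj)

lemma inj_g1: "inj ((*v) g1)" by (rule inj_matrix_vector_mult[OF invertible_g1])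

text \<open>A nonzero entry of \<open>b\<close> at \<open>(j, i)\<close> off the diagonal has
  \<open>v j < v i\<close>, so \<open>b\<close> maps the coordinate subspace into itself; by
  dimension it maps onto it, which gives the equivalence.\<close>

lemma cell_pattern_preserves:
  fixes b :: "('k, 'n) square_matrix"
  assumes b: "b \<in> pattern_matrices (cell_pattern v)"
  shows "b *v y \<in> coord_subspace {j. v j \<le> q} \<longleftrightarrow> y \<in> coord_subspace {j. v j \<le> q}"
proof -
  let ?E = "coord_subspace {j. v j \<le> q} :: ('k, 'n) Finite_Cartesian_Product.vec set"
  have "invertible b" using b cell_pattern_lower lower_unitriangular_invertible by blast
  have sub: "(*v) b ` ?E \<subseteq> ?E"
  proof (rule image_subsetI)
    fix y :: "('k, 'n) Finite_Cartesian_Product.vec" assume y: "y \<in> ?E"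
    have "b $ j $ i * y $ i = 0" if "\<not> v j \<le> q" for i j
    proof (rule ccontr)
      assume "b $ j $ i * y $ i \<noteq> 0"
      then have "v i \<le> q" "b $ j $ i \<noteq> 0" using y by (auto simp: coord_subspace_def)
      then show False
        using pattern_matrices_support[OF b, of j i] that by (cases "j = i") (auto simp: cell_pattern_def)
    qed
    then show "b *v y \<in> ?E" by (auto simp: coord_subspace_def matrix_vector_mult_def intro!: sum.neutral)
  qed
  have eq: "(*v) b ` ?E = ?E"
    by (intro vec.subspace_dim_equal sub subspace_coord_subspace vec.linear_subspace_image
        matrix_vector_mul_linear_gen) (simp add: dim_matrix_image[OF \<open>invertible b\<close>])
  then show ?thesis using inj_matrix_vector_mult[OF \<open>invertible b\<close>] by (metis image_eqI inj_image_mem_iff)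
qed

lemma dim_chart_incidence:
  assumes b: "b \<in> pattern_matrices (cell_pattern v)" and c: "c \<in> lower_unitriangular"
  shows "vec.dim (chart (b ** c) p \<inter> V q) = vec.dim (incidence_space v c p q)"
proof -
  have inv: "invertible (g1 ** (b ** c))"
    using b c cell_pattern_lower lower_unitriangular_invertible invertible_g1 by (intro invertible_mult) blast+
  have "chart (b ** c) p \<inter> V q = (*v) (g1 ** (b ** c)) ` incidence_space v c p q"
  proof (intro equalityI subsetI)
    fix y assume y: "y \<in> chart (b ** c) p \<inter> V q"
    then obtain x where x: "x \<in> coord_subspace {..p}" "y = g1 ** (b ** c) *v x"
      unfolding chart_def column_flag_image by blast
    obtain z where z: "z \<in> coord_subspace {j. v j \<le> q}" "y = g1 *v z" using y V_eq by blast
    have "g1 *v (b *v (c *v x)) = g1 *v z" using x z by (simp add: matrix_vector_mul_assoc matrix_mul_assoc)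
    then have "b *v (c *v x) = z" using inj_g1 by (auto dest: injD)
    then have "x \<in> incidence_space v c p q"
      using z x cell_pattern_preserves[OF b, of "c *v x" q] by (simp add: incidence_space_def)
    then show "y \<in> (*v) (g1 ** (b ** c)) ` incidence_space v c p q" using x by blast
  next
    fix y assume "y \<in> (*v) (g1 ** (b ** c)) ` incidence_space v c p q"
    then obtain x where x: "x \<in> incidence_space v c p q" "y = g1 ** (b ** c) *v x" by blast
    have "y = g1 *v (b *v (c *v x))" using x by (simp add: matrix_vector_mul_assoc matrix_mul_assoc)
    moreover have "b *v (c *v x) \<in> coord_subspace {j. v j \<le> q}"
      using x cell_pattern_preserves[OF b] by (simp add: incidence_space_def)
    ultimately have "y \<in> V q" using V_eq by blast
    moreover have "y \<in> chart (b ** c) p"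
      using x unfolding chart_def column_flag_image incidence_space_def by blast
    ultimately show "y \<in> chart (b ** c) p \<inter> V q" by blast
  qed
  then show ?thesis by (simp add: dim_matrix_image[OF inv])
qed

lemma one_lower: "Finite_Cartesian_Product.mat 1 \<in> pattern_matrices I"
  by (simp add: pattern_matrices_iff Finite_Cartesian_Product.mat_def)

lemma incidence_space_one:
  "vec.dim (incidence_space v (Finite_Cartesian_Product.mat 1 :: ('k, 'n) square_matrix) p q) = rank_function v p q"
proof -
  have "incidence_space v (Finite_Cartesian_Product.mat 1 :: ('k, 'n) square_matrix) p q = coord_subspace {i. i \<le> p \<and> v i \<le> q}"
    unfolding incidence_space_def coord_subspace_def by auto
  then show ?thesis by (simp add: dim_coord_subspace rank_function_def)
qed

lemma chart_factor:
  assumes "u \<in> lower_unitriangular"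
  obtains b c where "u = b ** c" "b \<in> pattern_matrices (cell_pattern v)" "c \<in> pattern_matrices (slice_pattern v)"
  using factor_limit_product[OF inj_v assms] restrict_pattern_in by metis

text \<open>In each \<open>P p\<close> there is a vector of \<open>V (v p)\<close> not in the
  preceding member of \<open>P\<close>. Dimension counts force its coordinate at \<open>p\<close> in
  the basis \<open>g1\<close> to be nonzero, so it can be scaled to 1. The matrix of these vectors
  has the flag \<open>P\<close>, and its leading minors are nonzero by triangularity for the order
  of the values of \<open>v\<close>.\<close>

lemma schubert_cell_in_chart:
  assumes P: "P \<in> schubert_cell V v"
  shows "P \<in> chart ` lower_unitriangular"
proof -
  have Pc: "P \<in> complete_flags" and dim: "vec.dim (P p \<inter> V q) = card {i. i \<le> p \<and> v i \<le> q}" for p q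
    using P unfolding schubert_cell_def rank_function_def by auto
  have z: "0 \<in> P p" "0 \<in> V p" "0 \<in> flag_below P p" "0 \<in> flag_below V p" for p
    using Pc V_complete flag_below_subset[OF Pc, of p] flag_below_subset[OF V_complete, of p]
    by (auto simp: complete_flags_def vec.subspace_0)
  have d2: "vec.dim (flag_below P p \<inter> V q) = card {i. i < p \<and> v i \<le> q}" for p q
    by (rule dim_flag_below[where f = "\<lambda>i. i"]) (simp_all add: z dim)
  have d3: "vec.dim (P p \<inter> flag_below V u) = card {i. i \<le> p \<and> v i < u}" for p u
    using dim_flag_below[of "P p" V v "\<lambda>i. i \<le> p" u] by (simp add: z dim Int_commute conj_commute)
  have d4: "vec.dim (flag_below P p \<inter> flag_below V u) = card {i. i < p \<and> v i < u}" for p u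
    by (rule dim_flag_below[where f = "\<lambda>i. i"]) (simp_all add: z d3)
  have below_V: "g1 *v y \<in> flag_below V u" if y: "y \<in> coord_subspace {j. v j < u}" for y u
  proof (cases rule: flag_below_cases[of u V])
    case 1
    then have "y = 0" using y by (simp add: coord_subspace_def cart_eq_iff)
    then show ?thesis using z by simp
  next
    case (2 u0)
    then show ?thesis using y V_eq by auto
  qed
  have "\<exists>x. x \<in> P p \<and> x \<notin> flag_below P p \<and> G *v x \<in> coord_subspace {j. v j \<le> v p} \<and> (G *v x) $ p = 1" for p
  proof -
    have "card {i. i < p \<and> v i \<le> v p} < card {i. i \<le> p \<and> v i \<le> v p}"
      by (rule psubset_card_mono) auto
    then have "vec.dim (flag_below P p \<inter> V (v p)) < vec.dim (P p \<inter> V (v p))" by (simp add: dim d2)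
    then have "\<not> P p \<inter> V (v p) \<subseteq> flag_below P p \<inter> V (v p)" using vec.dim_subset leD by blast
    then obtain x where x: "x \<in> P p" "x \<in> V (v p)" "x \<notin> flag_below P p" by blast
    then obtain y where y: "x = g1 *v y" "y \<in> coord_subspace {j. v j \<le> v p}" using V_eq by blast
    have Gx: "G *v x = y" by (simp add: y matrix_vector_mul_assoc left_inv)
    have "y $ p \<noteq> 0"
    proof
      assume "y $ p = 0"
      have "y $ i = 0" if "\<not> v i < v p" for i
      proof (cases "i = p")
        case False
        then have "\<not> v i \<le> v p" using inj_v that by (auto dest: injD)
        then show ?thesis using y(2) by (simp add: coord_subspace_def)
      qed (use \<open>y $ p = 0\<close> in simp)
      then have "x \<in> flag_below V (v p)" using below_V[of y "v p"] y(1) by (simp add: coord_subspace_def)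
      \<comment> \<open>With \<open>v i < v p\<close> the index \<open>i = p\<close> does not occur,
        so going from the preceding member to \<open>P p\<close> adds no dimension.\<close>
      moreover have "flag_below P p \<inter> flag_below V (v p) = P p \<inter> flag_below V (v p)"
      proof (rule vec.subspace_dim_equal)
        have "{i. i \<le> p \<and> v i < v p} = {i. i < p \<and> v i < v p}" by (auto simp: order_le_less)
        then show "vec.dim (P p \<inter> flag_below V (v p)) \<le> vec.dim (flag_below P p \<inter> flag_below V (v p))"
          by (simp add: d3 d4)
      qed (use flag_below_subset[OF Pc, of p] flag_below_subset[OF V_complete, of "v p"] Pc in
          \<open>auto simp: complete_flags_def intro!: vec.subspace_inter\<close>)
      ultimately show False using x by blast
    qed
    let ?x = "inverse (y $ p) *s x"
    have "?x \<in> P p" using x Pc by (simp add: complete_flags_def vec.subspace_scale)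
    moreover have "?x \<notin> flag_below P p"
    proof
      assume "?x \<in> flag_below P p"
      then have "y $ p *s ?x \<in> flag_below P p" using flag_below_subset[OF Pc, of p] vec.subspace_scale by blast
      then show False using x(3) \<open>y $ p \<noteq> 0\<close> by simp
    qed
    moreover have "G *v ?x = inverse (y $ p) *s y" by (simp add: vec.scale Gx)
    ultimately show ?thesis using y(2) \<open>y $ p \<noteq> 0\<close>
      by (intro exI[of _ ?x]) (simp add: coord_subspace_def)
  qed
  then obtain f where f: "\<And>p. f p \<in> P p" "\<And>p. f p \<notin> flag_below P p"
     "\<And>p. G *v f p \<in> coord_subspace {j. v j \<le> v p}" "\<And>p. (G *v f p) $ p = 1" by metis
  obtain M where M: "\<forall>p. column p M = f p" using matrix_of_columns by blast
  have "invertible M"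
  proof (rule invertible_from_flag[OF Pc])
    show "column p M \<in> P p" for p using M f by simp
    show "column p M \<noteq> 0" for p using M f(2)[of p] z by auto
    show "column p M \<notin> P q" if "q < p" for p q using M f(2)[of p] flag_below_subset[OF Pc, of p] that by auto
  qed
  have flag: "column_flag M = P"
    by (rule column_flag_eqI[OF Pc \<open>invertible M\<close>]) (simp add: M f)
  have entry: "(G ** M) $ j $ p = (G *v f p) $ j" for j p
  proof -
    have "column p (G ** M) = G *v column p M"
      by (simp add: matrix_vector_mult_axis[symmetric] matrix_vector_mul_assoc)
    then show ?thesis using M by (simp add: cart_eq_iff column_def)
  qed
  have "generic_flag_matrix (G ** M)" unfolding generic_flag_matrix_def
  proof
    fix i
    \<comment> \<open>Column \<open>s\<close> of \<open>G ** M\<close> has entry 1 at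
      \<open>s\<close> and is supported where \<open>v r \<le> v s\<close>. Replacing columns by
      unit vectors keeps this, so every corner matrix is unitriangular for the order by
      \<open>v\<close>.\<close>
    have "x = 0" if x: "corner_matrix (G ** M) i *v x = 0" for x
    proof (rule unitriangular_kernel[of "{(j, i). v i < v j}" x "corner_matrix (G ** M) i"])
      show "wf {(j, i). v i < v j}"
      proof (rule finite_acyclic_wf)
        show "acyclic {(j, i). v i < v j}" unfolding acyclic_def
        proof (intro allI notI)
          fix x assume "(x, x) \<in> {(j, i). v i < v j}\<^sup>+"
          moreover have "trans {(j, i). v i < v j}" by (auto intro: transI)
          ultimately show False by simp
        qed
      qed simp
      show "corner_matrix (G ** M) i $ r $ r = 1" for r by (simp add: corner_matrix_def entry f(4))
      show "r = s \<or> (s, r) \<in> {(j, i). v i < v j}" if "corner_matrix (G ** M) i $ r $ s \<noteq> 0" for r s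
      proof (cases "r = s")
        case False
        then have "(G *v f s) $ r \<noteq> 0" using that by (auto simp: corner_matrix_def entry split: if_splits)
        then have "v r \<le> v s" using f(3)[of s] by (auto simp: coord_subspace_def)
        then show ?thesis using False inj_v by (auto simp: order_le_less dest: injD)
      qed simp
    qed (simp add: x)
    then show "Determinants.det (corner_matrix (G ** M) i) \<noteq> 0" by (metis invertible_det_nz invertible_kernel)
  qed
  then have "discriminant M \<noteq> 0" by (simp add: discriminant_nonzero)
  from column_flag_normal[OF \<open>invertible M\<close> this] show ?thesis using flag by auto
qed

text \<open>In the cell of \<open>v\<close> the rank conditions of
  \<open>slice_column_vanishes\<close> hold for every column, which leaves only
  \<open>c = 1\<close>; the ranks at \<open>c = 1\<close> are those of \<open>v\<close>.\<close>

lemma schubert_cell_eq: "schubert_cell V v = chart ` pattern_matrices (cell_pattern v)"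
proof (intro equalityI subsetI)
  fix P assume "P \<in> chart ` pattern_matrices (cell_pattern v)"
  then obtain b where b: "b \<in> pattern_matrices (cell_pattern v)" "P = chart b" by blast
  have one: "Finite_Cartesian_Product.mat 1 \<in> lower_unitriangular" 
    unfolding lower_unitriangular_pattern by (rule one_lower)
  show "P \<in> schubert_cell V v"
    using dim_chart_incidence[OF b(1) one] b chart_complete[OF subsetD[OF cell_pattern_lower b(1)]]
    unfolding schubert_cell_def by (auto simp: incidence_space_one)
next
  fix P assume P: "P \<in> schubert_cell V v"
  then obtain u where u: "u \<in> lower_unitriangular" "P = chart u" using schubert_cell_in_chart by blast
  obtain b c where bc: "u = b ** c" "b \<in> pattern_matrices (cell_pattern v)" "c \<in> pattern_matrices (slice_pattern v)"
    using chart_factor[OF u(1)] .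
  have "c \<in> lower_unitriangular" using bc slice_pattern_lower by blast
  then have dim: "vec.dim (incidence_space v c p q) = rank_function v p q" for p q
    using P dim_chart_incidence[OF bc(2)] unfolding u bc schubert_cell_def by simp
  have "c $ j $ i = (Finite_Cartesian_Product.mat 1 :: ('k, 'n) square_matrix) $ j $ i" for i j
    using slice_column_vanishes[OF bc(3), of i j] bc(3)
    by (cases "j = i") (auto simp: dim Finite_Cartesian_Product.mat_def pattern_matrices_iff)
  then have "c = Finite_Cartesian_Product.mat 1" by (simp add: cart_eq_iff)
  then show "P \<in> chart ` pattern_matrices (cell_pattern v)" using bc u by simp
qed

lemma schubert_variety_in_chart:
  "chart ` lower_unitriangular \<inter> schubert_variety V w =
     chart ` {b ** c | b c. b \<in> pattern_matrices (cell_pattern v) \<and> c \<in> slice_schubert v w}"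
proof (intro equalityI subsetI)
  fix P assume P: "P \<in> chart ` lower_unitriangular \<inter> schubert_variety V w"
  then obtain u where u: "u \<in> lower_unitriangular" "P = chart u" by blast
  obtain b c where bc: "u = b ** c" "b \<in> pattern_matrices (cell_pattern v)" "c \<in> pattern_matrices (slice_pattern v)"
    using chart_factor[OF u(1)] .
  have "c \<in> lower_unitriangular" using bc slice_pattern_lower by blast
  then have "c \<in> slice_schubert v w"
    using P bc(3) dim_chart_incidence[OF bc(2)] unfolding u bc schubert_variety_def slice_schubert_def by simp
  then show "P \<in> chart ` {b ** c | b c. b \<in> pattern_matrices (cell_pattern v) \<and> c \<in> slice_schubert v w}"
    using u bc by blast
next
  fix P assume "P \<in> chart ` {b ** c | b c. b \<in> pattern_matrices (cell_pattern v) \<and> c \<in> slice_schubert v w}"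
  then obtain b c where bc: "P = chart (b ** c)" "b \<in> pattern_matrices (cell_pattern v)" "c \<in> slice_schubert v w"
    by blast
  have c: "c \<in> lower_unitriangular" using bc slice_pattern_lower unfolding slice_schubert_def by blast
  have "b ** c \<in> lower_unitriangular"
    using bc(2) cell_pattern_lower c by (intro lower_unitriangular_product) blast+
  then show "P \<in> chart ` lower_unitriangular \<inter> schubert_variety V w"
    using bc chart_complete dim_chart_incidence[OF bc(2) c]
    unfolding schubert_variety_def slice_schubert_def by auto
qed

lemma cell_isomorphism:
  "isomorphic_spaces (subspace_of flag_variety (schubert_cell V v))
     (coordinate_space (pattern_matrices (cell_pattern v)) matrix_entries)"
  unfolding schubert_cell_eq by (rule chart_isomorphism[OF cell_pattern_lower])

lemma cell_is_affine_space:
  "isomorphic_spaces (subspace_of flag_variety (schubert_cell V v))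
     (affine_space (inversions v) :: (nat \<Rightarrow> 'k, 'k) space_with_functions)"
proof -
  have "cell_pattern v = prod.swap ` {(i, j). i < j \<and> v j < v i}"
    unfolding cell_pattern_def by auto
  then have "card (cell_pattern v) = inversions v"
    unfolding inversions_def by (simp add: card_image)
  moreover have "isomorphic_spaces (coordinate_space (pattern_matrices (cell_pattern v) :: ('k, 'n) square_matrix set) matrix_entries)
     (affine_space (card (cell_pattern v)))"
    by (rule pattern_matrices_affine) (simp add: cell_pattern_def)
  ultimately show ?thesis using isomorphic_spaces_trans[OF cell_isomorphism] by simp
qed

text \<open>The same chart contains the whole cell and serves for all its points, so the local
  statement reduces to one isomorphism between the cone and the slice.\<close>

theorem locally_cell_timesI:
  fixes C :: "('p, 'k) space_with_functions"
  assumes C: "isomorphic_spaces C (coordinate_space (slice_schubert v w :: ('k, 'n) square_matrix set) matrix_entries)"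
  shows "locally_cell_times V w v C"
  unfolding locally_cell_times_def
proof
  fix P assume P: "P \<in> schubert_cell V v"
  let ?U = "chart ` lower_unitriangular"
  let ?B = "pattern_matrices (cell_pattern v) :: ('k, 'n) square_matrix set"
  let ?S = "slice_schubert v w :: ('k, 'n) square_matrix set"
  let ?BS = "{b ** c | b c. b \<in> ?B \<and> c \<in> ?S}"
  have S: "?S \<subseteq> pattern_matrices (slice_pattern v)" unfolding slice_schubert_def by blast
  have BS: "?BS \<subseteq> lower_unitriangular"
    using S slice_pattern_lower cell_pattern_lower lower_unitriangular_product by blast
  have "isomorphic_spaces (coordinate_space (lower_unitriangular :: ('k, 'n) square_matrix set) matrix_entries)
      (affine_space (card {(j :: 'n, i). i < j}))"
    unfolding lower_unitriangular_pattern by (rule pattern_matrices_affine) simp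
  then have "is_affine_variety (subspace_of flag_variety ?U)"
    using chart_isomorphism[OF order_refl] isomorphic_spaces_trans affine_space_is_affine_variety by blast
  moreover have "isomorphic_spaces (subspace_of flag_variety (?U \<inter> schubert_variety V w))
       (product_space (subspace_of flag_variety (schubert_cell V v)) C)"
  proof -
    have "isomorphic_spaces (subspace_of flag_variety (?U \<inter> schubert_variety V w)) (coordinate_space ?BS matrix_entries)"
      unfolding schubert_variety_in_chart by (rule chart_isomorphism[OF BS])
    also have "isomorphic_spaces \<dots> (coordinate_space (?B \<times> ?S) (product_coordinates matrix_entries matrix_entries))"
      by (rule factorization_isomorphism[OF S])
    also have "isomorphic_spaces \<dots> (product_space (coordinate_space ?B matrix_entries) (coordinate_space ?S matrix_entries))"
      by (rule isomorphic_spaces_sym[OF product_of_coordinate_spaces])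
    also have "isomorphic_spaces \<dots> (product_space (subspace_of flag_variety (schubert_cell V v)) C)"
      by (intro isomorphic_spaces_sym[OF isomorphic_product_spaces] cell_isomorphism C reg_one_coordinate_space)
    finally show ?thesis .
  qed
  ultimately show "\<exists>U. openin (top_of flag_variety) U \<and> P \<in> U \<and> is_affine_variety (subspace_of flag_variety U) \<and>
     isomorphic_spaces (subspace_of flag_variety (U \<inter> schubert_variety V w))
       (product_space (subspace_of flag_variety (schubert_cell V v)) C)"
    using chart_open schubert_cell_in_chart[OF P] by blast
qed

end

section \<open>Rank conditions on the slice\<close>

lemma singular_two_by_two:
  fixes \<alpha> \<beta> \<gamma> \<delta> x y :: "'k::field"
  assumes "\<alpha> * x + \<beta> * y = 0" "\<gamma> * x + \<delta> * y = 0" "x \<noteq> 0 \<or> y \<noteq> 0"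
  shows "\<alpha> * \<delta> = \<beta> * \<gamma>"
proof -
  have "(\<alpha> * \<delta> - \<beta> * \<gamma>) * x = \<delta> * (\<alpha> * x + \<beta> * y) - \<beta> * (\<gamma> * x + \<delta> * y)"
    "(\<alpha> * \<delta> - \<beta> * \<gamma>) * y = \<alpha> * (\<gamma> * x + \<delta> * y) - \<gamma> * (\<alpha> * x + \<beta> * y)"
    by (simp_all add: algebra_simps)
  then show ?thesis using assms by auto
qed

text \<open>The projection of \<open>K\<close> to the coordinates in \<open>B\<close> hits all basis
  vectors of \<open>coord_subspace B\<close>.\<close>

lemma dim_ge_coordinates:
  fixes K :: "('k::field ^ 'n::finite) set"
  assumes K: "vec.subspace K"
    and B: "\<And>a. a \<in> B \<Longrightarrow> \<exists>x\<in>K. x $ a = 1 \<and> (\<forall>a'\<in>B. a' \<noteq> a \<longrightarrow> x $ a' = 0)"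
  shows "card B \<le> vec.dim K"
proof -
  define E :: "'k ^ 'n ^ 'n" where "E = (\<chi> i j. if i = j \<and> i \<in> B then 1 else 0)"
  have E: "E *v x = (\<chi> i. if i \<in> B then x $ i else 0)" for x
    by (simp add: cart_eq_iff E_def matrix_vector_mult_def if_distrib[of "\<lambda>t. t * _"] cong: if_cong)
  have sub: "vec.subspace ((*v) E ` K)" by (intro vec.linear_subspace_image matrix_vector_mul_linear_gen K)
  have ax: "axis a 1 \<in> (*v) E ` K" if aB: "a \<in> B" for a
  proof -
    obtain x where x: "x \<in> K" "x $ a = 1" "\<forall>a'\<in>B. a' \<noteq> a \<longrightarrow> x $ a' = 0" using B[OF aB] by blast
    then have "axis a 1 = E *v x" using aB unfolding E by (auto simp: cart_eq_iff axis_def)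
    then show ?thesis using x by blast
  qed
  have "y \<in> (*v) E ` K" if y: "y \<in> coord_subspace B" for y
  proof -
    have "y = (\<Sum>a\<in>B. y $ a *s axis a 1)"
      using y by (auto simp: cart_eq_iff axis_def coord_subspace_def if_distrib[of "\<lambda>t. _ * t"] cong: if_cong)
    also have "\<dots> \<in> (*v) E ` K" using ax sub by (intro vec.subspace_sum vec.subspace_scale) auto
    finally show ?thesis .
  qed
  then have "vec.dim (coord_subspace B :: ('k ^ 'n) set) \<le> vec.dim ((*v) E ` K)" by (intro vec.dim_subset) blast
  also have "\<dots> \<le> vec.dim K" by (intro vec.dim_image_le matrix_vector_mul_linear_gen)
  finally show ?thesis by (simp add: dim_coord_subspace)
qed

text \<open>The Schur complement of the pivots in the block with columns up to \<open>p\<close> and rows \<open>j\<close> with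
  \<open>q < v j\<close>, provided that no product of three off-diagonal entries contributes.\<close>

definition residual ::
  "('n \<Rightarrow> 'n) \<Rightarrow> ('k::field, 'n::{finite,linorder}) square_matrix \<Rightarrow> 'n \<Rightarrow> 'n \<Rightarrow> 'n \<Rightarrow> 'n \<Rightarrow> 'k" where
  "residual v c p q j a = c $ j $ a - (\<Sum>t | t \<le> p \<and> q < v t. c $ j $ t * c $ t $ a)"

text \<open>The assumption \<open>short\<close> cuts off the Neumann series that inverts the pivot
  block, so that the Schur complement is quadratic in the entries.\<close>

locale short_slice =
  fixes v :: "'n::{finite,linorder} \<Rightarrow> 'n" and c :: "('k::field, 'n) square_matrix" and p q :: 'n
  assumes slice: "c \<in> pattern_matrices (slice_pattern v)"
    and short: "\<And>j s t i. j \<noteq> s \<Longrightarrow> s \<noteq> t \<Longrightarrow> t \<noteq> i \<Longrightarrow> c $ j $ s * c $ s $ t * c $ t $ i = 0"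
begin

abbreviation A where "A \<equiv> {a. a \<le> p \<and> v a \<le> q}"
abbreviation J where "J \<equiv> {j. p < j \<and> q < v j}"
abbreviation K where "K \<equiv> incidence_space v c p q"

definition M :: "('k, 'n) square_matrix" where "M = c - Finite_Cartesian_Product.mat 1"

text \<open>The projection to the coordinates that are eliminated: the columns up to
  \<open>p\<close> whose pivot row belongs to the rows required to vanish.\<close>

definition P :: "('k, 'n) Finite_Cartesian_Product.vec \<Rightarrow> ('k, 'n) Finite_Cartesian_Product.vec" where
  "P x = (\<chi> i. if i \<le> p \<and> q < v i then x $ i else 0)"

lemma lower: "c \<in> lower_unitriangular" using slice slice_pattern_lower by blast

lemma M_entry: "M $ j $ i = (if j = i then 0 else c $ j $ i)"
  using slice by (auto simp: M_def Finite_Cartesian_Product.mat_def pattern_matrices_iff)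

lemma c_mult: "c *v x = x + M *v x"
  by (simp add: M_def matrix_vector_mult_diff_rdistrib)

lemma P_linear: "P (x + y) = P x + P y" "P (- x) = - P x" "P (x - y) = P x - P y"
  by (simp_all add: P_def cart_eq_iff)

lemma MPM_entry: "(M *v P (M *v y)) $ j = (\<Sum>i\<in>UNIV. (\<Sum>t | t \<le> p \<and> q < v t. M $ j $ t * M $ t $ i) * y $ i)"
proof -
  have "(M *v P (M *v y)) $ j = (\<Sum>t\<in>UNIV. if t \<le> p \<and> q < v t then (\<Sum>i\<in>UNIV. M $ j $ t * M $ t $ i * y $ i) else 0)"
    unfolding matrix_vector_mult_def P_def
    by (auto simp: sum_distrib_left mult.assoc intro!: sum.cong)
  also have "\<dots> = (\<Sum>t | t \<le> p \<and> q < v t. \<Sum>i\<in>UNIV. M $ j $ t * M $ t $ i * y $ i)"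
    by (simp add: sum.If_cases Int_def)
  also have "\<dots> = (\<Sum>i\<in>UNIV. \<Sum>t | t \<le> p \<and> q < v t. M $ j $ t * M $ t $ i * y $ i)"
    by (rule sum.swap)
  finally show ?thesis by (simp add: sum_distrib_right)
qed

text \<open>Every term of the threefold product contains three consecutive off-diagonal
  entries.\<close>

lemma nilpotent: "M *v P (M *v P (M *v z)) = 0"
proof -
  have "(M *v P (M *v P (M *v z))) $ j = 0" for j
  proof -
    have "(\<Sum>t | t \<le> p \<and> q < v t. M $ j $ t * M $ t $ i) * P (M *v z) $ i = 0" for i
    proof -
      have "(M $ j $ t * M $ t $ i) * (M *v z) $ i = 0" for t
      proof -
        have "(M $ j $ t * M $ t $ i) * M $ i $ u = 0" for u using short by (simp add: M_entry)
        then have "(M $ j $ t * M $ t $ i) * (M $ i $ u * z $ u) = 0" for u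
          by (simp only: mult.assoc[symmetric] mult_zero_left)
        then show ?thesis unfolding matrix_vector_mult_def by (simp add: sum_distrib_left sum.neutral del: mult_eq_0_iff)
      qed
      then show ?thesis by (simp add: P_def sum_distrib_right del: mult_eq_0_iff)
    qed
    then show ?thesis unfolding MPM_entry by (simp add: sum.neutral del: mult_eq_0_iff)
  qed
  then show ?thesis by (simp add: cart_eq_iff)
qed

lemma residual_entry:
  assumes y: "y \<in> coord_subspace A" and j: "j \<in> J"
  shows "(M *v y - M *v P (M *v y)) $ j = (\<Sum>a\<in>A. residual v c p q j a * y $ a)"
proof -
  have "M $ j $ a - (\<Sum>t | t \<le> p \<and> q < v t. M $ j $ t * M $ t $ a) = residual v c p q j a" if "a \<in> A" for a
  proof -
    have "(\<Sum>t | t \<le> p \<and> q < v t. M $ j $ t * M $ t $ a) = (\<Sum>t | t \<le> p \<and> q < v t. c $ j $ t * c $ t $ a)"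
      using that j by (intro sum.cong refl) (auto simp: M_entry)
    moreover have "M $ j $ a = c $ j $ a" using that j by (auto simp: M_entry)
    ultimately show ?thesis by (simp add: residual_def)
  qed
  moreover have "(M *v y - M *v P (M *v y)) $ j =
      (\<Sum>a\<in>UNIV. (M $ j $ a - (\<Sum>t | t \<le> p \<and> q < v t. M $ j $ t * M $ t $ a)) * y $ a)"
    by (simp add: MPM_entry) (simp add: matrix_vector_mult_def sum_subtractf left_diff_distrib)
  moreover have "\<dots> = (\<Sum>a\<in>A. (M $ j $ a - (\<Sum>t | t \<le> p \<and> q < v t. M $ j $ t * M $ t $ a)) * y $ a)"
    using y by (intro sum.mono_neutral_right) (auto simp: coord_subspace_def)
  ultimately show ?thesis by simp
qed

text \<open>Write \<open>x = y + z\<close> with \<open>y\<close> on the block and \<open>z\<close>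
  on the eliminated coordinates. The eliminated rows say \<open>z = - P (M *v x)\<close>;
  substituting this twice and using \<open>nilpotent\<close> gives
  \<open>M *v z = - (M *v P (M *v y))\<close>.\<close>

lemma incidence_residual:
  assumes x: "x \<in> K" and j: "j \<in> J"
  shows "(\<Sum>a\<in>A. residual v c p q j a * x $ a) = 0"
proof -
  define y where "y = (\<chi> i. if i \<in> A then x $ i else 0)"
  have cx: "(c *v x) $ i = 0" if "q < v i" for i
    using x that by (auto simp: incidence_space_def coord_subspace_def)
  have xp: "x $ i = 0" if "\<not> i \<le> p" for i using x that by (auto simp: incidence_space_def coord_subspace_def)
  define z where "z = P x"
  have xyz: "x = y + z" using xp by (auto simp: cart_eq_iff y_def z_def P_def not_le)
  have "z = P (- (M *v x))"
    unfolding z_def P_def cart_eq_iff using cx c_mult[of x] by (auto simp: eq_neg_iff_add_eq_0)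
  then have "z = - P (M *v y) - P (M *v z)"
    unfolding xyz by (simp add: P_linear vec.add)
  then have Mz: "M *v z = - (M *v P (M *v y)) - M *v P (M *v z)"
    by (metis vec.diff vec.neg)
  have "P (M *v z) = - P (M *v P (M *v y)) - P (M *v P (M *v z))"
    by (subst Mz) (simp add: P_linear)
  then have "M *v P (M *v z) = - (M *v P (M *v P (M *v y))) - M *v P (M *v P (M *v z))"
    by (metis vec.diff vec.neg)
  then have "M *v z = - (M *v P (M *v y))" using Mz by (simp add: nilpotent)
  then have "M *v x = M *v y - M *v P (M *v y)" unfolding xyz by (simp only: vec.add) simp
  then have "(c *v x) $ j = x $ j + (M *v y - M *v P (M *v y)) $ j"
    using c_mult[of x] by (simp only: vector_add_component)
  moreover have "(c *v x) $ j = 0" "x $ j = 0" using cx xp j by auto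
  ultimately have "(M *v y - M *v P (M *v y)) $ j = 0" by simp
  moreover have "y \<in> coord_subspace A" by (simp add: y_def coord_subspace_def)
  ultimately have "(\<Sum>a\<in>A. residual v c p q j a * y $ a) = 0" using residual_entry[of y, OF _ j] by metis
  then show ?thesis by (simp add: y_def)
qed

text \<open>The eliminated coordinates are recovered by the truncated Neumann series; the remaining
  rows vanish precisely by the residual equations.\<close>

lemma incidence_lift:
  assumes y: "y \<in> coord_subspace A"
    and R: "\<And>j. j \<in> J \<Longrightarrow> (\<Sum>a\<in>A. residual v c p q j a * y $ a) = 0"
  obtains x where "x \<in> K" "\<And>a. a \<in> A \<Longrightarrow> x $ a = y $ a"
proof -
  define x where "x = y - P (M *v y) + P (M *v P (M *v y))"
  have "M *v x = M *v y - M *v P (M *v y)"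
    unfolding x_def by (simp add: vec.add vec.diff nilpotent)
  then have cx: "(c *v x) = y - P (M *v y) + P (M *v P (M *v y)) + (M *v y - M *v P (M *v y))"
    using c_mult[of x] by (simp add: x_def)
  have yz: "y $ i = 0" if "\<not> (i \<le> p \<and> v i \<le> q)" for i using y that by (auto simp: coord_subspace_def)
  have "(c *v x) $ i = 0" if i: "q < v i" for i
  proof (cases "i \<le> p")
    case True
    then show ?thesis unfolding cx using yz[of i] i by (simp add: P_def)
  next
    case False
    then have "i \<in> J" using i by auto
    then have "(M *v y - M *v P (M *v y)) $ i = 0" using residual_entry[OF y] R by simp
    then show ?thesis unfolding cx using yz[of i] False by (simp add: P_def)
  qed
  moreover have "x $ i = 0" if "\<not> i \<le> p" for i
    unfolding x_def using yz[of i] that by (simp add: P_def)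
  ultimately have "x \<in> K" unfolding incidence_space_def coord_subspace_def by (auto simp: not_le)
  moreover have "x $ a = y $ a" if "a \<in> A" for a using that by (auto simp: x_def P_def)
  ultimately show ?thesis using that by blast
qed

text \<open>Full dimension provides a vector of \<open>K\<close> whose only nonzero coordinate in
  the block is at \<open>a\<close>, and its residual equation isolates one entry.\<close>

lemma residual_zero:
  assumes dim: "rank_function v p q \<le> vec.dim K" and "j \<in> J" and a: "a \<in> A"
  shows "residual v c p q j a = 0"
proof -
  have "card (A - {a}) < card A" using a by (intro psubset_card_mono) auto
  then have "card (A - {a}) < vec.dim K" using dim unfolding rank_function_def by linarith
  then obtain x where x: "x \<in> K" "x \<noteq> 0" "\<And>i. i \<in> A - {a} \<Longrightarrow> x $ i = 0"
    using subspace_vanishing_vector[OF subspace_incidence_space] by blast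
  have "x $ a \<noteq> 0"
  proof
    assume "x $ a = 0"
    then have "x = 0" using x(3) by (intro incidence_space_determined[OF lower x(1)]) auto
    then show False using x by simp
  qed
  moreover have "(\<Sum>i\<in>A. residual v c p q j i * x $ i) = (\<Sum>i\<in>{a}. residual v c p q j i * x $ i)"
    using a x(3) by (intro sum.mono_neutral_right) auto
  ultimately show ?thesis using incidence_residual[OF x(1) \<open>j \<in> J\<close>] by simp
qed

text \<open>With dimension one less, two coordinates \<open>a\<close>, \<open>a'\<close> may
  survive. They give the same nontrivial relation between two columns in all rows, so the minor
  vanishes.\<close>

lemma residual_minor:
  assumes dim: "rank_function v p q \<le> vec.dim K + 1" and j: "j \<in> J" "j' \<in> J"
    and a: "a \<in> A" "a' \<in> A"
  shows "residual v c p q j a * residual v c p q j' a' = residual v c p q j a' * residual v c p q j' a"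
proof (cases "a = a'")
  case False
  have "card (A - {a, a'}) + 2 = card A"
    using a False card_Diff_subset[of "{a, a'}" A] card_mono[of A "{a, a'}"] by simp
  then have "card (A - {a, a'}) < vec.dim K" using dim unfolding rank_function_def by linarith
  then obtain x where x: "x \<in> K" "x \<noteq> 0" "\<And>i. i \<in> A - {a, a'} \<Longrightarrow> x $ i = 0"
    using subspace_vanishing_vector[OF subspace_incidence_space] by blast
  have nz: "x $ a \<noteq> 0 \<or> x $ a' \<noteq> 0"
  proof (rule ccontr)
    assume "\<not> (x $ a \<noteq> 0 \<or> x $ a' \<noteq> 0)"
    then have "x = 0" using x(3) by (intro incidence_space_determined[OF lower x(1)]) auto
    then show False using x by simp
  qed
  have rel: "residual v c p q r a * x $ a + residual v c p q r a' * x $ a' = 0" if "r \<in> J" for r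
  proof -
    have "(\<Sum>i\<in>A. residual v c p q r i * x $ i) = (\<Sum>i\<in>{a, a'}. residual v c p q r i * x $ i)"
      using a x(3) by (intro sum.mono_neutral_right) auto
    then show ?thesis using incidence_residual[OF x(1) that] False by simp
  qed
  show ?thesis using rel[OF j(1)] rel[OF j(2)] nz by (rule singular_two_by_two)
qed simp

lemma dim_ge_of_residual_zero:
  assumes "\<And>j a. j \<in> J \<Longrightarrow> a \<in> A \<Longrightarrow> residual v c p q j a = 0"
  shows "rank_function v p q \<le> vec.dim K"
  unfolding rank_function_def
proof (rule dim_ge_coordinates[OF subspace_incidence_space])
  fix a assume a: "a \<in> A"
  have "axis a 1 \<in> coord_subspace A" using a by (auto simp: coord_subspace_def axis_def)
  then obtain x where "x \<in> K" "\<And>i. i \<in> A \<Longrightarrow> x $ i = axis a 1 $ i"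
    by (rule incidence_lift) (use assms in auto)
  then show "\<exists>x\<in>K. x $ a = 1 \<and> (\<forall>a'\<in>A. a' \<noteq> a \<longrightarrow> x $ a' = 0)"
    using a by (intro bexI[of _ x]) (auto simp: axis_def)
qed

lemma dim_ge_of_residual_minor:
  assumes minor: "\<And>j j' a a'. j \<in> J \<Longrightarrow> j' \<in> J \<Longrightarrow> a \<in> A \<Longrightarrow> a' \<in> A \<Longrightarrow>
    residual v c p q j a * residual v c p q j' a' = residual v c p q j a' * residual v c p q j' a"
  shows "rank_function v p q \<le> vec.dim K + 1"
proof (cases "\<forall>j\<in>J. \<forall>a\<in>A. residual v c p q j a = 0")
  case True
  then show ?thesis using dim_ge_of_residual_zero by (simp add: le_SucI)
next
  case False
  then obtain j0 a0 where 0: "j0 \<in> J" "a0 \<in> A" "residual v c p q j0 a0 \<noteq> 0" by blast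
  let ?r = "residual v c p q"
  have "card (A - {a0}) \<le> vec.dim K"
  proof (rule dim_ge_coordinates[OF subspace_incidence_space])
    fix a assume a: "a \<in> A - {a0}"
    \<comment> \<open>The relation between columns \<open>a\<close> and \<open>a0\<close> read off
      from row \<open>j0\<close>; vanishing minors propagate it to all rows.\<close>
    define y where "y = (\<chi> i. if i = a then 1 else if i = a0 then - (?r j0 a / ?r j0 a0) else 0)"
    have yA: "y \<in> coord_subspace A" using a 0 by (auto simp: coord_subspace_def y_def)
    have "(\<Sum>i\<in>A. ?r j i * y $ i) = 0" if j: "j \<in> J" for j
    proof -
      have ne: "a \<noteq> a0" using a by blast
      have "(\<Sum>i\<in>A. ?r j i * y $ i) = (\<Sum>i\<in>{a, a0}. ?r j i * y $ i)"
        using a 0 by (intro sum.mono_neutral_right) (auto simp: y_def)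
      also have "\<dots> = ?r j a - ?r j a0 * (?r j0 a / ?r j0 a0)" using ne by (simp add: y_def)
      also have "\<dots> = 0" using minor[OF j 0(1), of a a0] a 0 by (simp add: field_simps)
      finally show ?thesis .
    qed
    from incidence_lift[OF yA this] obtain x where "x \<in> K" "\<And>i. i \<in> A \<Longrightarrow> x $ i = y $ i" by blast
    then show "\<exists>x\<in>K. x $ a = 1 \<and> (\<forall>a'\<in>A - {a0}. a' \<noteq> a \<longrightarrow> x $ a' = 0)"
      using a by (intro bexI[of _ x]) (auto simp: y_def)
  qed
  then show ?thesis unfolding rank_function_def using 0(2) by simp
qed

end

section \<open>Configurations\<close>

text \<open>The bounds are strict, so \<open>P\<close> and \<open>Q\<close> are numbers of positions
  and values, and 0 stands for an empty block.\<close>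

definition one_line_rank :: "(nat \<Rightarrow> nat) \<Rightarrow> nat \<Rightarrow> nat \<Rightarrow> nat" where
  "one_line_rank f P Q = card {a. a < P \<and> f a < Q}"

text \<open>Unlike in \<open>minimal_configuration\<close>, the values of \<open>om\<close> and \<open>nu\<close> are counted from 0.  Paths of three
  off-diagonal entries are excluded by \<open>no_long_chain\<close>, so that Schur complements are quadratic.\<close>

locale configuration =
  fixes v w :: "'n::{finite,linorder} \<Rightarrow> 'n" and N :: nat and x y :: "nat \<Rightarrow> 'n" and om nu :: "nat \<Rightarrow> nat"
  assumes bij_v: "bij v" and bij_w: "bij w"
    and x_less: "\<And>a b. a < b \<Longrightarrow> b < N \<Longrightarrow> x a < x b"
    and y_less: "\<And>a b. a < b \<Longrightarrow> b < N \<Longrightarrow> y a < y b"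
    and om_less: "\<And>a. a < N \<Longrightarrow> om a < N" and nu_less: "\<And>a. a < N \<Longrightarrow> nu a < N"
    and w_x: "\<And>a. a < N \<Longrightarrow> w (x a) = y (om a)" and v_x: "\<And>a. a < N \<Longrightarrow> v (x a) = y (nu a)"
    and outside: "\<And>i. i \<notin> x ` {..<N} \<Longrightarrow> v i = w i"
    and minimal: "\<And>i. i \<notin> x ` {..<N} \<Longrightarrow> \<not> rank_function v i (w i) > rank_function w i (w i)"
    and no_long_chain: "\<And>a b d e. a < b \<Longrightarrow> b < d \<Longrightarrow> d < e \<Longrightarrow> e < N \<Longrightarrow>
      nu a < nu b \<Longrightarrow> nu b < nu d \<Longrightarrow> nu d < nu e \<Longrightarrow> False"
begin

abbreviation X where "X \<equiv> x ` {..<N}"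

lemma x_less_iff: "a < N \<Longrightarrow> b < N \<Longrightarrow> x a < x b \<longleftrightarrow> a < b"
  using x_less by (metis less_asym less_linear)

lemma y_less_iff: "a < N \<Longrightarrow> b < N \<Longrightarrow> y a < y b \<longleftrightarrow> a < b"
  using y_less by (metis less_asym less_linear)

lemma x_eq_iff: "a < N \<Longrightarrow> b < N \<Longrightarrow> x a = x b \<longleftrightarrow> a = b"
  by (metis x_less_iff less_irrefl less_linear)

lemma inj_on_x: "inj_on x {..<N}"
  by (auto simp: inj_on_def x_eq_iff)

definition config_supported :: "('k::field, 'n) square_matrix \<Rightarrow> bool" where
  "config_supported c \<longleftrightarrow> (\<forall>j i. j \<noteq> i \<longrightarrow> j \<notin> X \<or> i \<notin> X \<longrightarrow> c $ j $ i = 0)"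

definition entry :: "('k::field, 'n) square_matrix \<Rightarrow> nat \<Rightarrow> nat \<Rightarrow> 'k" where
  "entry c b a = c $ x b $ x a"

definition config_matrix :: "(nat \<Rightarrow> nat \<Rightarrow> 'k) \<Rightarrow> ('k::field, 'n) square_matrix" where
  "config_matrix f = (\<chi> j i. if j = i then 1
     else if j \<in> X \<and> i \<in> X then f (inv_into {..<N} x j) (inv_into {..<N} x i) else 0)"

lemma entry_config_matrix:
  "a < N \<Longrightarrow> b < N \<Longrightarrow> entry (config_matrix f) b a = (if a = b then 1 else f b a)"
  by (auto simp: entry_def config_matrix_def x_eq_iff inj_on_x)

lemma config_matrix_entry:
  assumes "c \<in> pattern_matrices I" "config_supported c"
    and "\<And>a b. a < N \<Longrightarrow> b < N \<Longrightarrow> a \<noteq> b \<Longrightarrow> f b a = entry c b a"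
  shows "config_matrix f = c"
  unfolding cart_eq_iff
proof (intro allI)
  fix j i
  show "config_matrix f $ j $ i = c $ j $ i"
  proof (cases "j = i \<or> j \<notin> X \<or> i \<notin> X")
    case True
    then show ?thesis using assms(1,2)
      unfolding config_matrix_def config_supported_def pattern_matrices_iff by (cases "j = i") auto
  next
    case False
    then obtain a b where ab: "a < N" "b < N" "j = x b" "i = x a" by auto
    then show ?thesis using False assms(3)[of a b] entry_config_matrix[of a b f] by (auto simp: entry_def)
  qed
qed

lemma config_matrix_slice:
  assumes "\<And>a b. a < N \<Longrightarrow> b < N \<Longrightarrow> a \<noteq> b \<Longrightarrow> f b a \<noteq> 0 \<Longrightarrow> a < b \<and> nu a < nu b"
  shows "config_matrix f \<in> pattern_matrices (slice_pattern v)" "config_supported (config_matrix f)"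
proof -
  show "config_supported (config_matrix f)" by (auto simp: config_supported_def config_matrix_def)
  show "config_matrix f \<in> pattern_matrices (slice_pattern v)"
    unfolding pattern_matrices_iff
  proof (intro conjI allI impI)
    show "config_matrix f $ j $ j = 1" for j by (simp add: config_matrix_def)
    fix j i assume ji: "j \<noteq> i" "(j, i) \<notin> slice_pattern v"
    show "config_matrix f $ j $ i = 0"
    proof (cases "j \<in> X \<and> i \<in> X")
      case True
      then obtain a b where ab: "a < N" "b < N" "j = x b" "i = x a" by auto
      then have "\<not> (a < b \<and> nu a < nu b)"
        using ji(2) by (auto simp: slice_pattern_def x_less_iff v_x y_less_iff nu_less)
      then have "f b a = 0" using assms[of a b] ab ji(1) by auto
      then show ?thesis using entry_config_matrix[of a b f] ab ji(1) by (auto simp: entry_def)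
    qed (use ji in \<open>auto simp: config_matrix_def\<close>)
  qed
qed

lemma slice_entry_support:
  assumes "c \<in> pattern_matrices (slice_pattern v)" "a < N" "b < N" "a \<noteq> b" "entry c b a \<noteq> 0"
  shows "a < b \<and> nu a < nu b"
  using pattern_matrices_support[OF assms(1), of "x b" "x a"] assms
  by (auto simp: entry_def slice_pattern_def x_less_iff x_eq_iff v_x y_less_iff nu_less)

text \<open>Passing from the box just before \<open>(j, u j)\<close> to the box at it adds only the
  point itself. This carries minimality, which is given at points of the diagram, to the box needed
  for rows.\<close>

lemma rank_before:
  fixes u :: "'n \<Rightarrow> 'n"
  assumes "inj u" "\<And>i. i \<le> p \<longleftrightarrow> i < j" "\<And>r. r \<le> q \<longleftrightarrow> r < u j"
  shows "rank_function u j (u j) = Suc (rank_function u p q)"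
proof -
  have "{i. i \<le> j \<and> u i \<le> u j} = insert j {i. i \<le> p \<and> u i \<le> q}"
    using assms by (auto simp: order_le_less dest: injD)
  moreover have "j \<notin> {i. i \<le> p \<and> u i \<le> q}" using assms(2)[of j] by simp
  ultimately show ?thesis unfolding rank_function_def by simp
qed

text \<open>Minimality at a point outside the configuration says that the rank of \<open>v\<close>
  does not exceed that of \<open>w\<close> there. Columns use the point itself, rows the box just
  before it.\<close>

lemma slice_schubert_supported:
  assumes c: "c \<in> slice_schubert v w"
  shows "config_supported c"
  unfolding config_supported_def
proof (intro allI impI)
  fix j i :: 'n assume ne: "j \<noteq> i" and "j \<notin> X \<or> i \<notin> X"
  have s: "c \<in> pattern_matrices (slice_pattern v)"
    and dim: "rank_function w p q \<le> vec.dim (incidence_space v c p q)" for p q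
    using c by (auto simp: slice_schubert_def)
  from \<open>j \<notin> X \<or> i \<notin> X\<close> show "c $ j $ i = 0"
  proof
    assume "i \<notin> X"
    then have "rank_function v i (v i) \<le> rank_function w i (v i)"
      using minimal[of i] outside[of i] by simp
    then show ?thesis using slice_column_vanishes[OF s order_trans[OF _ dim] ne] by blast
  next
    assume j: "j \<notin> X"
    show ?thesis
    proof (rule slice_row_vanishes[OF s bij_is_inj[OF bij_v]])
      fix p q assume pq: "\<And>i. i \<le> p \<longleftrightarrow> i < j" "\<And>r. r \<le> q \<longleftrightarrow> r < v j"
      have "rank_function v j (v j) \<le> rank_function w j (v j)"
        using minimal[OF j] outside[OF j] by simp
      then have "rank_function v p q \<le> rank_function w p q"
        using rank_before[OF bij_is_inj[OF bij_v] pq] rank_before[OF bij_is_inj[OF bij_w], of p j q] pq outside[OF j]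
        by simp
      then show "rank_function v p q \<le> vec.dim (incidence_space v c p q)" using dim order_trans by blast
    qed (use ne in simp)
  qed
qed

text \<open>Three consecutive nonzero off-diagonal entries would produce an increasing chain of four
  in \<open>nu\<close>.\<close>

lemma config_short:
  assumes s: "c \<in> pattern_matrices (slice_pattern v)" and "config_supported c"
  shows "short_slice v c"
proof
  show "c \<in> pattern_matrices (slice_pattern v)" by (rule s)
  fix j s' t i :: 'n assume ne: "j \<noteq> s'" "s' \<noteq> t" "t \<noteq> i"
  show "c $ j $ s' * c $ s' $ t * c $ t $ i = 0"
  proof (rule ccontr)
    assume "c $ j $ s' * c $ s' $ t * c $ t $ i \<noteq> 0"
    then have nz: "c $ j $ s' \<noteq> 0" "c $ s' $ t \<noteq> 0" "c $ t $ i \<noteq> 0" by auto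
    then have "j \<in> X" "s' \<in> X" "t \<in> X" "i \<in> X"
      using assms(2) ne unfolding config_supported_def by metis+
    then obtain a b d e where abde: "a < N" "b < N" "d < N" "e < N" "i = x a" "t = x b" "s' = x d" "j = x e" by auto
    then have "a < b \<and> nu a < nu b" "b < d \<and> nu b < nu d" "d < e \<and> nu d < nu e"
      using slice_entry_support[OF s, of a b] slice_entry_support[OF s, of b d] slice_entry_support[OF s, of d e] nz ne
      by (auto simp: entry_def)
    then show False using no_long_chain abde by blast
  qed
qed

section \<open>Rank conditions in terms of the one-line notation\<close>

definition config_residual :: "('k::field, 'n) square_matrix \<Rightarrow> nat \<Rightarrow> nat \<Rightarrow> nat \<Rightarrow> nat \<Rightarrow> 'k" where
  "config_residual c P Q b a = entry c b a - (\<Sum>t | t < P \<and> Q \<le> nu t. entry c b t * entry c t a)"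

text \<open>Pivots outside the configuration drop out, because an off-diagonal entry of
  \<open>c\<close> in such a column is zero.\<close>

lemma residual_config:
  assumes s: "config_supported c" and "P \<le> N"
    and p: "\<And>a. a < N \<Longrightarrow> x a \<le> p \<longleftrightarrow> a < P" and q: "\<And>a. a < N \<Longrightarrow> y a \<le> q \<longleftrightarrow> a < Q"
    and b: "b < N" "a < N"
  shows "residual v c p q (x b) (x a) = config_residual c P Q b a"
proof -
  have "(\<Sum>t | t \<le> p \<and> q < v t. c $ x b $ t * c $ t $ x a) = (\<Sum>t\<in>x ` {t. t < P \<and> Q \<le> nu t}. c $ x b $ t * c $ t $ x a)"
  proof (rule sum.mono_neutral_right)
    show "x ` {t. t < P \<and> Q \<le> nu t} \<subseteq> {t. t \<le> p \<and> q < v t}"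
      using assms(2) p q nu_less by (auto simp: v_x not_le[symmetric])
    show "\<forall>t\<in>{t. t \<le> p \<and> q < v t} - x ` {t. t < P \<and> Q \<le> nu t}. c $ x b $ t * c $ t $ x a = 0"
    proof
      fix t assume t: "t \<in> {t. t \<le> p \<and> q < v t} - x ` {t. t < P \<and> Q \<le> nu t}"
      have "t \<notin> X"
      proof
        assume "t \<in> X"
        then obtain t' where t': "t' < N" "t = x t'" by auto
        then have "t' < P" "Q \<le> nu t'" using t p q nu_less by (auto simp: v_x not_le[symmetric])
        then show False using t t' by blast
      qed
      moreover have "x b \<noteq> t" using \<open>t \<notin> X\<close> b by auto
      ultimately show "c $ x b $ t * c $ t $ x a = 0" using s unfolding config_supported_def by simp
    qed
  qed simp
  also have "\<dots> = (\<Sum>t | t < P \<and> Q \<le> nu t. entry c b t * entry c t a)"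
    using assms(2) by (subst sum.reindex) (auto simp: entry_def intro: inj_on_subset[OF inj_on_x])
  finally show ?thesis by (simp add: residual_def config_residual_def entry_def)
qed

text \<open>Points outside the configuration are common to \<open>v\<close> and \<open>w\<close>, so
  the difference of the ranks is that of the one-line notations.\<close>

lemma rank_function_config:
  assumes "P \<le> N" and p: "\<And>a. a < N \<Longrightarrow> x a \<le> p \<longleftrightarrow> a < P" and q: "\<And>a. a < N \<Longrightarrow> y a \<le> q \<longleftrightarrow> a < Q"
  shows "rank_function v p q = card {i. i \<notin> X \<and> i \<le> p \<and> w i \<le> q} + one_line_rank nu P Q"
    and "rank_function w p q = card {i. i \<notin> X \<and> i \<le> p \<and> w i \<le> q} + one_line_rank om P Q"
proof -
  have *: "card {i. i \<le> p \<and> u i \<le> q} = card {i. i \<notin> X \<and> i \<le> p \<and> w i \<le> q} + one_line_rank f P Q"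
    if u: "\<And>a. a < N \<Longrightarrow> u (x a) = y (f a)" "\<And>a. a < N \<Longrightarrow> f a < N" "\<And>i. i \<notin> X \<Longrightarrow> u i = w i" for u f
  proof -
    have "{i. i \<le> p \<and> u i \<le> q} = {i. i \<notin> X \<and> i \<le> p \<and> w i \<le> q} \<union> x ` {a. a < P \<and> f a < Q}" (is "?L = ?R")
    proof (intro equalityI subsetI)
      fix i assume i: "i \<in> ?L"
      show "i \<in> ?R"
      proof (cases "i \<in> X")
        case True
        then obtain a where "a < N" "i = x a" by auto
        then show ?thesis using i p q u by auto
      qed (use i u in auto)
    qed (use u p q assms(1) in auto)
    moreover have "card (x ` {a. a < P \<and> f a < Q}) = one_line_rank f P Q"
      unfolding one_line_rank_def using assms(1) by (intro card_image inj_on_subset[OF inj_on_x]) auto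
    moreover have "{i. i \<notin> X \<and> i \<le> p \<and> w i \<le> q} \<inter> x ` {a. a < P \<and> f a < Q} = {}" using assms(1) by auto
    ultimately show ?thesis by (simp add: card_Un_disjoint)
  qed
  show "rank_function v p q = card {i. i \<notin> X \<and> i \<le> p \<and> w i \<le> q} + one_line_rank nu P Q"
    unfolding rank_function_def by (rule *) (auto simp: v_x nu_less outside)
  show "rank_function w p q = card {i. i \<notin> X \<and> i \<le> p \<and> w i \<le> q} + one_line_rank om P Q"
    unfolding rank_function_def by (rule *) (auto simp: w_x om_less)
qed

text \<open>The last row and column counted by \<open>P\<close> and \<open>Q\<close> realize the
  box; positivity is needed for these indices to exist.\<close>

lemma config_position:
  assumes "0 < P" "P \<le> N" "0 < Q" "Q \<le> N"
  shows "\<And>a. a < N \<Longrightarrow> x a \<le> x (P - 1) \<longleftrightarrow> a < P" "\<And>a. a < N \<Longrightarrow> y a \<le> y (Q - 1) \<longleftrightarrow> a < Q"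
  using assms x_less_iff[of "P - 1"] y_less_iff[of "Q - 1"] by (auto simp: not_less[symmetric])

lemma config_in_block:
  assumes "0 < P" "P \<le> N" "0 < Q" "Q \<le> N"
  shows "a < P \<Longrightarrow> nu a < Q \<Longrightarrow> x a \<le> x (P - 1) \<and> v (x a) \<le> y (Q - 1)"
    and "P \<le> b \<Longrightarrow> b < N \<Longrightarrow> Q \<le> nu b \<Longrightarrow> x (P - 1) < x b \<and> y (Q - 1) < v (x b)"
proof -
  show "x a \<le> x (P - 1) \<and> v (x a) \<le> y (Q - 1)" if "a < P" "nu a < Q"
    using that config_position(1)[OF assms, of a] config_position(2)[OF assms, of "nu a"] assms(2) nu_less[of a]
    by (simp add: v_x)
  show "x (P - 1) < x b \<and> y (Q - 1) < v (x b)" if "P \<le> b" "b < N" "Q \<le> nu b"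
    using that config_position(1)[OF assms, of b] config_position(2)[OF assms, of "nu b"] nu_less[of b]
    by (metis v_x not_le)
qed

lemma slice_schubert_residual_zero:
  assumes c: "c \<in> slice_schubert v w"
    and PQ: "0 < P" "P \<le> N" "0 < Q" "Q \<le> N" and le: "one_line_rank nu P Q \<le> one_line_rank om P Q"
    and a: "a < P" "nu a < Q" and b: "P \<le> b" "b < N" "Q \<le> nu b"
  shows "config_residual c P Q b a = 0"
proof -
  have s: "c \<in> pattern_matrices (slice_pattern v)" using c by (auto simp: slice_schubert_def)
  note supp = slice_schubert_supported[OF c]
  interpret short_slice v c "x (P - 1)" "y (Q - 1)" by (rule config_short[OF s supp])
  have "rank_function v (x (P - 1)) (y (Q - 1)) \<le> rank_function w (x (P - 1)) (y (Q - 1))"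
    using rank_function_config[OF PQ(2) config_position[OF PQ]] le by simp
  then have "rank_function v (x (P - 1)) (y (Q - 1)) \<le> vec.dim K"
    using c order_trans unfolding slice_schubert_def by blast
  then have "residual v c (x (P - 1)) (y (Q - 1)) (x b) (x a) = 0"
    using config_in_block[OF PQ] a b by (intro residual_zero) auto
  then show ?thesis using residual_config[OF supp PQ(2) config_position[OF PQ], of b a] a b PQ by simp
qed

lemma slice_schubert_residual_minor:
  assumes c: "c \<in> slice_schubert v w"
    and PQ: "0 < P" "P \<le> N" "0 < Q" "Q \<le> N" and le: "one_line_rank nu P Q \<le> one_line_rank om P Q + 1"
    and a: "a < P" "nu a < Q" "a' < P" "nu a' < Q"
    and b: "P \<le> b" "b < N" "Q \<le> nu b" "P \<le> b'" "b' < N" "Q \<le> nu b'"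
  shows "config_residual c P Q b a * config_residual c P Q b' a' = config_residual c P Q b a' * config_residual c P Q b' a"
proof -
  have s: "c \<in> pattern_matrices (slice_pattern v)" using c by (auto simp: slice_schubert_def)
  note supp = slice_schubert_supported[OF c]
  interpret short_slice v c "x (P - 1)" "y (Q - 1)" by (rule config_short[OF s supp])
  let ?r = "residual v c (x (P - 1)) (y (Q - 1))"
  have "rank_function v (x (P - 1)) (y (Q - 1)) \<le> rank_function w (x (P - 1)) (y (Q - 1)) + 1"
    using rank_function_config[OF PQ(2) config_position[OF PQ]] le by simp
  moreover have "rank_function w (x (P - 1)) (y (Q - 1)) \<le> vec.dim K"
    using c unfolding slice_schubert_def by blast
  ultimately have "rank_function v (x (P - 1)) (y (Q - 1)) \<le> vec.dim K + 1" by linarith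
  then have "?r (x b) (x a) * ?r (x b') (x a') = ?r (x b) (x a') * ?r (x b') (x a)"
    using config_in_block[OF PQ] a b by (intro residual_minor) auto
  then show ?thesis using residual_config[OF supp PQ(2) config_position[OF PQ]] a b PQ by simp
qed

text \<open>Any \<open>p\<close> and \<open>q\<close> cut the configuration in some box
  \<open>(P, Q)\<close>, and outside the configuration residuals vanish. Two alternatives suffice:
  all residuals vanish, or all their minors vanish and the rank of \<open>w\<close> is smaller by at
  least one.\<close>

lemma slice_schubertI:
  assumes s: "c \<in> pattern_matrices (slice_pattern v)" and supp: "config_supported c"
    and cond: "\<And>P Q. P \<le> N \<Longrightarrow> Q \<le> N \<Longrightarrow>
      one_line_rank om P Q \<le> one_line_rank nu P Q \<and>
        (\<forall>a b. a < P \<longrightarrow> nu a < Q \<longrightarrow> P \<le> b \<longrightarrow> b < N \<longrightarrow> Q \<le> nu b \<longrightarrow> config_residual c P Q b a = 0) \<or>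
      one_line_rank om P Q + 1 \<le> one_line_rank nu P Q \<and>
        (\<forall>a a' b b'. a < P \<longrightarrow> nu a < Q \<longrightarrow> a' < P \<longrightarrow> nu a' < Q \<longrightarrow>
           P \<le> b \<longrightarrow> b < N \<longrightarrow> Q \<le> nu b \<longrightarrow> P \<le> b' \<longrightarrow> b' < N \<longrightarrow> Q \<le> nu b' \<longrightarrow>
           config_residual c P Q b a * config_residual c P Q b' a' =
           config_residual c P Q b a' * config_residual c P Q b' a)"
  shows "c \<in> slice_schubert v w"
  unfolding slice_schubert_def
proof (intro CollectI conjI allI s)
  fix p q
  interpret short_slice v c p q by (rule config_short[OF s supp])
  \<comment> \<open>The members of an increasing sequence bounded by \<open>r\<close> form an
    initial segment, possibly empty or full.\<close>
  have initial: "\<exists>P\<le>N. \<forall>a<N. z a \<le> r \<longleftrightarrow> a < P" if z: "\<And>a b. a < b \<Longrightarrow> b < N \<Longrightarrow> z a < z b" for z :: "nat \<Rightarrow> 'n" and r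
  proof (cases "\<exists>a<N. \<not> z a \<le> r")
    case True
    define P where "P = (LEAST a. a < N \<and> \<not> z a \<le> r)"
    have P: "P < N" "\<not> z P \<le> r" using LeastI_ex[of "\<lambda>a. a < N \<and> \<not> z a \<le> r"] True unfolding P_def by auto
    have "z a \<le> r \<longleftrightarrow> a < P" if a: "a < N" for a
    proof
      assume "z a \<le> r"
      then show "a < P" using P z[of P a] a by (metis less_le_trans less_imp_le linorder_neqE_nat)
    next
      assume "a < P"
      then show "z a \<le> r" using not_less_Least a unfolding P_def by blast
    qed
    then show ?thesis using P by (intro exI[of _ P]) auto
  next
    case False
    then show ?thesis by (intro exI[of _ N]) auto
  qed
  obtain P where P: "P \<le> N" "\<And>a. a < N \<Longrightarrow> x a \<le> p \<longleftrightarrow> a < P" using initial[of x p] x_less by blast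
  obtain Q where Q: "Q \<le> N" "\<And>a. a < N \<Longrightarrow> y a \<le> q \<longleftrightarrow> a < Q" using initial[of y q] y_less by blast
  note rank = rank_function_config[OF P(1,2) Q(2)]
  have res: "residual v c p q j i = 0 \<or> (\<exists>a b. j = x b \<and> i = x a \<and> a < P \<and> nu a < Q \<and> P \<le> b \<and> b < N \<and> Q \<le> nu b)"
    if j: "j \<in> J" and i: "i \<in> A" for j i
  proof (cases "j \<in> X \<and> i \<in> X")
    case True
    then obtain a b where ab: "a < N" "b < N" "j = x b" "i = x a" by auto
    then have "a < P" "nu a < Q" "P \<le> b" "Q \<le> nu b"
      using i j P(2)[of a] P(2)[of b] Q(2)[of "nu a"] Q(2)[of "nu b"] nu_less[of a] nu_less[of b]
      by (simp_all add: v_x) (metis not_le)+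
    then show ?thesis using ab by blast
  next
    case False
    have "j \<noteq> i" using i j by auto
    then have "c $ j $ i = 0" using False supp unfolding config_supported_def by blast
    moreover have "c $ j $ t * c $ t $ i = 0" if "t \<le> p" "q < v t" for t
    proof -
      have "t \<noteq> j" "t \<noteq> i" using i j that by auto
      then show ?thesis using False supp unfolding config_supported_def by (metis mult_eq_0_iff)
    qed
    ultimately show ?thesis unfolding residual_def by (simp add: sum.neutral)
  qed
  note rc = residual_config[OF supp P(1,2) Q(2)]
  from cond[OF P(1) Q(1)] show "rank_function w p q \<le> vec.dim K"
  proof (elim disjE conjE)
    assume le: "one_line_rank om P Q \<le> one_line_rank nu P Q"
      and z: "\<forall>a b. a < P \<longrightarrow> nu a < Q \<longrightarrow> P \<le> b \<longrightarrow> b < N \<longrightarrow> Q \<le> nu b \<longrightarrow> config_residual c P Q b a = 0"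
    have "rank_function v p q \<le> vec.dim K"
    proof (rule dim_ge_of_residual_zero)
      fix j i assume "j \<in> J" "i \<in> A"
      from res[OF this] show "residual v c p q j i = 0"
      proof
        assume "\<exists>a b. j = x b \<and> i = x a \<and> a < P \<and> nu a < Q \<and> P \<le> b \<and> b < N \<and> Q \<le> nu b"
        then obtain a b where ab: "j = x b" "i = x a" "a < P" "nu a < Q" "P \<le> b" "b < N" "Q \<le> nu b" by blast
        then show ?thesis using rc[of b a] z by simp
      qed
    qed
    then show ?thesis using rank le by simp
  next
    assume le: "one_line_rank om P Q + 1 \<le> one_line_rank nu P Q"
      and m: "\<forall>a a' b b'. a < P \<longrightarrow> nu a < Q \<longrightarrow> a' < P \<longrightarrow> nu a' < Q \<longrightarrow>
           P \<le> b \<longrightarrow> b < N \<longrightarrow> Q \<le> nu b \<longrightarrow> P \<le> b' \<longrightarrow> b' < N \<longrightarrow> Q \<le> nu b' \<longrightarrow>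
           config_residual c P Q b a * config_residual c P Q b' a' =
           config_residual c P Q b a' * config_residual c P Q b' a"
    have "rank_function v p q \<le> vec.dim K + 1"
    proof (rule dim_ge_of_residual_minor)
      fix j j' i i' assume ji: "j \<in> J" "j' \<in> J" "i \<in> A" "i' \<in> A"
      let ?r = "residual v c p q"
      let ?c = "\<lambda>j i. \<exists>a b. j = x b \<and> i = x a \<and> a < P \<and> nu a < Q \<and> P \<le> b \<and> b < N \<and> Q \<le> nu b"
      show "?r j i * ?r j' i' = ?r j i' * ?r j' i"
      proof (cases "?c j i \<and> ?c j' i'")
        case True
        then obtain a b a' b' where ab: "j = x b" "i = x a" "a < P" "nu a < Q" "P \<le> b" "b < N" "Q \<le> nu b"
           "j' = x b'" "i' = x a'" "a' < P" "nu a' < Q" "P \<le> b'" "b' < N" "Q \<le> nu b'" by blast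
        then show ?thesis using rc[of b a] rc[of b a'] rc[of b' a] rc[of b' a'] m P(1) by simp
      next
        case False
        then have "?r j i = 0 \<or> ?r j' i' = 0" using res ji by blast
        moreover have "?r j i' = 0 \<or> ?r j' i = 0"
        proof (rule ccontr)
          assume "\<not> (?r j i' = 0 \<or> ?r j' i = 0)"
          then have "?c j i'" "?c j' i" using res[OF ji(1) ji(4)] res[OF ji(2) ji(3)] by blast+
          \<comment> \<open>The condition splits into one on the row and one on the column, so it
            passes from one diagonal of the minor to the other.\<close>
          then have "?c j i \<and> ?c j' i'" by blast
          then show False using False by blast
        qed
        ultimately show ?thesis by auto
      qed
    qed
    then show ?thesis using rank le by simp
  qed
qed

text \<open>The map \<open>f\<close> writes a point of the cone into the entries and
  \<open>g\<close> reads it off. Only off-diagonal entries are compared, since the diagonal is fixed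
  at 1.\<close>

lemma slice_isomorphism:
  fixes f :: "'p \<Rightarrow> nat \<Rightarrow> nat \<Rightarrow> 'k::field" and g :: "(nat \<Rightarrow> nat \<Rightarrow> 'k) \<Rightarrow> 'p"
  assumes f_in: "\<And>z. z \<in> Z \<Longrightarrow> config_matrix (f z) \<in> slice_schubert v w"
    and g_in: "\<And>c. c \<in> slice_schubert v w \<Longrightarrow> g (entry c) \<in> Z"
    and fg: "\<And>c a b. c \<in> slice_schubert v w \<Longrightarrow> a < N \<Longrightarrow> b < N \<Longrightarrow> a \<noteq> b \<Longrightarrow> f (g (entry c)) b a = entry c b a"
    and gf: "\<And>z. z \<in> Z \<Longrightarrow> g (entry (config_matrix (f z))) = z"
    and g_poly: "\<And>e. e \<in> C \<Longrightarrow> \<exists>h\<in>polynomial_functions matrix_entries. \<forall>c\<in>slice_schubert v w. e (g (entry c)) = h c"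
    and f_poly: "\<And>a b. a < N \<Longrightarrow> b < N \<Longrightarrow> a \<noteq> b \<Longrightarrow> (\<lambda>z. f z b a) \<in> polynomial_functions C"
  shows "isomorphic_spaces (coordinate_space Z C)
     (coordinate_space (slice_schubert v w :: ('k, 'n) square_matrix set) matrix_entries)"
proof (rule isomorphic_coordinate_spaces[where \<phi> = "\<lambda>z. config_matrix (f z)" and \<psi> = "\<lambda>c. g (entry c)"])
  show "config_matrix (f (g (entry c))) = c" if c: "c \<in> slice_schubert v w" for c
  proof (rule config_matrix_entry)
    show "c \<in> pattern_matrices (slice_pattern v)" using c by (simp add: slice_schubert_def)
  qed (use slice_schubert_supported[OF c] fg[OF c] in auto)
  show "\<exists>h\<in>polynomial_functions C. \<forall>z\<in>Z. e (config_matrix (f z)) = h z"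
    if e: "e \<in> matrix_entries" for e :: "('k, 'n) square_matrix \<Rightarrow> 'k"
  proof -
    obtain j i where e: "e = (\<lambda>c. c $ j $ i)" using e unfolding matrix_entries_def by blast
    show ?thesis
    proof (cases "j \<noteq> i \<and> j \<in> X \<and> i \<in> X")
      case True
      then obtain a b where ab: "a < N" "b < N" "j = x b" "i = x a" by auto
      then have "a \<noteq> b" using True by auto
      then show ?thesis using ab f_poly[of a b] entry_config_matrix[of a b]
        by (intro bexI[of _ "\<lambda>z. f z b a"]) (auto simp: e entry_def)
    next
      case False
      then show ?thesis
        by (intro bexI[of _ "\<lambda>_. if j = i then 1 else 0"] polynomial_functions.const)
           (auto simp: e config_matrix_def)
    qed
  qed
qed (use f_in g_in gf g_poly in auto)

lemma polynomial_entry: "(\<lambda>c. entry c b a) \<in> polynomial_functions matrix_entries"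
  unfolding entry_def by (rule polynomial_matrix_entry)

end

section \<open>Rank functions of the three types\<close>

text \<open>The one-line notations \<open>omega\<close> and \<open>nu\<close> of the three types, with positions and values counted
  from 0.\<close>

definition om_4231 :: "nat \<Rightarrow> nat \<Rightarrow> nat \<Rightarrow> nat" where
  "om_4231 l m a = (if a = 0 then l + m + 1 else if a \<le> l then l + 1 - a
     else if a \<le> l + m then 2 * l + m + 1 - a else 0)"

definition nu_4231' :: "nat \<Rightarrow> nat \<Rightarrow> nat \<Rightarrow> nat" where
  "nu_4231' l m a = (if a \<le> l then l - a else 2 * l + m + 2 - a)"

definition om_star :: "nat \<Rightarrow> nat \<Rightarrow> nat" where
  "om_star l a = (if a = 0 then l + 2 else if a = 1 then l + 3 else if a \<le> l + 1 then l + 3 - a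
     else if a = l + 2 then 0 else 1)"

definition nu_star :: "nat \<Rightarrow> nat \<Rightarrow> nat" where
  "nu_star l a = (if a = 0 then 0 else if a \<le> l + 2 then l + 3 - a else l + 3)"

definition om_empty :: "nat \<Rightarrow> nat \<Rightarrow> nat \<Rightarrow> nat" where
  "om_empty l m a = (if a = 0 then l + 2 else if a \<le> l then l + 1 - a else if a = l + 1 then l + m + 3
     else if a = l + 2 then 0 else if a \<le> l + m + 2 then 2 * l + m + 5 - a else l + 1)"

definition nu_empty :: "nat \<Rightarrow> nat \<Rightarrow> nat \<Rightarrow> nat" where
  "nu_empty l m a = (if a \<le> l then l - a else if a = l + 1 then l + 2 else if a = l + 2 then l + 1
     else 2 * l + m + 6 - a)"

text \<open>Writing \<open>P\<close> as a breakpoint plus an offset removes most truncated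
  subtractions from the case analyses below.\<close>

lemma le_or_offset: "(P :: nat) \<le> n \<or> (\<exists>p. P = n + 1 + p)"
  by presburger

text \<open>Each monotone run of the one-line notation contributes an interval of positions.
  Truncated subtraction counts an interval correctly even if it is empty, and the same method serves
  for the other one-line notations.\<close>

lemma one_line_rank_om_4231:
  assumes "l > 0" "m > 0" "P \<le> l + m + 2" "Q \<le> l + m + 2"
  shows "one_line_rank (om_4231 l m) P Q = min P (Q - (l + m + 1)) + (min P (l + 1) - max 1 (l + 2 - Q))
     + (min P (l + m + 1) - max (l + 1) (2 * l + m + 2 - Q)) + (min P (l + m + 1 + Q) - (l + m + 1))"
proof -
  have eq: "{a. a < P \<and> om_4231 l m a < Q} = {0..<min P (Q - (l + m + 1))} \<union> {max 1 (l + 2 - Q)..<min P (l + 1)}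
     \<union> {max (l + 1) (2 * l + m + 2 - Q)..<min P (l + m + 1)} \<union> {l + m + 1..<min P (l + m + 1 + Q)}"
  proof (rule Set.set_eqI)
    fix a
    have "a = 0 \<or> (0 < a \<and> a \<le> l) \<or> (l < a \<and> a \<le> l + m) \<or> l + m < a"
      by linarith
    then show "a \<in> {a. a < P \<and> om_4231 l m a < Q} \<longleftrightarrow> a \<in> {0..<min P (Q - (l + m + 1))} \<union> {max 1 (l + 2 - Q)..<min P (l + 1)}
     \<union> {max (l + 1) (2 * l + m + 2 - Q)..<min P (l + m + 1)} \<union> {l + m + 1..<min P (l + m + 1 + Q)}"
      by (elim disjE) (use assms in \<open>auto simp: om_4231_def\<close>)
  qed
  show ?thesis unfolding one_line_rank_def eq using assms
    by (subst card_Un_disjoint, simp, simp, fastforce)+ simp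
qed

lemma one_line_rank_nu_4231:
  assumes "P \<le> l + m + 2" "Q \<le> l + m + 2"
  shows "one_line_rank (nu_4231' l m) P Q = (min P (l + 1) - (l + 1 - Q)) + (P - max (l + 1) (2 * l + m + 3 - Q))"
proof -
  have eq: "{a. a < P \<and> nu_4231' l m a < Q} = {l + 1 - Q..<min P (l + 1)} \<union> {max (l + 1) (2 * l + m + 3 - Q)..<P}"
  proof (rule Set.set_eqI)
    fix a
    have "a \<le> l \<or> l < a"
      by linarith
    then show "a \<in> {a. a < P \<and> nu_4231' l m a < Q} \<longleftrightarrow> a \<in> {l + 1 - Q..<min P (l + 1)} \<union> {max (l + 1) (2 * l + m + 3 - Q)..<P}"
      by (elim disjE) (use assms in \<open>auto simp: nu_4231'_def\<close>)
  qed
  show ?thesis unfolding one_line_rank_def eq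
    by (subst card_Un_disjoint, simp, simp, fastforce)+ simp
qed

text \<open>The second clause covers the boxes that meet the block of free entries; the last one
  supplies the box from which the minors are read.\<close>

lemma rank_4231:
  assumes lm: "l > 0" "m > 0" and "P \<le> l + m + 2" "Q \<le> l + m + 2"
  shows "one_line_rank (om_4231 l m) P Q \<le> one_line_rank (nu_4231' l m) P Q"
    and "1 \<le> P \<Longrightarrow> P \<le> l + m + 1 \<Longrightarrow> 1 \<le> Q \<Longrightarrow> Q \<le> l + m + 1 \<Longrightarrow> l + 2 \<le> P + Q \<Longrightarrow> P + Q \<le> 2 * l + m + 2 \<Longrightarrow>
      one_line_rank (om_4231 l m) P Q + 1 \<le> one_line_rank (nu_4231' l m) P Q"
    and "one_line_rank (nu_4231' l m) (l + 1) (l + 1) \<le> one_line_rank (om_4231 l m) (l + 1) (l + 1) + 1"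
proof -
  note ranks = one_line_rank_om_4231[OF lm assms(3,4)] one_line_rank_nu_4231[OF assms(3,4)]
  consider "P \<le> l" "Q \<le> l" | p where "P = l + 1 + p" "Q \<le> l" | q where "P \<le> l" "Q = l + 1 + q"
    | p q where "P = l + 1 + p" "Q = l + 1 + q"
    using le_or_offset[of P l] le_or_offset[of Q l] by blast
  note cases = this
  from cases show "one_line_rank (om_4231 l m) P Q \<le> one_line_rank (nu_4231' l m) P Q"
    unfolding ranks by cases (use assms in \<open>auto simp: min_def max_def\<close>)
  show "one_line_rank (om_4231 l m) P Q + 1 \<le> one_line_rank (nu_4231' l m) P Q"
    if "1 \<le> P" "P \<le> l + m + 1" "1 \<le> Q" "Q \<le> l + m + 1" "l + 2 \<le> P + Q" "P + Q \<le> 2 * l + m + 2"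
    using cases unfolding ranks by cases (use assms that in \<open>auto simp: min_def max_def\<close>)
  show "one_line_rank (nu_4231' l m) (l + 1) (l + 1) \<le> one_line_rank (om_4231 l m) (l + 1) (l + 1) + 1"
    using lm by (simp add: one_line_rank_om_4231 one_line_rank_nu_4231)
qed

section \<open>Rank functions of type 34*12\<close>

lemma one_line_rank_om_star:
  assumes "P \<le> l + 4" "Q \<le> l + 4"
  shows "one_line_rank (om_star l) P Q = min P (min 1 (Q - (l + 2))) + (min P (1 + (Q - (l + 3))) - 1)
     + (min P (l + 2) - max 2 (l + 4 - Q)) + (min P (min (l + 3) (l + 2 + Q)) - (l + 2))
     + (min P (l + 3 + (Q - 1)) - (l + 3))"
proof -
  have eq: "{a. a < P \<and> om_star l a < Q} = {0..<min P (min 1 (Q - (l + 2)))} \<union> {1..<min P (1 + (Q - (l + 3)))}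
     \<union> {max 2 (l + 4 - Q)..<min P (l + 2)} \<union> {l + 2..<min P (min (l + 3) (l + 2 + Q))}
     \<union> {l + 3..<min P (l + 3 + (Q - 1))}"
  proof (rule Set.set_eqI)
    fix a
    have "a = 0 \<or> a = 1 \<or> (2 \<le> a \<and> a \<le> l + 1) \<or> a = l + 2 \<or> l + 3 \<le> a"
      by linarith
    then show "a \<in> {a. a < P \<and> om_star l a < Q} \<longleftrightarrow> a \<in> {0..<min P (min 1 (Q - (l + 2)))} \<union> {1..<min P (1 + (Q - (l + 3)))}
     \<union> {max 2 (l + 4 - Q)..<min P (l + 2)} \<union> {l + 2..<min P (min (l + 3) (l + 2 + Q))}
     \<union> {l + 3..<min P (l + 3 + (Q - 1))}"
      by (elim disjE) (use assms in \<open>auto simp: om_star_def\<close>)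
  qed
  show ?thesis unfolding one_line_rank_def eq using assms
    by (subst card_Un_disjoint, simp, simp, fastforce)+ simp
qed

lemma one_line_rank_nu_star:
  assumes "P \<le> l + 4" "Q \<le> l + 4"
  shows "one_line_rank (nu_star l) P Q = min P (min 1 Q) + (min P (l + 3) - max 1 (l + 4 - Q))
     + (min P (l + 3 + (Q - (l + 3))) - (l + 3))"
proof -
  have eq: "{a. a < P \<and> nu_star l a < Q} = {0..<min P (min 1 Q)} \<union> {max 1 (l + 4 - Q)..<min P (l + 3)}
     \<union> {l + 3..<min P (l + 3 + (Q - (l + 3)))}"
  proof (rule Set.set_eqI)
    fix a
    have "a = 0 \<or> (1 \<le> a \<and> a \<le> l + 2) \<or> l + 3 \<le> a"
      by linarith
    then show "a \<in> {a. a < P \<and> nu_star l a < Q} \<longleftrightarrow> a \<in> {0..<min P (min 1 Q)} \<union> {max 1 (l + 4 - Q)..<min P (l + 3)}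
     \<union> {l + 3..<min P (l + 3 + (Q - (l + 3)))}"
      by (elim disjE) (use assms in \<open>auto simp: nu_star_def\<close>)
  qed
  show ?thesis unfolding one_line_rank_def eq using assms
    by (subst card_Un_disjoint, simp, simp, fastforce)+ simp
qed

text \<open>The ranks differ on a square of boxes without two opposite corners. At these corners
  they agree, and from them come the vanishing corner entry and the quadric.\<close>

lemma rank_star:
  assumes "P \<le> l + 4" "Q \<le> l + 4"
  shows "one_line_rank (om_star l) P Q \<le> one_line_rank (nu_star l) P Q"
    and "1 \<le> P \<Longrightarrow> P \<le> l + 3 \<Longrightarrow> 1 \<le> Q \<Longrightarrow> Q \<le> l + 3 \<Longrightarrow> 2 \<le> P \<or> Q \<le> l + 2 \<Longrightarrow> 2 \<le> Q \<or> P \<le> l + 2 \<Longrightarrow>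
      one_line_rank (om_star l) P Q + 1 \<le> one_line_rank (nu_star l) P Q"
    and "one_line_rank (nu_star l) 1 (l + 3) \<le> one_line_rank (om_star l) 1 (l + 3)"
    and "one_line_rank (nu_star l) (l + 3) 1 \<le> one_line_rank (om_star l) (l + 3) 1"
proof -
  note ranks = one_line_rank_om_star[OF assms] one_line_rank_nu_star[OF assms]
  have P: "P = 0 \<or> P = 1 \<or> (\<exists>p\<le>l. P = p + 2) \<or> P = l + 3 \<or> P = l + 4"
    using assms(1) le_or_offset[of P 1] by auto
  have Q: "Q = 0 \<or> Q = 1 \<or> (\<exists>q<l. Q = q + 2) \<or> Q = l + 2 \<or> Q = l + 3 \<or> Q = l + 4"
    using assms(2) le_or_offset[of Q 1] by auto
  show "one_line_rank (om_star l) P Q \<le> one_line_rank (nu_star l) P Q"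
    unfolding ranks using P Q by (elim disjE exE conjE) (auto simp: min_def max_def)
  show "one_line_rank (om_star l) P Q + 1 \<le> one_line_rank (nu_star l) P Q"
    if "1 \<le> P" "P \<le> l + 3" "1 \<le> Q" "Q \<le> l + 3" "2 \<le> P \<or> Q \<le> l + 2" "2 \<le> Q \<or> P \<le> l + 2"
    unfolding ranks using P Q that by (elim disjE exE conjE) (auto simp: min_def max_def)
  show "one_line_rank (nu_star l) 1 (l + 3) \<le> one_line_rank (om_star l) 1 (l + 3)"
    "one_line_rank (nu_star l) (l + 3) 1 \<le> one_line_rank (om_star l) (l + 3) 1"
    by (simp_all add: one_line_rank_om_star one_line_rank_nu_star)
qed

section \<open>Rank functions of type 34empty12\<close>

lemma one_line_rank_om_empty:
  assumes "P \<le> l + m + 4" "Q \<le> l + m + 4"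
  shows "one_line_rank (om_empty l m) P Q = min P (min 1 (Q - (l + 2))) + (min P (l + 1) - max 1 (l + 2 - Q))
     + (min P (l + 1 + (Q - (l + m + 3))) - (l + 1)) + (min P (min (l + 3) (l + 2 + Q)) - (l + 2))
     + (min P (l + m + 3) - max (l + 3) (2 * l + m + 6 - Q)) + (min P (l + m + 3 + (Q - (l + 1))) - (l + m + 3))"
proof -
  have eq: "{a. a < P \<and> om_empty l m a < Q} = {0..<min P (min 1 (Q - (l + 2)))} \<union> {max 1 (l + 2 - Q)..<min P (l + 1)}
     \<union> {l + 1..<min P (l + 1 + (Q - (l + m + 3)))} \<union> {l + 2..<min P (min (l + 3) (l + 2 + Q))}
     \<union> {max (l + 3) (2 * l + m + 6 - Q)..<min P (l + m + 3)} \<union> {l + m + 3..<min P (l + m + 3 + (Q - (l + 1)))}"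
  proof (rule Set.set_eqI)
    fix a
    have "a = 0 \<or> (0 < a \<and> a \<le> l) \<or> a = l + 1 \<or> a = l + 2 \<or> (l + 3 \<le> a \<and> a \<le> l + m + 2) \<or> l + m + 3 \<le> a"
      by linarith
    then show "a \<in> {a. a < P \<and> om_empty l m a < Q} \<longleftrightarrow> a \<in> {0..<min P (min 1 (Q - (l + 2)))} \<union> {max 1 (l + 2 - Q)..<min P (l + 1)}
     \<union> {l + 1..<min P (l + 1 + (Q - (l + m + 3)))} \<union> {l + 2..<min P (min (l + 3) (l + 2 + Q))}
     \<union> {max (l + 3) (2 * l + m + 6 - Q)..<min P (l + m + 3)} \<union> {l + m + 3..<min P (l + m + 3 + (Q - (l + 1)))}"
      by (elim disjE) (use assms in \<open>auto simp: om_empty_def\<close>)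
  qed
  show ?thesis unfolding one_line_rank_def eq using assms
    by (subst card_Un_disjoint, simp, simp, fastforce)+ simp
qed

lemma one_line_rank_nu_empty:
  assumes "P \<le> l + m + 4" "Q \<le> l + m + 4"
  shows "one_line_rank (nu_empty l m) P Q = (min P (l + 1) - (l + 1 - Q))
     + (min P (min (l + 2) (l + 1 + (Q - (l + 2)))) - (l + 1))
     + (min P (min (l + 3) (l + 2 + (Q - (l + 1)))) - (l + 2)) + (P - max (l + 3) (2 * l + m + 7 - Q))"
proof -
  have eq: "{a. a < P \<and> nu_empty l m a < Q} = {l + 1 - Q..<min P (l + 1)}
     \<union> {l + 1..<min P (min (l + 2) (l + 1 + (Q - (l + 2))))}
     \<union> {l + 2..<min P (min (l + 3) (l + 2 + (Q - (l + 1))))} \<union> {max (l + 3) (2 * l + m + 7 - Q)..<P}"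
  proof (rule Set.set_eqI)
    fix a
    have "a \<le> l \<or> a = l + 1 \<or> a = l + 2 \<or> l + 3 \<le> a"
      by linarith
    then show "a \<in> {a. a < P \<and> nu_empty l m a < Q} \<longleftrightarrow> a \<in> {l + 1 - Q..<min P (l + 1)}
     \<union> {l + 1..<min P (min (l + 2) (l + 1 + (Q - (l + 2))))}
     \<union> {l + 2..<min P (min (l + 3) (l + 2 + (Q - (l + 1))))} \<union> {max (l + 3) (2 * l + m + 7 - Q)..<P}"
      by (elim disjE) (use assms in \<open>auto simp: nu_empty_def\<close>)
  qed
  show ?thesis unfolding one_line_rank_def eq using assms
    by (subst card_Un_disjoint, simp, simp, fastforce)+ simp
qed

text \<open>The region where the ranks differ consists of two parts that meet only in the box
  \<open>(l + 2, l + 2)\<close>. The last four clauses are the boxes giving the equations: two for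
  minors, two for vanishing residuals.\<close>

lemma rank_empty:
  assumes "P \<le> l + m + 4" "Q \<le> l + m + 4"
  shows "one_line_rank (om_empty l m) P Q \<le> one_line_rank (nu_empty l m) P Q"
    and "1 \<le> P \<Longrightarrow> P \<le> l + 2 \<Longrightarrow> 1 \<le> Q \<Longrightarrow> Q \<le> l + 2 \<Longrightarrow> l + 2 \<le> P + Q \<Longrightarrow>
      one_line_rank (om_empty l m) P Q + 1 \<le> one_line_rank (nu_empty l m) P Q"
    and "l + 2 \<le> P \<Longrightarrow> P \<le> l + m + 3 \<Longrightarrow> l + 2 \<le> Q \<Longrightarrow> Q \<le> l + m + 3 \<Longrightarrow> P + Q \<le> 2 * l + m + 6 \<Longrightarrow>
      one_line_rank (om_empty l m) P Q + 1 \<le> one_line_rank (nu_empty l m) P Q"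
    and "one_line_rank (nu_empty l m) (l + 1) (l + 1) \<le> one_line_rank (om_empty l m) (l + 1) (l + 1) + 1"
    and "one_line_rank (nu_empty l m) (l + 3) (l + 3) \<le> one_line_rank (om_empty l m) (l + 3) (l + 3) + 1"
    and "one_line_rank (nu_empty l m) (l + 1) (l + 3) \<le> one_line_rank (om_empty l m) (l + 1) (l + 3)"
    and "one_line_rank (nu_empty l m) (l + 3) (l + 1) \<le> one_line_rank (om_empty l m) (l + 3) (l + 1)"
proof -
  note ranks = one_line_rank_om_empty[OF assms] one_line_rank_nu_empty[OF assms]
  consider "P \<le> l + 1" "Q \<le> l + 1" | p where "P = l + 2 + p" "Q \<le> l + 1" | q where "P \<le> l + 1" "Q = l + 2 + q"
    | p q where "P = l + 2 + p" "Q = l + 2 + q"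
    using le_or_offset[of P "l + 1"] le_or_offset[of Q "l + 1"] by auto
  then show "one_line_rank (om_empty l m) P Q \<le> one_line_rank (nu_empty l m) P Q"
    unfolding ranks by cases (use assms in \<open>auto simp: min_def max_def\<close>)
  show "one_line_rank (om_empty l m) P Q + 1 \<le> one_line_rank (nu_empty l m) P Q"
    if "1 \<le> P" "P \<le> l + 2" "1 \<le> Q" "Q \<le> l + 2" "l + 2 \<le> P + Q"
    unfolding ranks using that by (auto simp: min_def max_def)
  show "one_line_rank (om_empty l m) P Q + 1 \<le> one_line_rank (nu_empty l m) P Q"
    if c: "l + 2 \<le> P" "P \<le> l + m + 3" "l + 2 \<le> Q" "Q \<le> l + m + 3" "P + Q \<le> 2 * l + m + 6"
  proof -
    obtain p q where "P = l + 2 + p" "Q = l + 2 + q" using c(1,3) le_Suc_ex by blast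
    then show ?thesis unfolding ranks using c by (auto simp: min_def max_def)
  qed
  show "one_line_rank (nu_empty l m) (l + 1) (l + 1) \<le> one_line_rank (om_empty l m) (l + 1) (l + 1) + 1"
    "one_line_rank (nu_empty l m) (l + 3) (l + 3) \<le> one_line_rank (om_empty l m) (l + 3) (l + 3) + 1"
    "one_line_rank (nu_empty l m) (l + 1) (l + 3) \<le> one_line_rank (om_empty l m) (l + 1) (l + 3)"
    "one_line_rank (nu_empty l m) (l + 3) (l + 1) \<le> one_line_rank (om_empty l m) (l + 3) (l + 1)"
    by (simp_all add: one_line_rank_om_empty one_line_rank_nu_empty min_def max_def)
qed

section \<open>Matrices of rank at most one\<close>

text \<open>The rank is at least the size of a nonsingular square submatrix, here the one in rows
  \<open>i\<close>, \<open>i'\<close> and columns \<open>j\<close>, \<open>j'\<close>.\<close>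

lemma rank_gt_one_minor:
  fixes A :: "'k::field mat"
  assumes A: "A \<in> carrier_mat r c" and i: "i < i'" "i' < r" and j: "j < j'" "j' < c"
    and minor: "A $$ (i, j) * A $$ (i', j') \<noteq> A $$ (i, j') * A $$ (i', j)"
  shows "vec_space.rank r A > 1"
proof -
  let ?B = "submatrix A {i, i'} {j, j'}"
  have ci: "card {a. a < dim_row A \<and> a \<in> {i, i'}} = 2" and cj: "card {a. a < dim_col A \<and> a \<in> {j, j'}} = 2"
  proof -
    have "{a. a < dim_row A \<and> a \<in> {i, i'}} = {i, i'}" "{a. a < dim_col A \<and> a \<in> {j, j'}} = {j, j'}"
      using A i j by auto
    then show "card {a. a < dim_row A \<and> a \<in> {i, i'}} = 2" "card {a. a < dim_col A \<and> a \<in> {j, j'}} = 2"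
      using i j by simp_all
  qed
  have B: "?B \<in> carrier_mat 2 2" by (rule carrier_matI) (simp_all only: dim_submatrix ci cj)
  \<comment> \<open>Rows and columns of a submatrix are numbered by how many selected indices are
    smaller.\<close>
  have si: "{a \<in> {i, i'}. a < i} = {}" "{a \<in> {i, i'}. a < i'} = {i}"
    and sj: "{a \<in> {j, j'}. a < j} = {}" "{a \<in> {j, j'}. a < j'} = {j}"
    using i j by auto
  have e: "?B $$ (card {a \<in> {i, i'}. a < k}, card {a \<in> {j, j'}. a < h}) = A $$ (k, h)"
    if "k \<in> {i, i'}" "h \<in> {j, j'}" for k h
    by (rule submatrix_index_card) (use that A i j in auto)
  have entries: "?B $$ (0, 0) = A $$ (i, j)" "?B $$ (0, 1) = A $$ (i, j')"
    "?B $$ (1, 0) = A $$ (i', j)" "?B $$ (1, 1) = A $$ (i', j')"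
    using e[of i j] e[of i j'] e[of i' j] e[of i' j'] unfolding si sj by simp_all
  \<comment> \<open>A kernel vector replaces the expansion of the determinant:
    \<open>singular_two_by_two\<close> turns it into the excluded equality.\<close>
  have "Determinant.det ?B \<noteq> 0"
  proof
    assume "Determinant.det ?B = 0"
    then obtain x where x: "x \<in> carrier_vec 2" "x \<noteq> 0\<^sub>v 2" "?B *\<^sub>v x = 0\<^sub>v 2"
      using det_0_iff_vec_prod_zero_field[OF B] by blast
    have row: "?B $$ (k, 0) * vec_index x 0 + ?B $$ (k, 1) * vec_index x 1 = 0" if k: "k < 2" for k
    proof -
      have "vec_index (?B *\<^sub>v x) k = ?B $$ (k, 0) * vec_index x 0 + ?B $$ (k, 1) * vec_index x 1"
        using B x(1) k by (simp add: scalar_prod_def numeral_2_eq_2)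
      then show ?thesis using x(3) k by simp
    qed
    have "vec_index x 0 \<noteq> 0 \<or> vec_index x 1 \<noteq> 0"
    proof (rule ccontr)
      assume z: "\<not> (vec_index x 0 \<noteq> 0 \<or> vec_index x 1 \<noteq> 0)"
      have "x = 0\<^sub>v 2"
        by (rule eq_vecI) (use x(1) z in \<open>auto simp: less_2_cases_iff\<close>)
      then show False using x(2) by simp
    qed
    then show False
      using singular_two_by_two[of "A $$ (i, j)" "vec_index x 0" "A $$ (i, j')" "vec_index x 1" "A $$ (i', j)" "A $$ (i', j')"]
        row[of 0] row[of 1] minor unfolding entries by simp
  qed
  then have "card {a. a < c \<and> a \<in> {j, j'}} \<le> vec_space.rank r A"
    by (rule vec_space.rank_gt_minor[OF A])
  moreover have "dim_col A = c" using A by simp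
  ultimately show ?thesis using cj by simp
qed

text \<open>Around a nonzero entry at \<open>(i0, j0)\<close> the minors express every entry through
  column \<open>j0\<close> and row \<open>i0\<close>.\<close>

lemma rank_le_one_product:
  fixes A :: "'k::field mat"
  assumes A: "A \<in> carrier_mat r c"
    and minors: "\<And>i i' j j'. i < i' \<Longrightarrow> i' < r \<Longrightarrow> j < j' \<Longrightarrow> j' < c \<Longrightarrow>
       A $$ (i, j) * A $$ (i', j') = A $$ (i, j') * A $$ (i', j)"
  obtains \<alpha> \<beta> where "\<And>i j. i < r \<Longrightarrow> j < c \<Longrightarrow> A $$ (i, j) = \<alpha> i * \<beta> j"
proof -
  have m': "A $$ (i, j) * A $$ (i', j') = A $$ (i, j') * A $$ (i', j)"
    if "i < i'" "i' < r" "j < c" "j' < c" for i i' j j'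
    using minors[of i i' j j'] minors[of i i' j' j] that by (cases j j' rule: linorder_cases) simp_all
  have m: "A $$ (i, j) * A $$ (i', j') = A $$ (i, j') * A $$ (i', j)"
    if "i < r" "i' < r" "j < c" "j' < c" for i i' j j'
  proof (cases i i' rule: linorder_cases)
    case less
    then show ?thesis using m' that by blast
  next
    case equal
    then show ?thesis by (simp add: mult.commute)
  next
    case greater
    then show ?thesis using m'[of i' i j' j] that by (simp add: mult.commute)
  qed
  show ?thesis
  proof (cases "\<forall>i<r. \<forall>j<c. A $$ (i, j) = 0")
    case True
    then show ?thesis using that[of "\<lambda>_. 0" "\<lambda>_. 0"] by simp
  next
    case False
    then obtain i0 j0 where 0: "i0 < r" "j0 < c" "A $$ (i0, j0) \<noteq> 0" by blast
    have "A $$ (i, j) = A $$ (i, j0) * (A $$ (i0, j) / A $$ (i0, j0))" if "i < r" "j < c" for i j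
      using m[of i i0 j j0] that 0 by (simp add: field_simps)
    then show ?thesis by (rule that)
  qed
qed

lemma rank_le_one_iff:
  fixes A :: "'k::field mat"
  assumes A: "A \<in> carrier_mat r c"
  shows "vec_space.rank r A \<le> 1 \<longleftrightarrow> (\<forall>i i' j j'. i < i' \<longrightarrow> i' < r \<longrightarrow> j < j' \<longrightarrow> j' < c \<longrightarrow>
     A $$ (i, j) * A $$ (i', j') = A $$ (i, j') * A $$ (i', j))"
proof
  assume "vec_space.rank r A \<le> 1"
  then show "\<forall>i i' j j'. i < i' \<longrightarrow> i' < r \<longrightarrow> j < j' \<longrightarrow> j' < c \<longrightarrow>
     A $$ (i, j) * A $$ (i', j') = A $$ (i, j') * A $$ (i', j)"
    using rank_gt_one_minor[OF A] by (meson leD)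
next
  assume m: "\<forall>i i' j j'. i < i' \<longrightarrow> i' < r \<longrightarrow> j < j' \<longrightarrow> j' < c \<longrightarrow>
     A $$ (i, j) * A $$ (i', j') = A $$ (i, j') * A $$ (i', j)"
  obtain \<alpha> \<beta> where ab: "\<And>i j. i < r \<Longrightarrow> j < c \<Longrightarrow> A $$ (i, j) = \<alpha> i * \<beta> j"
  proof (rule rank_le_one_product[OF A _ that])
    fix i i' j j' assume "i < i'" "i' < r" "j < j'" "j' < c"
    then show "A $$ (i, j) * A $$ (i', j') = A $$ (i, j') * A $$ (i', j)" using m by blast
  qed
  show "vec_space.rank r A \<le> 1"
    by (rule vec_space.rank_le_1_product_entries[OF A]) (use A ab in auto)
qed

section \<open>The cone of matrices of rank at most one as a coordinate space\<close>

definition rank_one_matrices :: "nat \<Rightarrow> nat \<Rightarrow> 'k::field mat set" where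
  "rank_one_matrices r c = {A \<in> carrier_mat r c. vec_space.rank r A \<le> 1}"

definition mat_coordinates :: "nat \<Rightarrow> nat \<Rightarrow> ('k mat \<Rightarrow> 'k::field) set" where
  "mat_coordinates r c = {(\<lambda>A. A $$ (i, j)) | i j. i < r \<and> j < c}"

lemma rank_one_matricesE:
  assumes "A \<in> rank_one_matrices r c"
  obtains \<alpha> \<beta> where "\<And>i j. i < r \<Longrightarrow> j < c \<Longrightarrow> A $$ (i, j) = \<alpha> i * \<beta> j"
proof -
  have A: "A \<in> carrier_mat r c" "vec_space.rank r A \<le> 1" using assms by (auto simp: rank_one_matrices_def)
  note m = A(2)[unfolded rank_le_one_iff[OF A(1)]]
  show ?thesis
  proof (rule rank_le_one_product[OF A(1) _ that])
    fix i i' j j' assume "i < i'" "i' < r" "j < j'" "j' < c"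
    then show "A $$ (i, j) * A $$ (i', j') = A $$ (i, j') * A $$ (i', j)" using m by blast
  qed
qed

lemma rank_one_matricesI:
  assumes "A \<in> carrier_mat r c"
    and "\<And>i i' j j'. i < i' \<Longrightarrow> i' < r \<Longrightarrow> j < j' \<Longrightarrow> j' < c \<Longrightarrow>
       A $$ (i, j) * A $$ (i', j') = A $$ (i, j') * A $$ (i', j)"
  shows "A \<in> rank_one_matrices r c"
  unfolding rank_one_matrices_def using rank_le_one_iff[OF assms(1)] assms by blast

lemma rank_at_most_one_cone_iso:
  "isomorphic_spaces (rank_at_most_one_cone r c)
     (coordinate_space (rank_one_matrices r c) (mat_coordinates r c :: ('k::field mat \<Rightarrow> 'k) set))"
  unfolding rank_at_most_one_cone_def rank_one_matrices_def mat_coordinates_def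
  by (rule subspace_of_coordinate_space) blast

lemma polynomial_mat_coordinate:
  "i < r \<Longrightarrow> j < c \<Longrightarrow> (\<lambda>A. A $$ (i, j)) \<in> polynomial_functions (mat_coordinates r c)"
  unfolding mat_coordinates_def by (intro polynomial_functions.coord) blast

section \<open>Nondegenerate quadratic forms\<close>

lemma sum_lessThan_add: "(\<Sum>i<n + m. f i) = (\<Sum>i<n. f i) + (\<Sum>i<m. f (n + i :: nat))"
  for f :: "nat \<Rightarrow> 'a::comm_monoid_add"
  by (induction m) (simp_all add: add.assoc)

definition hyperbolic_swap :: "nat \<Rightarrow> nat \<Rightarrow> nat" where
  "hyperbolic_swap n i = (if i < n then i + n else i - n)"

text \<open>The Gram matrix of an orthogonal sum of \<open>n\<close> hyperbolic planes, with
  coordinate \<open>i\<close> paired with \<open>i + n\<close>; each pair is counted twice in the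
  form.\<close>

definition hyperbolic_form :: "nat \<Rightarrow> nat \<Rightarrow> nat \<Rightarrow> 'k::field_char_0" where
  "hyperbolic_form n i j = (if j = hyperbolic_swap n i then 1 else 0)"

lemma hyperbolic_form_row:
  assumes "i < 2 * n"
  shows "(\<Sum>j<2 * n. hyperbolic_form n i j * x i * y j) = x i * y (hyperbolic_swap n i)"
proof -
  have "hyperbolic_swap n i < 2 * n" using assms by (auto simp: hyperbolic_swap_def)
  moreover have "(\<Sum>j<2 * n. hyperbolic_form n i j * x i * y j) =
     (\<Sum>j<2 * n. if j = hyperbolic_swap n i then x i * y j else 0)"
    by (intro sum.cong) (auto simp: hyperbolic_form_def)
  ultimately show ?thesis by simp
qed

lemma hyperbolic_form_value:
  "(\<Sum>i<2 * n. \<Sum>j<2 * n. hyperbolic_form n i j * x i * x j) = 2 * (\<Sum>i<n. x i * x (i + n))"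
proof -
  have "(\<Sum>i<2 * n. \<Sum>j<2 * n. hyperbolic_form n i j * x i * x j) = (\<Sum>i<n + n. x i * x (hyperbolic_swap n i))"
    by (simp add: hyperbolic_form_row mult_2[symmetric])
  also have "\<dots> = (\<Sum>i<n. x i * x (hyperbolic_swap n i)) + (\<Sum>i<n. x (n + i) * x (hyperbolic_swap n (n + i)))"
    by (rule sum_lessThan_add)
  finally show ?thesis by (simp add: hyperbolic_swap_def mult.commute add.commute)
qed

lemma nondegenerate_hyperbolic_form: "nondegenerate_form (2 * n) (hyperbolic_form n)"
  unfolding nondegenerate_form_def
proof (intro conjI allI impI)
  show "hyperbolic_form n i j = hyperbolic_form n j i" if "i < 2 * n" "j < 2 * n" for i j
    using that by (auto simp: hyperbolic_form_def hyperbolic_swap_def)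
  fix x :: "nat \<Rightarrow> 'a" and i
  assume x: "\<forall>y. (\<Sum>i<2 * n. \<Sum>j<2 * n. hyperbolic_form n i j * x i * y j) = 0" and i: "i < 2 * n"
  \<comment> \<open>The unit vector at the partner of \<open>i\<close> extracts the coordinate
    \<open>x i\<close>.\<close>
  define y :: "nat \<Rightarrow> 'a" where "y = (\<lambda>j. if j = hyperbolic_swap n i then 1 else 0)"
  have "(\<Sum>k<2 * n. \<Sum>j<2 * n. hyperbolic_form n k j * x k * y j) = (\<Sum>k<2 * n. x k * y (hyperbolic_swap n k))"
    by (simp add: hyperbolic_form_row)
  also have "\<dots> = (\<Sum>k<2 * n. if k = i then x k else 0)"
  proof (intro sum.cong refl)
    fix k assume "k \<in> {..<2 * n}"
    then have "hyperbolic_swap n k = hyperbolic_swap n i \<longleftrightarrow> k = i"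
      using i by (auto simp: hyperbolic_swap_def)
    then show "x k * y (hyperbolic_swap n k) = (if k = i then x k else 0)" by (simp add: y_def)
  qed
  also have "\<dots> = x i" using i by simp
  finally show "x i = 0" using x by simp
qed

section \<open>The slices of the three types\<close>

context configuration
begin

lemma config_residual_matrix:
  assumes "a < P" "nu a < Q" "P \<le> b" "b < N" "Q \<le> nu b"
  shows "config_residual (config_matrix f) P Q b a = f b a - (\<Sum>t | t < P \<and> Q \<le> nu t. f b t * f t a)"
proof -
  have "entry (config_matrix f) b t * entry (config_matrix f) t a = f b t * f t a" if "t < P" "Q \<le> nu t" for t
    using that assms by (auto simp: entry_config_matrix)
  then have "(\<Sum>t | t < P \<and> Q \<le> nu t. entry (config_matrix f) b t * entry (config_matrix f) t a) =
     (\<Sum>t | t < P \<and> Q \<le> nu t. f b t * f t a)"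
    by (intro sum.cong) auto
  then show ?thesis using assms by (simp add: config_residual_def entry_config_matrix)
qed

text \<open>The common criterion for matrices built from a cone. \<open>R\<close> is an explicit
  formula for the residuals: a nonzero value forces a rank difference at that box, and the product
  form makes all minors vanish.\<close>

lemma config_matrix_slice_schubert:
  assumes supp: "\<And>a b. a < N \<Longrightarrow> b < N \<Longrightarrow> a \<noteq> b \<Longrightarrow> f b a \<noteq> 0 \<Longrightarrow> a < b \<and> nu a < nu b"
    and le: "\<And>P Q. P \<le> N \<Longrightarrow> Q \<le> N \<Longrightarrow> one_line_rank om P Q \<le> one_line_rank nu P Q"
    and R: "\<And>P Q b a. a < P \<Longrightarrow> nu a < Q \<Longrightarrow> P \<le> b \<Longrightarrow> b < N \<Longrightarrow> Q \<le> nu b \<Longrightarrow>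
       f b a - (\<Sum>t | t < P \<and> Q \<le> nu t. f b t * f t a) = R P Q b a"
    and less: "\<And>P Q b a. a < P \<Longrightarrow> nu a < Q \<Longrightarrow> P \<le> b \<Longrightarrow> b < N \<Longrightarrow> Q \<le> nu b \<Longrightarrow> R P Q b a \<noteq> 0 \<Longrightarrow>
       one_line_rank om P Q + 1 \<le> one_line_rank nu P Q"
    and prod: "\<And>P Q. \<exists>\<rho> \<sigma>. \<forall>a b. a < P \<longrightarrow> nu a < Q \<longrightarrow> P \<le> b \<longrightarrow> b < N \<longrightarrow> Q \<le> nu b \<longrightarrow> R P Q b a = \<rho> b * \<sigma> a"
  shows "config_matrix f \<in> slice_schubert v w"
proof (rule slice_schubertI[OF config_matrix_slice])
  fix P Q assume PQ: "P \<le> N" "Q \<le> N"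
  show "one_line_rank om P Q \<le> one_line_rank nu P Q \<and>
        (\<forall>a b. a < P \<longrightarrow> nu a < Q \<longrightarrow> P \<le> b \<longrightarrow> b < N \<longrightarrow> Q \<le> nu b \<longrightarrow> config_residual (config_matrix f) P Q b a = 0) \<or>
      one_line_rank om P Q + 1 \<le> one_line_rank nu P Q \<and>
        (\<forall>a a' b b'. a < P \<longrightarrow> nu a < Q \<longrightarrow> a' < P \<longrightarrow> nu a' < Q \<longrightarrow>
           P \<le> b \<longrightarrow> b < N \<longrightarrow> Q \<le> nu b \<longrightarrow> P \<le> b' \<longrightarrow> b' < N \<longrightarrow> Q \<le> nu b' \<longrightarrow>
           config_residual (config_matrix f) P Q b a * config_residual (config_matrix f) P Q b' a' =
           config_residual (config_matrix f) P Q b a' * config_residual (config_matrix f) P Q b' a)"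
  proof (cases "\<exists>a b. a < P \<and> nu a < Q \<and> P \<le> b \<and> b < N \<and> Q \<le> nu b \<and> R P Q b a \<noteq> 0")
    case True
    then have "one_line_rank om P Q + 1 \<le> one_line_rank nu P Q" using less by blast
    moreover obtain \<rho> \<sigma> where "\<forall>a b. a < P \<longrightarrow> nu a < Q \<longrightarrow> P \<le> b \<longrightarrow> b < N \<longrightarrow> Q \<le> nu b \<longrightarrow> R P Q b a = \<rho> b * \<sigma> a"
      using prod[of P Q] by blast
    ultimately show ?thesis by (simp add: config_residual_matrix R)
  next
    case False
    then show ?thesis using le[OF PQ] by (auto simp: config_residual_matrix R)
  qed
qed (use supp in blast)+

text \<open>\<open>nu\<close> consists of two decreasing runs, the second with larger values, so
  free entries have their column in the first run and their row in the second. No path of two such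
  entries exists: residuals are plain entries, and the box \<open>(l + 1, l + 1)\<close> contains
  the full block.\<close>

lemma slice_4231:
  assumes lm: "l > 0" "m > 0" and N: "N = l + m + 2" and om: "om = om_4231 l m" and nu: "nu = nu_4231' l m"
  shows "isomorphic_spaces (rank_at_most_one_cone (l + 1) (m + 1))
     (coordinate_space (slice_schubert v w :: ('k::field, 'n) square_matrix set) matrix_entries)"
proof -
  \<comment> \<open>The block is stored transposed: columns of \<open>c\<close> become rows of
    \<open>A\<close>.\<close>
  define f :: "'k mat \<Rightarrow> nat \<Rightarrow> nat \<Rightarrow> 'k" where
    "f = (\<lambda>A b a. if a \<le> l \<and> l < b then A $$ (a, b - (l + 1)) else 0)"
  define g :: "(nat \<Rightarrow> nat \<Rightarrow> 'k) \<Rightarrow> 'k mat" where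
    "g = (\<lambda>M. Matrix.mat (l + 1) (m + 1) (\<lambda>(i, j). M (j + l + 1) i))"
  have nu_low: "nu a = l - a" if "a \<le> l" for a using that by (simp add: nu nu_4231'_def)
  have nu_high: "nu a = 2 * l + m + 2 - a" if "l < a" for a using that by (simp add: nu nu_4231'_def)
  have "isomorphic_spaces (coordinate_space (rank_one_matrices (l + 1) (m + 1)) (mat_coordinates (l + 1) (m + 1)))
     (coordinate_space (slice_schubert v w :: ('k, 'n) square_matrix set) matrix_entries)"
  proof (rule slice_isomorphism[where f = f and g = g])
    fix A :: "'k mat" assume A: "A \<in> rank_one_matrices (l + 1) (m + 1)"
    obtain \<alpha> \<beta> where ab: "\<And>i j. i < l + 1 \<Longrightarrow> j < m + 1 \<Longrightarrow> A $$ (i, j) = \<alpha> i * \<beta> j"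
      using rank_one_matricesE[OF A] by blast
    show "config_matrix (f A) \<in> slice_schubert v w"
    proof (rule config_matrix_slice_schubert[where R = "\<lambda>P Q b a. f A b a"])
      show "a < b \<and> nu a < nu b" if "a < N" "b < N" "f A b a \<noteq> 0" for a b
        using that by (auto simp: f_def N nu_low nu_high split: if_splits)
      show "one_line_rank om P Q \<le> one_line_rank nu P Q" if "P \<le> N" "Q \<le> N" for P Q
        using rank_4231(1)[OF lm, of P Q] that by (simp add: N om nu)
      show "f A b a - (\<Sum>t | t < P \<and> Q \<le> nu t. f A b t * f A t a) = f A b a" for P Q b a
        by (simp add: f_def sum.neutral)
      show "one_line_rank om P Q + 1 \<le> one_line_rank nu P Q"
        if "a < P" "nu a < Q" "P \<le> b" "b < N" "Q \<le> nu b" "f A b a \<noteq> 0" for P Q b a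
      proof -
        have "a \<le> l" "l < b" using that by (auto simp: f_def split: if_splits)
        then show ?thesis using that unfolding om nu
          by (intro rank_4231(2)[OF lm]) (auto simp: N nu_4231'_def)
      qed
      show "\<exists>\<rho> \<sigma>. \<forall>a b. a < P \<longrightarrow> nu a < Q \<longrightarrow> P \<le> b \<longrightarrow> b < N \<longrightarrow> Q \<le> nu b \<longrightarrow> f A b a = \<rho> b * \<sigma> a" for P Q
        by (intro exI[of _ "\<lambda>b. if l < b then \<beta> (b - (l + 1)) else 0"] exI[of _ "\<lambda>a. if a \<le> l then \<alpha> a else 0"])
           (auto simp: f_def ab N)
    qed
    show "g (entry (config_matrix (f A))) = A"
    proof (rule eq_matI)
      show "dim_row (g (entry (config_matrix (f A)))) = dim_row A" "dim_col (g (entry (config_matrix (f A)))) = dim_col A"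
        using A by (auto simp: g_def rank_one_matrices_def)
      fix i j assume "i < dim_row A" "j < dim_col A"
      then have ij: "i \<le> l" "j \<le> m" using A by (auto simp: rank_one_matrices_def)
      then have "entry (config_matrix (f A)) (j + l + 1) i = f A (j + l + 1) i"
        by (subst entry_config_matrix) (simp_all add: N)
      then show "g (entry (config_matrix (f A))) $$ (i, j) = A $$ (i, j)"
        using ij by (simp add: g_def f_def)
    qed
  next
    fix c :: "('k, 'n) square_matrix" assume c: "c \<in> slice_schubert v w"
    have s: "c \<in> pattern_matrices (slice_pattern v)" using c by (simp add: slice_schubert_def)
    have empty: "{t. t < l + 1 \<and> l + 1 \<le> nu t} = {}" by (auto simp: nu_low less_Suc_eq_le)
    have res: "config_residual c (l + 1) (l + 1) b a = entry c b a" for a b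
      unfolding config_residual_def empty by simp
    show "g (entry c) \<in> rank_one_matrices (l + 1) (m + 1)"
    proof (rule rank_one_matricesI)
      show "g (entry c) \<in> carrier_mat (l + 1) (m + 1)" by (simp add: g_def)
      fix i i' j j' assume ij: "i < i'" "i' < l + 1" "j < j'" "j' < m + 1"
      have "entry c (j + l + 1) i * entry c (j' + l + 1) i' = entry c (j + l + 1) i' * entry c (j' + l + 1) i"
        using slice_schubert_residual_minor[OF c, of "l + 1" "l + 1" i i' "j + l + 1" "j' + l + 1"]
          ij rank_4231(3)[OF lm order_refl order_refl]
        by (simp add: res[simplified] N nu_low nu_high om[symmetric] nu[symmetric])
      then show "g (entry c) $$ (i, j) * g (entry c) $$ (i', j') = g (entry c) $$ (i, j') * g (entry c) $$ (i', j)"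
        using ij by (simp add: g_def mult.commute)
    qed
    fix a b assume ab: "a < N" "b < N" "a \<noteq> b"
    show "f (g (entry c)) b a = entry c b a"
    proof (cases "a \<le> l \<and> l < b")
      case True
      then show ?thesis using ab by (simp add: f_def g_def N)
    next
      case False
      have "entry c b a = 0"
      proof (rule ccontr)
        assume "entry c b a \<noteq> 0"
        then have "a < b" "nu a < nu b" using slice_entry_support[OF s ab] by auto
        then show False using False ab by (auto simp: nu nu_4231'_def N split: if_splits)
      qed
      then show ?thesis using False by (auto simp: f_def)
    qed
  next
    fix e :: "'k mat \<Rightarrow> 'k" assume "e \<in> mat_coordinates (l + 1) (m + 1)"
    then obtain i j where e: "e = (\<lambda>A. A $$ (i, j))" "i < l + 1" "j < m + 1" unfolding mat_coordinates_def by blast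
    then show "\<exists>h\<in>polynomial_functions matrix_entries. \<forall>c\<in>slice_schubert v w. e (g (entry c)) = h c"
      by (intro bexI[OF _ polynomial_entry[of "j + l + 1" i]]) (simp add: g_def)
  next
    fix a b assume "a < N" "b < N" "a \<noteq> b"
    then show "(\<lambda>A. f A b a) \<in> polynomial_functions (mat_coordinates (l + 1) (m + 1))"
      by (cases "a \<le> l \<and> l < b") (auto simp: f_def N intro: polynomial_mat_coordinate polynomial_functions.const)
  qed
  then show ?thesis by (rule isomorphic_spaces_trans[OF rank_at_most_one_cone_iso])
qed

end

lemma polynomial_functions_if:
  "(b \<Longrightarrow> f \<in> polynomial_functions C) \<Longrightarrow> (\<not> b \<Longrightarrow> g \<in> polynomial_functions C) \<Longrightarrow>
    (\<lambda>x. if b then f x else g x) \<in> polynomial_functions C"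
  by (cases b) auto

context configuration
begin

text \<open>Increasing pairs of \<open>nu\<close> involve the first or the last position. The box
  \<open>(1, l + 3)\<close> kills the corner entry, and at \<open>(l + 3, 1)\<close> the residual of
  the corner is minus the full pairing of row \<open>l + 3\<close> with column 0. Other boxes see
  partial sums of this pairing at the corner.\<close>

lemma slice_star:
  assumes N: "N = l + 4" and om: "om = om_star l" and nu: "nu = nu_star l"
  shows "\<exists>Q. quadratic_cone (2 * l + 3) Q \<and> isomorphic_spaces Q
     (coordinate_space (slice_schubert v w :: ('k::field_char_0, 'n) square_matrix set) matrix_entries)"
proof -
  define Z :: "(nat \<Rightarrow> 'k) set" where
    "Z = {z. (\<forall>i\<ge>2 * l + 4. z i = 0) \<and> (\<Sum>i<l + 2. z i * z (i + (l + 2))) = 0}"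
  define C :: "((nat \<Rightarrow> 'k) \<Rightarrow> 'k) set" where "C = {(\<lambda>x. x i) | i. i < 2 * l + 4}"
  \<comment> \<open>The first \<open>l + 2\<close> coordinates fill column 0, the others row
    \<open>l + 3\<close>; the shifts pair coordinate \<open>i\<close> with
    \<open>i + (l + 2)\<close> at the pivot \<open>i + 1\<close>.\<close>
  define f :: "(nat \<Rightarrow> 'k) \<Rightarrow> nat \<Rightarrow> nat \<Rightarrow> 'k" where
    "f = (\<lambda>z b a. if a = 0 \<and> 1 \<le> b \<and> b \<le> l + 2 then z (b - 1)
       else if b = l + 3 \<and> 1 \<le> a \<and> a \<le> l + 2 then z (a + l + 1) else 0)"
  define g :: "(nat \<Rightarrow> nat \<Rightarrow> 'k) \<Rightarrow> nat \<Rightarrow> 'k" where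
    "g = (\<lambda>M i. if i < l + 2 then M (i + 1) 0 else if i < 2 * l + 4 then M (l + 3) (i - (l + 1)) else 0)"
  have nu0: "nu 0 = 0" and num: "\<And>a. 1 \<le> a \<Longrightarrow> a \<le> l + 2 \<Longrightarrow> nu a = l + 3 - a" and nul: "nu (l + 3) = l + 3"
    by (simp_all add: nu nu_star_def)
  have middle: "(\<Sum>t | 1 \<le> t \<and> t \<le> l + 2. h t) = (\<Sum>i<l + 2. h (i + 1))" for h :: "nat \<Rightarrow> 'k"
  proof -
    have "{t. 1 \<le> t \<and> t \<le> l + 2} = (\<lambda>i. i + 1) ` {..<l + 2}"
    proof (intro equalityI subsetI)
      fix t assume "t \<in> {t. 1 \<le> t \<and> t \<le> l + 2}"
      then show "t \<in> (\<lambda>i. i + 1) ` {..<l + 2}" by (intro image_eqI[of _ _ "t - 1"]) auto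
    qed auto
    then show ?thesis by (simp add: sum.reindex)
  qed
  have "isomorphic_spaces (coordinate_space Z C)
     (coordinate_space (slice_schubert v w :: ('k, 'n) square_matrix set) matrix_entries)"
  proof (rule slice_isomorphism[where f = f and g = g])
    fix z assume z: "z \<in> Z"
    define S where "S = (\<lambda>P Q. \<Sum>t | t < P \<and> Q \<le> nu t. f z (l + 3) t * f z t 0)"
    define R where "R = (\<lambda>P Q b a. f z b a - (if b = l + 3 \<and> a = 0 then S P Q else 0))"
    \<comment> \<open>A nonzero partial pairing needs a middle pivot \<open>t\<close> with
      \<open>t < P\<close> and \<open>Q \<le> l + 3 - t\<close>.\<close>
    have S_support: "2 \<le> P \<and> Q \<le> l + 2" if "S P Q \<noteq> 0" for P Q
    proof -
      obtain t where t: "t < P" "Q \<le> nu t" "f z (l + 3) t * f z t 0 \<noteq> 0"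
        using \<open>S P Q \<noteq> 0\<close> unfolding S_def by (metis (mono_tags, lifting) mem_Collect_eq sum.neutral)
      then have "1 \<le> t" "t \<le> l + 2" by (auto simp: f_def split: if_splits)
      then show ?thesis using t num[of t] by linarith
    qed
    \<comment> \<open>Here all middle pivots are counted, so the sum is the quadratic form at
      \<open>z\<close>.\<close>
    have S_full: "S P Q = 0" if "l + 3 \<le> P" "Q \<le> 1" for P Q
    proof -
      have "S P Q = (\<Sum>t | 1 \<le> t \<and> t \<le> l + 2. f z (l + 3) t * f z t 0)"
        unfolding S_def
      proof (rule sum.mono_neutral_right)
        show "{t. 1 \<le> t \<and> t \<le> l + 2} \<subseteq> {t. t < P \<and> Q \<le> nu t}" using that num by auto
      qed (auto simp: f_def)
      also have "\<dots> = (\<Sum>i<l + 2. z (i + (l + 2)) * z i)"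
        unfolding middle by (intro sum.cong) (auto simp: f_def add.commute add.left_commute)
      also have "\<dots> = 0" using z by (simp add: Z_def mult.commute)
      finally show ?thesis .
    qed
    have R_cases: "(a = 0 \<and> 1 \<le> b \<and> b \<le> l + 2) \<or> (b = l + 3 \<and> 1 \<le> a \<and> a \<le> l + 2) \<or> (a = 0 \<and> b = l + 3 \<and> S P Q \<noteq> 0)"
      if "R P Q b a \<noteq> 0" for P Q b a
      using that by (auto simp: R_def f_def split: if_splits)
    show "config_matrix (f z) \<in> slice_schubert v w"
    proof (rule config_matrix_slice_schubert[where R = R])
      show "a < b \<and> nu a < nu b" if "a < N" "b < N" "f z b a \<noteq> 0" for a b
        using that nu0 num nul by (auto simp: f_def split: if_splits)
      show "one_line_rank om P Q \<le> one_line_rank nu P Q" if "P \<le> N" "Q \<le> N" for P Q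
        using rank_star(1)[of P l Q] that by (simp add: N om nu)
      show "f z b a - (\<Sum>t | t < P \<and> Q \<le> nu t. f z b t * f z t a) = R P Q b a" for P Q b a
      proof (cases "b = l + 3 \<and> a = 0")
        case False
        then have "f z b t * f z t a = 0" for t by (auto simp: f_def)
        then have "(\<Sum>t | t < P \<and> Q \<le> nu t. f z b t * f z t a) = 0" by (simp only: sum.neutral_const)
        then show ?thesis using False by (auto simp: R_def)
      qed (simp add: R_def S_def)
      show "one_line_rank om P Q + 1 \<le> one_line_rank nu P Q"
        if block: "a < P" "nu a < Q" "P \<le> b" "b < N" "Q \<le> nu b" and nz: "R P Q b a \<noteq> 0" for P Q b a
      proof -
        from R_cases[OF nz] have "1 \<le> P \<and> P \<le> l + 3 \<and> 1 \<le> Q \<and> Q \<le> l + 3 \<and> (2 \<le> P \<or> Q \<le> l + 2) \<and> (2 \<le> Q \<or> P \<le> l + 2)"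
        proof (elim disjE)
          assume "a = 0 \<and> 1 \<le> b \<and> b \<le> l + 2"
          then show ?thesis using block nu0 num[of b] by auto
        next
          assume "b = l + 3 \<and> 1 \<le> a \<and> a \<le> l + 2"
          then show ?thesis using block nul num[of a] by auto
        next
          assume a: "a = 0 \<and> b = l + 3 \<and> S P Q \<noteq> 0"
          then have "\<not> (l + 3 \<le> P \<and> Q \<le> 1)" "2 \<le> P" "Q \<le> l + 2" using S_full S_support by blast+
          then show ?thesis using block a nul by auto
        qed
        then show ?thesis unfolding om nu using block by (intro rank_star(2)) (auto simp: N)
      qed
      show "\<exists>\<rho> \<sigma>. \<forall>a b. a < P \<longrightarrow> nu a < Q \<longrightarrow> P \<le> b \<longrightarrow> b < N \<longrightarrow> Q \<le> nu b \<longrightarrow> R P Q b a = \<rho> b * \<sigma> a" for P Q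
      proof (cases "\<exists>b. P \<le> b \<and> Q \<le> nu b \<and> 1 \<le> b \<and> b \<le> l + 2")
        case True
        \<comment> \<open>A middle row in the block excludes all middle columns, which would need
          \<open>P + Q \<ge> l + 5\<close>; so only column 0 can be nonzero. Without middle rows
          only row \<open>l + 3\<close> can.\<close>
        then have PQ: "P + Q \<le> l + 3" using num by fastforce
        have *: "R P Q b a = R P Q b 0 * (if a = 0 then 1 else 0)" if "a < P" "nu a < Q" for a b
        proof (cases "a = 0")
          case False
          have "R P Q b a = 0"
          proof (rule ccontr)
            assume "R P Q b a \<noteq> 0"
            then have "1 \<le> a" "a \<le> l + 2" using R_cases False by blast+
            then show False using that PQ num[of a] by linarith
          qed
          then show ?thesis using False by simp
        qed simp
        show ?thesis
          by (intro exI[of _ "\<lambda>b. R P Q b 0"] exI[of _ "\<lambda>a. if a = 0 then 1 else 0"] allI impI) (rule *; assumption)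
      next
        case False
        have *: "R P Q b a = (if b = l + 3 then 1 else 0) * R P Q (l + 3) a" if "P \<le> b" "Q \<le> nu b" for a b
        proof (cases "b = l + 3")
          case b: False
          have "R P Q b a = 0"
            using R_cases[of P Q b a] b False that by blast
          then show ?thesis using b by simp
        qed simp
        show ?thesis
          by (intro exI[of _ "\<lambda>b. if b = l + 3 then 1 else 0"] exI[of _ "R P Q (l + 3)"] allI impI) (rule *; assumption)
      qed
    qed
    show "g (entry (config_matrix (f z))) = z"
    proof
      fix i
      have e: "entry (config_matrix (f z)) b a = f z b a" if "a < N" "b < N" "a \<noteq> b" for a b
        using that by (simp add: entry_config_matrix)
      consider "i < l + 2" | "l + 2 \<le> i" "i < 2 * l + 4" | "2 * l + 4 \<le> i" by linarith
      then show "g (entry (config_matrix (f z))) i = z i"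
      proof cases
        case 1
        then have "entry (config_matrix (f z)) (i + 1) 0 = f z (i + 1) 0" by (intro e) (auto simp: N)
        then show ?thesis using 1 by (simp add: g_def f_def)
      next
        case 2
        then have "entry (config_matrix (f z)) (l + 3) (i - (l + 1)) = f z (l + 3) (i - (l + 1))"
          by (intro e) (auto simp: N)
        then show ?thesis using 2 by (auto simp: g_def f_def)
      next
        case 3
        then show ?thesis using z by (simp add: g_def Z_def)
      qed
    qed
  next
    fix c :: "('k, 'n) square_matrix" assume c: "c \<in> slice_schubert v w"
    have s: "c \<in> pattern_matrices (slice_pattern v)" using c by (simp add: slice_schubert_def)
    have corner: "entry c (l + 3) 0 = 0"
    proof -
      have empty: "{t. t < 1 \<and> l + 3 \<le> nu t} = {}" using nu0 by auto
      have "config_residual c 1 (l + 3) (l + 3) 0 = 0"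
        by (rule slice_schubert_residual_zero[OF c])
           (use rank_star(3)[of 0 l 0] nu0 nul in \<open>simp_all add: N om[symmetric] nu[symmetric]\<close>)
      then show ?thesis unfolding config_residual_def empty by simp
    qed
    have quadric: "(\<Sum>t | 1 \<le> t \<and> t \<le> l + 2. entry c (l + 3) t * entry c t 0) = 0"
    proof -
      have set: "{t. t < l + 3 \<and> 1 \<le> nu t} = {t. 1 \<le> t \<and> t \<le> l + 2}"
      proof (intro equalityI subsetI)
        fix t assume t: "t \<in> {t. t < l + 3 \<and> 1 \<le> nu t}"
        have "t \<noteq> 0"
        proof
          assume "t = 0"
          then show False using t nu0 by simp
        qed
        then show "t \<in> {t. 1 \<le> t \<and> t \<le> l + 2}" using t by auto
      qed (use num in auto)
      have "config_residual c (l + 3) 1 (l + 3) 0 = 0"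
        by (rule slice_schubert_residual_zero[OF c])
           (use rank_star(4)[of 0 l 0] nu0 nul in \<open>simp_all add: N om[symmetric] nu[symmetric]\<close>)
      then show ?thesis unfolding config_residual_def set using corner by simp
    qed
    show "g (entry c) \<in> Z"
    proof -
      have "(\<Sum>i<l + 2. g (entry c) i * g (entry c) (i + (l + 2))) = (\<Sum>i<l + 2. entry c (l + 3) (i + 1) * entry c (i + 1) 0)"
        by (intro sum.cong) (auto simp: g_def mult.commute)
      also have "\<dots> = 0" using quadric unfolding middle .
      finally show ?thesis by (simp add: Z_def g_def)
    qed
    fix a b assume ab: "a < N" "b < N" "a \<noteq> b"
    show "f (g (entry c)) b a = entry c b a"
    proof -
      have "a = 0 \<or> (1 \<le> a \<and> a \<le> l + 2) \<or> a = l + 3" "b = 0 \<or> (1 \<le> b \<and> b \<le> l + 2) \<or> b = l + 3"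
        using ab(1,2) unfolding N by linarith+
      moreover have "\<not> (a < b \<and> nu a < nu b)" if "1 \<le> a \<and> a \<le> l + 2" "1 \<le> b \<and> b \<le> l + 2"
        using that num[of a] num[of b] by linarith
      moreover have "\<not> l + 3 < b" using ab(2) N by linarith
      ultimately consider "a = 0" "1 \<le> b" "b \<le> l + 2" | "b = l + 3" "1 \<le> a" "a \<le> l + 2" | "a = 0" "b = l + 3"
        | "\<not> (a < b \<and> nu a < nu b)"
        using ab(3) by (metis less_nat_zero_code)
      then show ?thesis
      proof cases
        case 4
        then have "entry c b a = 0" using slice_entry_support[OF s ab] by blast
        moreover have "f (g (entry c)) b a = 0"
        proof (rule ccontr)
          assume "f (g (entry c)) b a \<noteq> 0"
          then have "a = 0 \<and> 1 \<le> b \<and> b \<le> l + 2 \<or> b = l + 3 \<and> 1 \<le> a \<and> a \<le> l + 2"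
            by (auto simp: f_def split: if_splits)
          then show False using 4 nu0 nul num[of a] num[of b] by auto
        qed
        ultimately show ?thesis by simp
      qed (auto simp: f_def g_def corner)
    qed
  next
    fix e assume "e \<in> C"
    then obtain i where e: "e = (\<lambda>x. x i)" "i < 2 * l + 4" unfolding C_def by blast
    show "\<exists>h\<in>polynomial_functions matrix_entries. \<forall>c\<in>slice_schubert v w. e (g (entry c)) = h c"
    proof (cases "i < l + 2")
      case True
      then show ?thesis
        by (intro bexI[OF _ polynomial_entry[of "i + 1" 0]]) (simp add: g_def e)
    next
      case False
      then show ?thesis using e(2)
        by (intro bexI[OF _ polynomial_entry[of "l + 3" "i - (l + 1)"]]) (simp add: g_def e(1))
    qed
  next
    fix a b assume "a < N" "b < N" "a \<noteq> b"
    have coord: "(\<lambda>z. z i) \<in> polynomial_functions C" if "i < 2 * l + 4" for i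
      using that unfolding C_def by (intro polynomial_functions.coord) blast
    show "(\<lambda>z. f z b a) \<in> polynomial_functions C"
      unfolding f_def by (intro polynomial_functions_if coord polynomial_functions.const) auto
  qed
  moreover define Q where "Q = subspace_of (affine_space (2 * l + 3 + 1))
       {x. (\<forall>i\<ge>2 * l + 3 + 1. x i = (0::'k)) \<and>
         (\<Sum>i<2 * l + 3 + 1. \<Sum>j<2 * l + 3 + 1. hyperbolic_form (l + 2) i j * x i * x j) = 0}"
  have dim: "2 * l + 3 + 1 = 2 * (l + 2)" and four: "2 * (l + 2) = 2 * l + 4" by simp_all
  have cone: "quadratic_cone (2 * l + 3) Q"
    unfolding quadratic_cone_def Q_def dim
    by (rule exI[of _ "hyperbolic_form (l + 2)"]) (simp only: nondegenerate_hyperbolic_form)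
  \<comment> \<open>The hyperbolic form is twice the pairing in \<open>Z\<close>, and 2 is nonzero
    in characteristic zero.\<close>
  have eq: "{x. (\<forall>i\<ge>2 * (l + 2). x i = (0::'k)) \<and>
      (\<Sum>i<2 * (l + 2). \<Sum>j<2 * (l + 2). hyperbolic_form (l + 2) i j * x i * x j) = 0} = Z"
    unfolding hyperbolic_form_value unfolding Z_def four by (simp only: mult_eq_0_iff zero_neq_numeral[symmetric] simp_thms)
  have "isomorphic_spaces Q (coordinate_space Z C)"
  proof -
    have "isomorphic_spaces (subspace_of (coordinate_space {x. \<forall>i\<ge>2 * l + 4. x i = 0} C) Z) (coordinate_space Z C)"
      by (rule subspace_of_coordinate_space) (auto simp: Z_def)
    moreover have "Q = subspace_of (coordinate_space {x. \<forall>i\<ge>2 * l + 4. x i = 0} C) Z"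
      unfolding Q_def dim eq unfolding affine_space_def C_def four ..
    ultimately show ?thesis by simp
  qed
  ultimately show ?thesis using cone isomorphic_spaces_trans by blast
qed

end

context configuration
begin

text \<open>Two boxes give rank at most one for the block of rows \<open>l + 1\<close>,
  \<open>l + 2\<close> and for the block of columns \<open>l + 1\<close>, \<open>l + 2\<close>. The
  other two kill the entries joining their outer indices and the pairings across the middle
  positions. After the sign change these pairings become the minors that mix both blocks.\<close>

lemma slice_empty:
  assumes N: "N = l + m + 4" and om: "om = om_empty l m" and nu: "nu = nu_empty l m"
  shows "isomorphic_spaces (rank_at_most_one_cone 2 (l + m + 2))
     (coordinate_space (slice_schubert v w :: ('k::field, 'n) square_matrix set) matrix_entries)"
proof -
  \<comment> \<open>Columns up to \<open>l\<close> of \<open>A\<close> fill the two middle rows. The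
    others fill the rows from \<open>l + 3\<close> on, shifted by 2, with the two middle columns
    exchanged and one sign changed.\<close>
  define f :: "'k mat \<Rightarrow> nat \<Rightarrow> nat \<Rightarrow> 'k" where
    "f = (\<lambda>A b a. if a \<le> l \<and> b = l + 1 then A $$ (0, a) else if a \<le> l \<and> b = l + 2 then A $$ (1, a)
       else if l + 3 \<le> b \<and> a = l + 2 then A $$ (0, b - 2)
       else if l + 3 \<le> b \<and> a = l + 1 then - A $$ (1, b - 2) else 0)"
  define g :: "(nat \<Rightarrow> nat \<Rightarrow> 'k) \<Rightarrow> 'k mat" where
    "g = (\<lambda>M. Matrix.mat 2 (l + m + 2) (\<lambda>(i, k). if k \<le> l then M (l + 1 + i) k
       else if i = 0 then M (k + 2) (l + 2) else - M (k + 2) (l + 1)))"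
  have nu_low: "nu a = l - a" if "a \<le> l" for a using that by (simp add: nu nu_empty_def)
  have nu1: "nu (l + 1) = l + 2" and nu2: "nu (l + 2) = l + 1" by (simp_all add: nu nu_empty_def)
  have nu_high: "nu a = 2 * l + m + 6 - a" if "l + 3 \<le> a" for a using that by (simp add: nu nu_empty_def)
  have type: "a \<le> l \<or> a = l + 1 \<or> a = l + 2 \<or> l + 3 \<le> a" for a :: nat by linarith
  have "isomorphic_spaces (coordinate_space (rank_one_matrices 2 (l + m + 2)) (mat_coordinates 2 (l + m + 2)))
     (coordinate_space (slice_schubert v w :: ('k, 'n) square_matrix set) matrix_entries)"
  proof (rule slice_isomorphism[where f = f and g = g])
    fix A :: "'k mat" assume A: "A \<in> rank_one_matrices 2 (l + m + 2)"
    obtain \<alpha> \<beta> where ab: "\<And>i j. i < 2 \<Longrightarrow> j < l + m + 2 \<Longrightarrow> A $$ (i, j) = \<alpha> i * \<beta> j"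
      using rank_one_matricesE[OF A] by blast
    have f1: "f A (l + 1) a = \<alpha> 0 * \<beta> a" "f A (l + 2) a = \<alpha> 1 * \<beta> a" if "a \<le> l" for a
      using that by (simp_all add: f_def ab)
    have f2: "f A b (l + 2) = \<alpha> 0 * \<beta> (b - 2)" "f A b (l + 1) = - (\<alpha> 1 * \<beta> (b - 2))" if "l + 3 \<le> b" "b < N" for b
      using that by (auto simp: f_def ab N)
    have f0: "f A b a = 0" if "\<not> (a \<le> l \<and> (b = l + 1 \<or> b = l + 2))" "\<not> (l + 3 \<le> b \<and> (a = l + 1 \<or> a = l + 2))" for a b
      using that by (auto simp: f_def)
    \<comment> \<open>An outer pair \<open>a \<le> l\<close>, \<open>l + 3 \<le> b\<close> is joined
      by paths through \<open>l + 1\<close> and \<open>l + 2\<close>, which contribute opposite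
      products. A path counts only if its middle point is an eliminated pivot, so \<epsilon>
      vanishes when both paths count or neither does.\<close>
    define \<epsilon> :: "nat \<Rightarrow> nat \<Rightarrow> 'k" where
      "\<epsilon> = (\<lambda>P Q. (if l + 1 < P \<and> Q \<le> l + 2 then 1 else 0) - (if l + 2 < P \<and> Q \<le> l + 1 then 1 else 0))"
    define R where "R = (\<lambda>P Q b a. if a \<le> l \<and> l + 3 \<le> b
        then \<epsilon> P Q * (\<alpha> 0 * \<alpha> 1) * (\<beta> (b - 2) * \<beta> a) else f A b a)"
    have path: "(\<Sum>t | t < P \<and> Q \<le> nu t. f A b t * f A t a) = - \<epsilon> P Q * (\<alpha> 0 * \<alpha> 1) * (\<beta> (b - 2) * \<beta> a)"
      if "a \<le> l" "l + 3 \<le> b" "b < N" for P Q b a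
    proof -
      have "(\<Sum>t | t < P \<and> Q \<le> nu t. f A b t * f A t a) =
          (\<Sum>t\<in>{t. t < P \<and> Q \<le> nu t} \<inter> {l + 1, l + 2}. f A b t * f A t a)"
      proof (rule sum.mono_neutral_right)
        show "\<forall>t\<in>{t. t < P \<and> Q \<le> nu t} - {t. t < P \<and> Q \<le> nu t} \<inter> {l + 1, l + 2}. f A b t * f A t a = 0"
          using that by (auto simp: f_def)
      qed auto
      also have "\<dots> = (\<Sum>t\<in>{l + 1, l + 2}. if t < P \<and> Q \<le> nu t then f A b t * f A t a else 0)"
        by (subst Int_commute, subst sum.inter_restrict) auto
      also have "\<dots> = (if l + 1 < P \<and> Q \<le> l + 2 then f A b (l + 1) * f A (l + 1) a else 0) +
          (if l + 2 < P \<and> Q \<le> l + 1 then f A b (l + 2) * f A (l + 2) a else 0)"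
        by (simp add: nu1[simplified] nu2[simplified])
      also have "\<dots> = - \<epsilon> P Q * (\<alpha> 0 * \<alpha> 1) * (\<beta> (b - 2) * \<beta> a)"
        unfolding f1[OF that(1)] f2[OF that(2,3)] \<epsilon>_def by (simp add: algebra_simps)
      finally show ?thesis .
    qed
    show "config_matrix (f A) \<in> slice_schubert v w"
    proof (rule config_matrix_slice_schubert[where R = R])
      show "a < b \<and> nu a < nu b" if "a < N" "b < N" "f A b a \<noteq> 0" for a b
        using that nu1 nu2 by (auto simp: f_def N nu_low nu_high split: if_splits)
      show "one_line_rank om P Q \<le> one_line_rank nu P Q" if "P \<le> N" "Q \<le> N" for P Q
        using rank_empty(1)[of P l m Q] that by (simp add: N om nu)
      show "f A b a - (\<Sum>t | t < P \<and> Q \<le> nu t. f A b t * f A t a) = R P Q b a" if "b < N" for P Q b a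
      proof (cases "a \<le> l \<and> l + 3 \<le> b")
        case True
        then have "f A b a = 0" by (simp add: f0)
        then show ?thesis using True path[of a b P Q] that by (simp add: R_def)
      next
        case False
        have "f A b t * f A t a = 0" for t
          using False by (auto simp: f_def)
        then have "(\<Sum>t | t < P \<and> Q \<le> nu t. f A b t * f A t a) = 0" by (simp only: sum.neutral_const)
        then show ?thesis using False by (auto simp: R_def)
      qed
      show "one_line_rank om P Q + 1 \<le> one_line_rank nu P Q"
        if block: "a < P" "nu a < Q" "P \<le> b" "b < N" "Q \<le> nu b" and nz: "R P Q b a \<noteq> 0" for P Q b a
      proof -
        have region: "(1 \<le> P \<and> P \<le> l + 2 \<and> 1 \<le> Q \<and> Q \<le> l + 2 \<and> l + 2 \<le> P + Q) \<or>
           (l + 2 \<le> P \<and> P \<le> l + m + 3 \<and> l + 2 \<le> Q \<and> Q \<le> l + m + 3 \<and> P + Q \<le> 2 * l + m + 6)"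
        proof (cases "a \<le> l \<and> l + 3 \<le> b")
          case True
          then have "\<epsilon> P Q \<noteq> 0" using nz by (auto simp: R_def)
          \<comment> \<open>Exactly one of the two paths counts, namely that through
            \<open>l + 1\<close>; this leaves the boxes with \<open>P = l + 2\<close> or
            \<open>Q = l + 2\<close>.\<close>
          then have "l + 1 < P \<and> Q \<le> l + 2 \<and> (P = l + 2 \<or> Q = l + 2)"
            unfolding \<epsilon>_def by (auto split: if_splits)
          then show ?thesis using block True nu_low[of a] nu_high[of b] by (auto simp: N)
        next
          case False
          then have "f A b a \<noteq> 0" using nz by (auto simp: R_def split: if_splits)
          then have "a \<le> l \<and> (b = l + 1 \<or> b = l + 2) \<or> l + 3 \<le> b \<and> (a = l + 1 \<or> a = l + 2)" using f0 by blast
          then show ?thesis using block nu_low[of a] nu_high[of b] nu1 nu2 by (auto simp: N)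
        qed
        have "P \<le> l + m + 4" "Q \<le> l + m + 4" using block nu_less[of b] by (auto simp: N)
        then show ?thesis using region rank_empty(2,3)[of P l m Q] unfolding om nu by blast
      qed
      show "\<exists>\<rho> \<sigma>. \<forall>a b. a < P \<longrightarrow> nu a < Q \<longrightarrow> P \<le> b \<longrightarrow> b < N \<longrightarrow> Q \<le> nu b \<longrightarrow> R P Q b a = \<rho> b * \<sigma> a" for P Q
      \<comment> \<open>If a middle row meets the block, no middle column does, and the values of
        \<beta> at the column factor out; otherwise no middle row occurs and the values of \<beta>
        at the row factor out.\<close>
      proof (cases "\<exists>b\<in>{l + 1, l + 2}. P \<le> b \<and> Q \<le> nu b")
        case True
        let ?\<rho> = "\<lambda>b. (if b = l + 1 then \<alpha> 0 else if b = l + 2 then \<alpha> 1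
             else if l + 3 \<le> b then \<epsilon> P Q * (\<alpha> 0 * \<alpha> 1) * \<beta> (b - 2) else 0)" and ?\<sigma> = "\<lambda>a. (if a \<le> l then \<beta> a else 0)"
        have *: "R P Q b a = ?\<rho> b * ?\<sigma> a"
          if block: "a < P" "nu a < Q" "b < N" for a b
        proof -
          have "a \<noteq> l + 1" "a \<noteq> l + 2" using block True nu1 nu2 by auto
          then show ?thesis using f1[of a] type[of b] by (auto simp: R_def f0)
        qed
        show ?thesis by (intro exI[of _ ?\<rho>] exI[of _ ?\<sigma>] allI impI) (rule *; assumption)
      next
        case False
        let ?\<rho> = "\<lambda>b. (if l + 3 \<le> b then \<beta> (b - 2) else 0)" and ?\<sigma> = "\<lambda>a. (if a \<le> l then \<epsilon> P Q * (\<alpha> 0 * \<alpha> 1) * \<beta> a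
             else if a = l + 1 then - \<alpha> 1 else if a = l + 2 then \<alpha> 0 else 0)"
        have *: "R P Q b a = ?\<rho> b * ?\<sigma> a"
          if block: "P \<le> b" "Q \<le> nu b" "b < N" for a b
        proof -
          have "b \<noteq> l + 1" "b \<noteq> l + 2" using block False by auto
          then show ?thesis using f2[of b] type[of b] type[of a] block(3) by (auto simp: R_def f0)
        qed
        show ?thesis by (intro exI[of _ ?\<rho>] exI[of _ ?\<sigma>] allI impI) (rule *; assumption)
      qed
    qed
    show "g (entry (config_matrix (f A))) = A"
    proof (rule eq_matI)
      show "dim_row (g (entry (config_matrix (f A)))) = dim_row A" "dim_col (g (entry (config_matrix (f A)))) = dim_col A"
        using A by (auto simp: g_def rank_one_matrices_def)
      have e: "entry (config_matrix (f A)) b a = f A b a" if "a < N" "b < N" "a \<noteq> b" for a b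
        using that by (simp add: entry_config_matrix)
      fix i k assume "i < dim_row A" "k < dim_col A"
      then have ik: "i = 0 \<or> i = 1" "k < l + m + 2" using A by (auto simp: rank_one_matrices_def)
      show "g (entry (config_matrix (f A))) $$ (i, k) = A $$ (i, k)"
      proof (cases "k \<le> l")
        case True
        then have "entry (config_matrix (f A)) (l + 1 + i) k = f A (l + 1 + i) k"
          using ik by (intro e) (auto simp: N)
        then show ?thesis using True ik by (auto simp: g_def f_def)
      next
        case False
        have "entry (config_matrix (f A)) (k + 2) (l + 2) = f A (k + 2) (l + 2)"
          "entry (config_matrix (f A)) (k + 2) (l + 1) = f A (k + 2) (l + 1)"
          by (rule e; use ik False in \<open>simp add: N\<close>)+
        then show ?thesis using False ik by (auto simp: g_def f_def)
      qed
    qed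
  next
    fix c :: "('k, 'n) square_matrix" assume c: "c \<in> slice_schubert v w"
    have s: "c \<in> pattern_matrices (slice_pattern v)" using c by (simp add: slice_schubert_def)
    have far: "entry c b a = 0" if "a \<le> l" "l + 3 \<le> b" "b < N" for a b
    proof -
      have empty: "{t. t < l + 1 \<and> l + 3 \<le> nu t} = {}" using nu_low by auto
      have "config_residual c (l + 1) (l + 3) b a = 0"
        by (rule slice_schubert_residual_zero[OF c])
           (use rank_empty(6)[of 0 l m 0] nu_low[of a] nu_high[of b] that in \<open>simp_all add: N om[symmetric] nu[symmetric]\<close>)
      then show ?thesis unfolding config_residual_def empty by simp
    qed
    have orth: "entry c b (l + 1) * entry c (l + 1) a + entry c b (l + 2) * entry c (l + 2) a = 0"
      if "a \<le> l" "l + 3 \<le> b" "b < N" for a b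
    proof -
      have set: "{t. t < l + 3 \<and> l + 1 \<le> nu t} = {l + 1, l + 2}"
      proof (intro equalityI subsetI)
        fix t assume t: "t \<in> {t. t < l + 3 \<and> l + 1 \<le> nu t}"
        then show "t \<in> {l + 1, l + 2}" using type[of t] nu_low[of t] by auto
      qed (use nu1 nu2 in auto)
      have "config_residual c (l + 3) (l + 1) b a = 0"
        by (rule slice_schubert_residual_zero[OF c])
           (use rank_empty(7)[of 0 l m 0] nu_low[of a] nu_high[of b] that in \<open>simp_all add: N om[symmetric] nu[symmetric]\<close>)
      then show ?thesis unfolding config_residual_def set using far[OF that] by (simp add: add_eq_0_iff)
    qed
    have low: "entry c (l + 1) a * entry c (l + 2) a' = entry c (l + 1) a' * entry c (l + 2) a" if "a \<le> l" "a' \<le> l" for a a'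
    proof -
      have empty: "{t. t < l + 1 \<and> l + 1 \<le> nu t} = {}" using nu_low by auto
      have "config_residual c (l + 1) (l + 1) (l + 1) a * config_residual c (l + 1) (l + 1) (l + 2) a' =
          config_residual c (l + 1) (l + 1) (l + 1) a' * config_residual c (l + 1) (l + 1) (l + 2) a"
        by (rule slice_schubert_residual_minor[OF c])
           (use rank_empty(4)[of 0 l m 0] nu_low[of a] nu_low[of a'] nu1 nu2 that in \<open>simp_all add: N om[symmetric] nu[symmetric]\<close>)
      then show ?thesis unfolding config_residual_def empty by simp
    qed
    have high: "entry c b (l + 1) * entry c b' (l + 2) = entry c b (l + 2) * entry c b' (l + 1)"
      if "l + 3 \<le> b" "b < N" "l + 3 \<le> b'" "b' < N" for b b'
    proof -
      have empty: "{t. t < l + 3 \<and> l + 3 \<le> nu t} = {}"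
      proof -
        have "nu t < l + 3" if "t < l + 3" for t using type[of t] nu_low[of t] nu1 nu2 that by auto
        then show ?thesis by (auto simp: not_le)
      qed
      have "config_residual c (l + 3) (l + 3) b (l + 1) * config_residual c (l + 3) (l + 3) b' (l + 2) =
          config_residual c (l + 3) (l + 3) b (l + 2) * config_residual c (l + 3) (l + 3) b' (l + 1)"
        by (rule slice_schubert_residual_minor[OF c])
           (use rank_empty(5)[of 0 l m 0] nu_high[of b] nu_high[of b'] nu1 nu2 that in \<open>simp_all add: N om[symmetric] nu[symmetric]\<close>)
      then show ?thesis unfolding config_residual_def empty by simp
    qed
    show "g (entry c) \<in> rank_one_matrices 2 (l + m + 2)"
    proof (rule rank_one_matricesI)
      show "g (entry c) \<in> carrier_mat 2 (l + m + 2)" by (simp add: g_def)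
      fix i i' k k' :: nat assume ik: "i < i'" "i' < 2" "k < k'" "k' < l + m + 2"
      then have i: "i = 0" "i' = 1" by auto
      consider "k' \<le> l" | "k \<le> l" "l < k'" | "l < k" by linarith
      then show "g (entry c) $$ (i, k) * g (entry c) $$ (i', k') = g (entry c) $$ (i, k') * g (entry c) $$ (i', k)"
      proof cases
        case 1
        then show ?thesis using ik low[of k k'] by (simp add: g_def i)
      next
        case 2
        \<comment> \<open>A minor with one column from each block is the pairing across the middle
          positions, because of the sign in \<open>g\<close>.\<close>
        have "k' + 2 < N" using ik by (simp add: N)
        then have "entry c (k' + 2) (l + 1) * entry c (l + 1) k + entry c (k' + 2) (l + 2) * entry c (l + 2) k = 0"
          using 2 by (intro orth) auto
        then have "- (entry c (k' + 2) (l + 1) * entry c (l + 1) k) = entry c (k' + 2) (l + 2) * entry c (l + 2) k"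
          by (rule minus_unique)
        then show ?thesis using ik 2 by (simp add: g_def i mult.commute)
      next
        case 3
        have "entry c (k + 2) (l + 1) * entry c (k' + 2) (l + 2) = entry c (k + 2) (l + 2) * entry c (k' + 2) (l + 1)"
          using 3 ik by (intro high) (auto simp: N)
        then show ?thesis using ik 3 by (simp add: g_def i mult.commute)
      qed
    qed
    fix a b assume ab: "a < N" "b < N" "a \<noteq> b"
    consider "a \<le> l" "b = l + 1" | "a \<le> l" "b = l + 2" | "l + 3 \<le> b" "a = l + 2" | "l + 3 \<le> b" "a = l + 1"
      | "a \<le> l" "l + 3 \<le> b" | "\<not> (a < b \<and> nu a < nu b)"
    proof -
      have "\<not> (a < b \<and> nu a < nu b)" if "l + 3 \<le> a" using that nu_high[of a] nu_high[of b] by linarith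
      moreover have "\<not> (a < b \<and> nu a < nu b)" if "b \<le> l" using that nu_low[of a] nu_low[of b] by linarith
      moreover have "\<not> (a < b \<and> nu a < nu b)" if "a = l + 1 \<or> a = l + 2" "b = l + 1 \<or> b = l + 2"
        using that nu1 nu2 by auto
      ultimately show ?thesis using that type[of a] type[of b] by blast
    qed
    moreover have shift: "Suc (Suc (b - 2)) = b" if "l + 3 \<le> b" using that by simp
    ultimately show "f (g (entry c)) b a = entry c b a"
    proof cases
      case 6
      then have "entry c b a = 0" using slice_entry_support[OF s ab] by blast
      moreover have "f (g (entry c)) b a = 0"
      proof (rule ccontr)
        assume "f (g (entry c)) b a \<noteq> 0"
        then have "a \<le> l \<and> (b = l + 1 \<or> b = l + 2) \<or> l + 3 \<le> b \<and> (a = l + 1 \<or> a = l + 2)"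
          by (auto simp: f_def split: if_splits)
        then show False using 6 ab nu_low[of a] nu_high[of b] nu1 nu2 by (auto simp: N)
      qed
      ultimately show ?thesis by simp
    qed (use ab far[of a b] in \<open>auto simp: f_def g_def N shift\<close>)
  next
    fix e :: "'k mat \<Rightarrow> 'k" assume "e \<in> mat_coordinates 2 (l + m + 2)"
    then obtain i k where e: "e = (\<lambda>A. A $$ (i, k))" "i < 2" "k < l + m + 2" unfolding mat_coordinates_def by blast
    show "\<exists>h\<in>polynomial_functions matrix_entries. \<forall>c\<in>slice_schubert v w. e (g (entry c)) = h c"
    proof (cases "k \<le> l")
      case True
      then show ?thesis using e
        by (intro bexI[OF _ polynomial_entry[of "l + 1 + i" k]]) (simp add: g_def)
    next
      case False
      show ?thesis
      proof (cases "i = 0")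
        case True
        then show ?thesis using e \<open>\<not> k \<le> l\<close>
          by (intro bexI[OF _ polynomial_entry[of "k + 2" "l + 2"]]) (simp add: g_def)
      next
        case False
        then show ?thesis using e \<open>\<not> k \<le> l\<close>
          by (intro bexI[OF _ polynomial_functions_uminus[OF polynomial_entry[of "k + 2" "l + 1"]]]) (simp add: g_def)
      qed
    qed
  next
    fix a b assume ab: "a < N" "b < N" "a \<noteq> b"
    have coord: "(\<lambda>A. A $$ (i, k)) \<in> polynomial_functions (mat_coordinates 2 (l + m + 2) :: ('k mat \<Rightarrow> 'k) set)"
      if "i < 2" "k < l + m + 2" for i k
      using that by (rule polynomial_mat_coordinate)
    show "(\<lambda>A. f A b a) \<in> polynomial_functions (mat_coordinates 2 (l + m + 2))"
      unfolding f_def using ab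
      by (intro polynomial_functions_if coord polynomial_functions.const polynomial_functions_uminus) (auto simp: N)
  qed
  then show ?thesis by (rule isomorphic_spaces_trans[OF rank_at_most_one_cone_iso])
qed

end

section \<open>Minimal configurations in one-line notation\<close>

lemma configuration_from_minimal:
  assumes mc: "minimal_configuration om nu w v" and "bij v" "bij w"
    and om: "length om = N" "\<And>a. a < N \<Longrightarrow> om ! a = om' a + 1" "\<And>a. a < N \<Longrightarrow> om' a < N"
    and nu: "\<And>a. a < N \<Longrightarrow> nu ! a = nu' a + 1" "\<And>a. a < N \<Longrightarrow> nu' a < N"
    and chain: "\<And>a b d e. a < b \<Longrightarrow> b < d \<Longrightarrow> d < e \<Longrightarrow> e < N \<Longrightarrow>
      nu' a < nu' b \<Longrightarrow> nu' b < nu' d \<Longrightarrow> nu' d < nu' e \<Longrightarrow> False"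
  obtains x y where "configuration v w N x y om' nu'"
proof -
  obtain xs ys where xs: "sorted_wrt (<) xs" "length xs = N" and ys: "sorted_wrt (<) ys" "length ys = N"
    and wv: "\<forall>a<N. w (xs ! a) = ys ! (om ! a - 1) \<and> v (xs ! a) = ys ! (nu ! a - 1)"
    and out: "\<forall>i. i \<notin> set xs \<longrightarrow> v i = w i"
    and min: "\<forall>i. i \<notin> set xs \<longrightarrow> \<not> rank_function v i (w i) > rank_function w i (w i)"
    using mc om(1) unfolding minimal_configuration_def by blast
  have "set xs = (!) xs ` {..<N}" using xs(2) by (auto simp: set_conv_nth)
  then have "configuration v w N ((!) xs) ((!) ys) om' nu'"
    using assms(2,3) xs ys wv out min om nu chain
    by unfold_locales (auto simp: sorted_wrt_nth_less)
  then show ?thesis by (rule that)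
qed

lemma length_decreasing_run [simp]: "length (decreasing_run a b) = Suc a - b"
  by (simp add: decreasing_run_def del: upt_Suc)

lemma nth_decreasing_run [simp]: "k < Suc a - b \<Longrightarrow> decreasing_run a b ! k = a - k"
  unfolding decreasing_run_def by (simp add: rev_nth del: upt_Suc)

text \<open>The last clause locates the increasing pairs of \<open>nu\<close>. It is the source of
  \<open>no_long_chain\<close>, and likewise for the other two types.\<close>

lemma one_line_4231:
  assumes "l > 0" "m > 0"
  shows "length (omega_4231 l m) = l + m + 2"
    "a < l + m + 2 \<Longrightarrow> omega_4231 l m ! a = om_4231 l m a + 1" "a < l + m + 2 \<Longrightarrow> om_4231 l m a < l + m + 2"
    "a < l + m + 2 \<Longrightarrow> nu_4231 l m ! a = nu_4231' l m a + 1" "a < l + m + 2 \<Longrightarrow> nu_4231' l m a < l + m + 2"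
    "a < b \<Longrightarrow> b < l + m + 2 \<Longrightarrow> nu_4231' l m a < nu_4231' l m b \<Longrightarrow> a \<le> l \<and> l < b"
  using assms
  by (auto simp: omega_4231_def nu_4231_def om_4231_def nu_4231'_def Let_def nth_append nth_Cons' split: if_splits)

lemma one_line_34_star_12:
  "length (omega_34_star_12 l) = l + 4"
  "a < l + 4 \<Longrightarrow> omega_34_star_12 l ! a = om_star l a + 1" "a < l + 4 \<Longrightarrow> om_star l a < l + 4"
  "a < l + 4 \<Longrightarrow> nu_34_star_12 l ! a = nu_star l a + 1" "a < l + 4 \<Longrightarrow> nu_star l a < l + 4"
  "a < b \<Longrightarrow> b < l + 4 \<Longrightarrow> nu_star l a < nu_star l b \<Longrightarrow> a = 0 \<or> b = l + 3"
  by (auto simp: omega_34_star_12_def nu_34_star_12_def om_star_def nu_star_def Let_def nth_append nth_Cons' split: if_splits)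

lemma one_line_34_empty_12:
  "length (omega_34_empty_12 l m) = l + m + 4"
  "a < l + m + 4 \<Longrightarrow> omega_34_empty_12 l m ! a = om_empty l m a + 1" "a < l + m + 4 \<Longrightarrow> om_empty l m a < l + m + 4"
  "a < l + m + 4 \<Longrightarrow> nu_34_empty_12 l m ! a = nu_empty l m a + 1" "a < l + m + 4 \<Longrightarrow> nu_empty l m a < l + m + 4"
  "a < b \<Longrightarrow> b < l + m + 4 \<Longrightarrow> nu_empty l m a < nu_empty l m b \<Longrightarrow> a \<le> l \<and> l < b \<or> a \<le> l + 2 \<and> l + 3 \<le> b"
  by (auto simp: omega_34_empty_12_def nu_34_empty_12_def om_empty_def nu_empty_def Let_def nth_append nth_Cons' split: if_splits)

theorem mainTheorem1:
  fixes V :: "('k::{alg_closed_field,field_char_0}, 'n::{finite,linorder}) flag"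
    and v w :: "'n \<Rightarrow> 'n"
  assumes "V \<in> complete_flags"
    and "bij v" and "bij w"
    and "component_of_singular_locus V w v"
  shows "isomorphic_spaces (subspace_of flag_variety (schubert_cell V v))
           (affine_space (inversions v) :: (nat \<Rightarrow> 'k, 'k) space_with_functions) \<and>
    (\<forall>l m. l > 0 \<and> m > 0 \<and> minimal_configuration (omega_4231 l m) (nu_4231 l m) w v \<longrightarrow>
       locally_cell_times V w v (rank_at_most_one_cone (l + 1) (m + 1))) \<and>
    (\<forall>l. minimal_configuration (omega_34_star_12 l) (nu_34_star_12 l) w v \<longrightarrow>
       (\<exists>Q. quadratic_cone (2 * l + 3) Q \<and> locally_cell_times V w v Q)) \<and>
    (\<forall>l m. minimal_configuration (omega_34_empty_12 l m) (nu_34_empty_12 l m) w v \<longrightarrow>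
       locally_cell_times V w v (rank_at_most_one_cone 2 (l + m + 2)))"
proof -
  obtain g1 G :: "('k, 'n) square_matrix" where g1: "flag_chart g1 G"
    and V: "\<And>q. V q = (*v) g1 ` coord_subspace {j. v j \<le> q}"
    using exists_adapted_matrix[OF assms(1,2)] by blast
  interpret schubert_chart g1 G v V
    using g1 V assms(1,2) by (intro schubert_chart.intro schubert_chart_axioms.intro)
  show ?thesis
  proof (intro conjI allI impI)
    show "isomorphic_spaces (subspace_of flag_variety (schubert_cell V v))
           (affine_space (inversions v) :: (nat \<Rightarrow> 'k, 'k) space_with_functions)"
      by (rule cell_is_affine_space)
  next
    fix l m assume mc: "l > 0 \<and> m > 0 \<and> minimal_configuration (omega_4231 l m) (nu_4231 l m) w v"
    then have lm: "l > 0" "m > 0" by auto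
    obtain x y where "configuration v w (l + m + 2) x y (om_4231 l m) (nu_4231' l m)"
    proof (rule configuration_from_minimal[OF _ assms(2,3) one_line_4231(1-5)[OF lm]])
      show "minimal_configuration (omega_4231 l m) (nu_4231 l m) w v" using mc by blast
      fix a b d e assume "a < b" "b < d" "d < e" "e < l + m + 2"
        "nu_4231' l m a < nu_4231' l m b" "nu_4231' l m b < nu_4231' l m d"
      \<comment> \<open>The middle element of two consecutive increases would belong to both
        decreasing runs.\<close>
      then have "l < b" "b \<le> l"
        using one_line_4231(6)[OF lm, of a b] one_line_4231(6)[OF lm, of b d] by auto
      then show False by simp
    qed
    from configuration.slice_4231[OF this lm refl refl refl]
    show "locally_cell_times V w v (rank_at_most_one_cone (l + 1) (m + 1))" by (rule locally_cell_timesI)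
  next
    fix l assume mc: "minimal_configuration (omega_34_star_12 l) (nu_34_star_12 l) w v"
    obtain x y where "configuration v w (l + 4) x y (om_star l) (nu_star l)"
    proof (rule configuration_from_minimal[OF mc assms(2,3) one_line_34_star_12(1-5)])
      fix a b d e assume "a < b" "b < d" "d < e" "e < l + 4"
        "nu_star l b < nu_star l d" "nu_star l d < nu_star l e"
      \<comment> \<open>\<open>b\<close> is not the first position because \<open>a < b\<close>, so
        the increase from \<open>b\<close> to \<open>d\<close> must end at the last position, which
        leaves no room for \<open>e\<close>.\<close>
      then have "d = l + 3" "d < l + 3" using one_line_34_star_12(6)[of b d l] by auto
      then show False by simp
    qed
    from configuration.slice_star[OF this refl refl refl]
    show "\<exists>Q. quadratic_cone (2 * l + 3) Q \<and> locally_cell_times V w v Q"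
      using locally_cell_timesI by blast
  next
    fix l m assume mc: "minimal_configuration (omega_34_empty_12 l m) (nu_34_empty_12 l m) w v"
    obtain x y where "configuration v w (l + m + 4) x y (om_empty l m) (nu_empty l m)"
    proof (rule configuration_from_minimal[OF mc assms(2,3) one_line_34_empty_12(1-5)])
      fix a b d e assume "a < b" "b < d" "d < e" "e < l + m + 4"
        "nu_empty l m a < nu_empty l m b" "nu_empty l m b < nu_empty l m d" "nu_empty l m d < nu_empty l m e"
      \<comment> \<open>The first increase leaves the initial run, the second then ends at
        \<open>l + 3\<close> or later, and from there no further increase starts.\<close>
      then have "l < b" "l + 3 \<le> d" "d \<le> l + 2"
        using one_line_34_empty_12(6)[of a b l m] one_line_34_empty_12(6)[of b d l m]
          one_line_34_empty_12(6)[of d e l m] by auto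
      then show False by simp
    qed
    from configuration.slice_empty[OF this refl refl refl]
    show "locally_cell_times V w v (rank_at_most_one_cone 2 (l + m + 2))" by (rule locally_cell_timesI)
  qed
qed

end
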